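(* Let $r\in\{1,2\}$. (a) There are constants $C,C'\in(0,\infty)$ depending only on $r$ such that for every $1\le p<\infty$, every strictly increasing sequence $\Lambda=\{\lambda_n\}_{n\in\mathbb Z}\subset\mathbb R$ and $I=\bigcup_{n\in\mathbb Z}[\lambda_n,\lambda_{n+1}]$, $$C\,\|f\|_{\mathrm{eq},L}\le \|f\|_{L_p^r(I)|_\Lambda}\le C'\,\|f\|_{\mathrm{eq},L}\qquad\text{for all } f\in L_p^r(I)|_\Lambda .$$ Moreover, $\Phi_r: L_p^r(I)|_\Lambda\to L_p^r(I)$ is a quasi-optimal interpolator, and its operator norm satisfies $\|\Phi_r\|\le C''$ with $C''$ depending only on $r$. (b) Let $K>0$. There are constants $C,C'\in(0,\infty)$ depending only on $r$ and $K$ such that for every $1\le p<\infty$, every strictly increasing sequence $\Lambda=\{\lambda_n\}_{n\in\mathbb Z}\subset\mathbb R$ with $\lambda_{n+1}-\lambda_n\le K$ for all $n\in\mathbb Z$, and $I=\bigcup_{n\in\mathbb Z}[\lambda_n,\lambda_{n+1}]$, $$C\,\|f\|_{\mathrm{eq},W}\le \|f\|_{W_p^r(I)|_\Lambda}\le C'\,\|f\|_{\mathrm{eq},W}\qquad\text{for all } f\in W_p^r(I)|_\Lambda .$$ Moreover, $\Phi_r: W_p^r(I)|_\Lambda\to W_p^r(I)$ is a quasi-optimal interpolator, and its operator norm satisfies $\|\Phi_r\|\le C''$ with $C''$ depending only on $r$ and $K$.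
   Context: Sobolev spaces. For an interval $I\subset\mathbb R$ (possibly infinite), an integer $r\ge1$ and $1\le p<\infty$, $W_p^r(I)$ is the completion of the space of complex functions $F\in\mathcal C^\infty(I)$ for which $\|F\|_{W_p^r(I)}^p=\int_I|F(x)|^p\,dx+\int_I|F^{(r)}(x)|^p\,dx$ is finite. $L_p^r(I)$ is the space of complex functions on $I$ with finite seminorm $\|F\|_{L_p^r(I)}^p=\int_I|F^{(r)}(x)|^p\,dx$. Elements of both spaces are identified with functions $F$ such that $F,\dots,F^{(r-1)}$ are continuous and $F^{(r-1)}$ is (locally) absolutely continuous. Trace spaces. For $\mathbb X=W_p^r(I)$ or $L_p^r(I)$ and $\Lambda\subset I$, $\mathbb X|_\Lambda=\{F|_\Lambda: F\in\mathbb X\}$, with the norm (or seminorm) $\|f\|_{\mathbb X|_\Lambda}=\inf\{\|F\|_{\mathbb X}: F\in\mathbb X,\ F|_\Lambda=f\}$. A quasi-optimal interpolator $T:\mathbb X|_\Lambda\to\mathbb X$ is a linear operator that is bounded for these (semi)norms and satisfies $(Tf)|_\Lambda=f$ for all $f\in\mathbb X|_\Lambda$. Divided differences. $f(x_1)$ is the value at $x_1$, $f(x_1,x_2)=\frac{f(x_2)-f(x_1)}{x_2-x_1}$, and $f(x_1,\dots,x_n)=\frac{f(x_2,\dots,x_n)-f(x_1,\dots,x_{n-1})}{x_n-x_1}$ for $n\ge3$. For $f:\Lambda\to\mathbb C$, $$\|f\|_{\mathrm{eq},L}^p=\sum_{n\in\mathbb Z}(\lambda_{n+r}-\lambda_n)|f(\lambda_n,\dots,\lambda_{n+r})|^p,$$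 $$\|f\|_{\mathrm{eq},W}^p=\|f\|_{\mathrm{eq},L}^p+\sum_{j=0}^{r-1}\sum_{n\in\mathbb Z}(\lambda_{n+r}-\lambda_n)^{jp+1}|f(\lambda_n,\dots,\lambda_{n+j})|^p.$$ Interpolators. Put $h_n=\lambda_{n+1}-\lambda_n$ and $\mu_n=(\lambda_n+\lambda_{n+1})/2$. For $f:\Lambda\to\mathbb C$, $\Phi_1f$ is the piecewise linear interpolant $$(\Phi_1f)(x)=f(\lambda_n)\frac{\lambda_{n+1}-x}{h_n}+f(\lambda_{n+1})\frac{x-\lambda_n}{h_n},\qquad \lambda_n\le x\le\lambda_{n+1}.$$ With $\alpha_n(f)=\frac{h_nf(\lambda_{n-1},\lambda_n)+h_{n-1}f(\lambda_n,\lambda_{n+1})}{h_{n-1}+h_n}$ and $q(x)=4(x^2-x^3)$, $\Phi_2f$ is the $\mathcal C^1$ piecewise cubic spline given by $$(\Phi_2f)(x)=f(\lambda_n)+\alpha_n(f)(x-\lambda_n)+h_{n-1}^2f(\lambda_{n-1},\lambda_n,\lambda_{n+1})\,q\!\left(\frac{\lambda_n-x}{h_{n-1}}\right),\quad \mu_{n-1}\le x\le\lambda_n,$$ $$(\Phi_2f)(x)=f(\lambda_n)+\alpha_n(f)(x-\lambda_n)+h_n^2f(\lambda_{n-1},\lambda_n,\lambda_{n+1})\,q\!\left(\frac{x-\lambda_n}{h_n}\right),\quad \lambda_n\le x\le\mu_n.$$ *)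

theory Defs
  imports "HOL-Analysis.Analysis"
begin

(* A function on a set S of reals (an interval I, or the set of nodes) is represented by a total
   function real => complex of which only the values on S matter. Norms take values in ennreal,
   so that "finite norm" is literally "norm < infinity". *)

subsection \<open>Sobolev spaces\<close>

definition absolutely_continuous_fun_on :: "real \<Rightarrow> real \<Rightarrow> (real \<Rightarrow> complex) \<Rightarrow> bool" where
  "absolutely_continuous_fun_on a b g \<longleftrightarrow>
     (\<forall>\<epsilon>>0. \<exists>\<delta>>0. \<forall>d T. d division_of T \<and> T \<subseteq> {a..b} \<and> (\<Sum>k\<in>d. Sup k - Inf k) < \<delta> \<longrightarrow>
        (\<Sum>k\<in>d. cmod (g (Sup k) - g (Inf k))) < \<epsilon>)"

definition locally_absolutely_continuous_on :: "real set \<Rightarrow> (real \<Rightarrow> complex) \<Rightarrow> bool" where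
  "locally_absolutely_continuous_on I g \<longleftrightarrow>
     (\<forall>a b. a \<le> b \<and> {a..b} \<subseteq> I \<longrightarrow> absolutely_continuous_fun_on a b g)"

definition nth_deriv_on :: "real set \<Rightarrow> nat \<Rightarrow> (real \<Rightarrow> complex) \<Rightarrow> real \<Rightarrow> complex" where
  "nth_deriv_on I k = (\<lambda>g x. vector_derivative g (at x within I)) ^^ k"

(* The last conjunct is implied by the second one (Lebesgue's differentiation theorem, which the
   libraries lack); it says that the r-th derivative exists almost everywhere on I. *)
definition sobolev_regular :: "nat \<Rightarrow> real set \<Rightarrow> (real \<Rightarrow> complex) \<Rightarrow> bool" where
  "sobolev_regular r I F \<longleftrightarrow>
     (\<forall>k. k + 1 < r \<longrightarrow> nth_deriv_on I k F differentiable_on I) \<and>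
     locally_absolutely_continuous_on I (nth_deriv_on I (r - 1) F) \<and>
     (AE x\<in>I in lebesgue. nth_deriv_on I (r - 1) F differentiable (at x within I))"

definition ennroot :: "real \<Rightarrow> ennreal \<Rightarrow> ennreal" where
  "ennroot p x = (if x = \<infinity> then \<infinity> else ennreal (enn2real x powr (1 / p)))"

definition L_norm :: "nat \<Rightarrow> real \<Rightarrow> real set \<Rightarrow> (real \<Rightarrow> complex) \<Rightarrow> ennreal" where
  "L_norm r p I F =
     ennroot p (\<integral>\<^sup>+x\<in>I. ennreal (cmod (nth_deriv_on I r F x) powr p) \<partial>lebesgue)"

definition W_norm :: "nat \<Rightarrow> real \<Rightarrow> real set \<Rightarrow> (real \<Rightarrow> complex) \<Rightarrow> ennreal" where
  "W_norm r p I F =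
     ennroot p ((\<integral>\<^sup>+x\<in>I. ennreal (cmod (F x) powr p) \<partial>lebesgue) +
                (\<integral>\<^sup>+x\<in>I. ennreal (cmod (nth_deriv_on I r F x) powr p) \<partial>lebesgue))"

definition L_space :: "nat \<Rightarrow> real \<Rightarrow> real set \<Rightarrow> (real \<Rightarrow> complex) set" where
  "L_space r p I = {F. sobolev_regular r I F \<and> L_norm r p I F < \<infinity>}"

definition W_space :: "nat \<Rightarrow> real \<Rightarrow> real set \<Rightarrow> (real \<Rightarrow> complex) set" where
  "W_space r p I = {F. sobolev_regular r I F \<and> W_norm r p I F < \<infinity>}"

subsection \<open>Trace spaces and interpolators\<close>

definition trace_space :: "(real \<Rightarrow> complex) set \<Rightarrow> real set \<Rightarrow> (real \<Rightarrow> complex) set" where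
  "trace_space X \<Lambda> = {f. \<exists>F\<in>X. \<forall>x\<in>\<Lambda>. F x = f x}"

definition trace_norm ::
    "(real \<Rightarrow> complex) set \<Rightarrow> ((real \<Rightarrow> complex) \<Rightarrow> ennreal) \<Rightarrow> real set \<Rightarrow> (real \<Rightarrow> complex) \<Rightarrow> ennreal" where
  "trace_norm X N \<Lambda> f = Inf {N F | F. F \<in> X \<and> (\<forall>x\<in>\<Lambda>. F x = f x)}"

(* The second conjunct says that T f depends only on the restriction of f to the nodes. *)
definition quasi_optimal_interpolator ::
    "real set \<Rightarrow> (real \<Rightarrow> complex) set \<Rightarrow> ((real \<Rightarrow> complex) \<Rightarrow> ennreal) \<Rightarrow> real set \<Rightarrow>
     ((real \<Rightarrow> complex) \<Rightarrow> real \<Rightarrow> complex) \<Rightarrow> bool" where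
  "quasi_optimal_interpolator I X N \<Lambda> T \<longleftrightarrow>
     (\<forall>f\<in>trace_space X \<Lambda>. T f \<in> X) \<and>
     (\<forall>f\<in>trace_space X \<Lambda>. \<forall>g. (\<forall>x\<in>\<Lambda>. f x = g x) \<longrightarrow> (\<forall>x\<in>I. T f x = T g x)) \<and>
     (\<forall>f\<in>trace_space X \<Lambda>. \<forall>g\<in>trace_space X \<Lambda>. \<forall>a b. \<forall>x\<in>I.
        T (\<lambda>y. a * f y + b * g y) x = a * T f x + b * T g x) \<and>
     (\<exists>B<\<infinity>. \<forall>f\<in>trace_space X \<Lambda>. N (T f) \<le> B * trace_norm X N \<Lambda> f) \<and>
     (\<forall>f\<in>trace_space X \<Lambda>. \<forall>x\<in>\<Lambda>. T f x = f x)"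

definition interpolator_norm ::
    "(real \<Rightarrow> complex) set \<Rightarrow> ((real \<Rightarrow> complex) \<Rightarrow> ennreal) \<Rightarrow> real set \<Rightarrow>
     ((real \<Rightarrow> complex) \<Rightarrow> real \<Rightarrow> complex) \<Rightarrow> ennreal" where
  "interpolator_norm X N \<Lambda> T =
     Inf {B. \<forall>f\<in>trace_space X \<Lambda>. N (T f) \<le> B * trace_norm X N \<Lambda> f}"

subsection \<open>Divided differences and equivalent norms\<close>

(* The empty list is a junk case. *)
function divdiff :: "(real \<Rightarrow> complex) \<Rightarrow> real list \<Rightarrow> complex" where
  "divdiff f [] = 0"
| "divdiff f [x] = f x"
| "divdiff f (x # y # zs) =
     (divdiff f (y # zs) - divdiff f (butlast (x # y # zs))) /
     complex_of_real (last (x # y # zs) - x)"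
  by pat_completeness auto
termination
  by (relation "Wellfounded.measure (\<lambda>(f, xs). length xs)") auto

(* f(lam n, ..., lam (n + k)) *)
definition node_dd :: "(int \<Rightarrow> real) \<Rightarrow> (real \<Rightarrow> complex) \<Rightarrow> int \<Rightarrow> nat \<Rightarrow> complex" where
  "node_dd lam f n k = divdiff f (map lam [n..n + int k])"

lemma node_dd_0: "node_dd lam f n 0 = f (lam n)"
  by (simp add: node_dd_def)

lemma node_dd_Suc:
  "node_dd lam f n (Suc k) =
     (node_dd lam f (n + 1) k - node_dd lam f n k) /
     complex_of_real (lam (n + int (Suc k)) - lam n)"
proof -
  let ?m = "n + int (Suc k)"
  have m: "?m = n + 1 + int k" by simp
  have 1: "[n..?m] = n # [n + 1..n + 1 + int k]" using upto_rec1[of n ?m] unfolding m by simp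
  have 2: "[n + 1..n + 1 + int k] = (n + 1) # [n + 2..n + 1 + int k]"
    using upto_rec1[of "n + 1" "n + 1 + int k"] by (simp only: add.assoc one_add_one)
  have 3: "[n..?m] = [n..n + int k] @ [?m]" using upto_rec2[of n ?m] by simp
  define L where "L = map lam [n..?m]"
  have L: "L = lam n # lam (n + 1) # map lam [n + 2..n + 1 + int k]"
    unfolding L_def 1 by (simp add: 2)
  have tl: "lam (n + 1) # map lam [n + 2..n + 1 + int k] = map lam [n + 1..n + 1 + int k]"
    by (simp add: 2)
  have b: "butlast L = map lam [n..n + int k]" and l: "last L = lam ?m"
    unfolding L_def 3 by simp_all
  have "divdiff f L = (divdiff f (map lam [n + 1..n + 1 + int k]) - divdiff f (butlast L)) /
      complex_of_real (last L - lam n)"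
    unfolding L by (subst divdiff.simps(3)) (simp only: tl)
  then show ?thesis unfolding b l by (simp add: node_dd_def L_def)
qed

definition eqL_sum :: "nat \<Rightarrow> real \<Rightarrow> (int \<Rightarrow> real) \<Rightarrow> (real \<Rightarrow> complex) \<Rightarrow> ennreal" where
  "eqL_sum r p lam f =
     (\<Sum>\<^sub>\<infinity>n. ennreal ((lam (n + int r) - lam n) * cmod (node_dd lam f n r) powr p))"

definition eqL_norm :: "nat \<Rightarrow> real \<Rightarrow> (int \<Rightarrow> real) \<Rightarrow> (real \<Rightarrow> complex) \<Rightarrow> ennreal" where
  "eqL_norm r p lam f = ennroot p (eqL_sum r p lam f)"

definition eqW_norm :: "nat \<Rightarrow> real \<Rightarrow> (int \<Rightarrow> real) \<Rightarrow> (real \<Rightarrow> complex) \<Rightarrow> ennreal" where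
  "eqW_norm r p lam f =
     ennroot p (eqL_sum r p lam f +
       (\<Sum>j<r. \<Sum>\<^sub>\<infinity>n.
          ennreal ((lam (n + int r) - lam n) powr (real j * p + 1) *
                   cmod (node_dd lam f n j) powr p)))"

subsection \<open>The interpolators\<close>

definition node_interval :: "(int \<Rightarrow> real) \<Rightarrow> real set" where
  "node_interval lam = (\<Union>n. {lam n..lam (n + 1)})"

definition gap :: "(int \<Rightarrow> real) \<Rightarrow> int \<Rightarrow> real" where
  "gap lam n = lam (n + 1) - lam n"

definition mid :: "(int \<Rightarrow> real) \<Rightarrow> int \<Rightarrow> real" where
  "mid lam n = (lam n + lam (n + 1)) / 2"

definition Phi1_piece :: "(int \<Rightarrow> real) \<Rightarrow> (real \<Rightarrow> complex) \<Rightarrow> int \<Rightarrow> real \<Rightarrow> complex" where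
  "Phi1_piece lam f n x =
     f (lam n) * complex_of_real ((lam (n + 1) - x) / gap lam n) +
     f (lam (n + 1)) * complex_of_real ((x - lam n) / gap lam n)"

(* On half-open intervals the index n is unique; Phi1_eq and Phi2_eq_left, Phi2_eq_right below
   give the formulas on the closed intervals. *)
definition Phi1 :: "(int \<Rightarrow> real) \<Rightarrow> (real \<Rightarrow> complex) \<Rightarrow> real \<Rightarrow> complex" where
  "Phi1 lam f x = Phi1_piece lam f (THE n. lam n \<le> x \<and> x < lam (n + 1)) x"

definition alpha :: "(int \<Rightarrow> real) \<Rightarrow> (real \<Rightarrow> complex) \<Rightarrow> int \<Rightarrow> complex" where
  "alpha lam f n =
     (complex_of_real (gap lam n) * divdiff f [lam (n - 1), lam n] +
      complex_of_real (gap lam (n - 1)) * divdiff f [lam n, lam (n + 1)]) /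
     complex_of_real (gap lam (n - 1) + gap lam n)"

definition qcubic :: "real \<Rightarrow> real" where
  "qcubic x = 4 * (x\<^sup>2 - x ^ 3)"

definition Phi2_left :: "(int \<Rightarrow> real) \<Rightarrow> (real \<Rightarrow> complex) \<Rightarrow> int \<Rightarrow> real \<Rightarrow> complex" where
  "Phi2_left lam f n x =
     f (lam n) + alpha lam f n * complex_of_real (x - lam n) +
     complex_of_real ((gap lam (n - 1))\<^sup>2) * divdiff f [lam (n - 1), lam n, lam (n + 1)] *
     complex_of_real (qcubic ((lam n - x) / gap lam (n - 1)))"

definition Phi2_right :: "(int \<Rightarrow> real) \<Rightarrow> (real \<Rightarrow> complex) \<Rightarrow> int \<Rightarrow> real \<Rightarrow> complex" where
  "Phi2_right lam f n x =
     f (lam n) + alpha lam f n * complex_of_real (x - lam n) +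
     complex_of_real ((gap lam n)\<^sup>2) * divdiff f [lam (n - 1), lam n, lam (n + 1)] *
     complex_of_real (qcubic ((x - lam n) / gap lam n))"

definition Phi2 :: "(int \<Rightarrow> real) \<Rightarrow> (real \<Rightarrow> complex) \<Rightarrow> real \<Rightarrow> complex" where
  "Phi2 lam f x =
     (let n = (THE n. mid lam (n - 1) \<le> x \<and> x < mid lam n)
      in if x \<le> lam n then Phi2_left lam f n x else Phi2_right lam f n x)"

definition Phi :: "nat \<Rightarrow> (int \<Rightarrow> real) \<Rightarrow> (real \<Rightarrow> complex) \<Rightarrow> real \<Rightarrow> complex" where
  "Phi r = (if r = 1 then Phi1 else Phi2)"

lemma The_strict_mono_interval:
  fixes s :: "int \<Rightarrow> real"
  assumes "strict_mono s" "s n \<le> x" "x < s (n + 1)"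
  shows "(THE k. s k \<le> x \<and> x < s (k + 1)) = n"
proof (rule the_equality)
  fix k assume k: "s k \<le> x \<and> x < s (k + 1)"
  have "s k < s (n + 1)" "s n < s (k + 1)" using k assms by linarith+
  then have "k < n + 1" "n < k + 1" using assms(1) by (simp_all add: strict_mono_less)
  then show "k = n" by simp
qed (use assms in simp)

lemma strict_mono_mid:
  assumes "strict_mono lam" shows "strict_mono (mid lam)"
proof (rule strict_monoI)
  fix m n :: int assume "m < n"
  then have "lam m < lam n" "lam (m + 1) < lam (n + 1)"
    using assms by (simp_all add: strict_mono_less)
  then show "mid lam m < mid lam n" by (simp add: mid_def)
qed

lemma mid_bounds:
  assumes "strict_mono lam" shows "lam n < mid lam n" "mid lam n < lam (n + 1)"
  using strict_monoD[OF assms, of n "n + 1"] by (simp_all add: mid_def)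

lemma Phi1_eq:
  assumes "strict_mono lam" "lam n \<le> x" "x \<le> lam (n + 1)"
  shows "Phi1 lam f x = Phi1_piece lam f n x"
proof (cases "x < lam (n + 1)")
  case True
  then show ?thesis using The_strict_mono_interval[OF assms(1,2)] by (simp add: Phi1_def)
next
  case False
  then have x: "x = lam (n + 1)" using assms by simp
  have less: "lam n < lam (n + 1)" "lam (n + 1) < lam (n + 1 + 1)"
    using assms(1) by (simp_all add: strict_mono_less)
  have "(THE k. lam k \<le> x \<and> x < lam (k + 1)) = n + 1"
    using less x by (intro The_strict_mono_interval[OF assms(1)]) auto
  then have "Phi1 lam f x = Phi1_piece lam f (n + 1) x" by (simp add: Phi1_def)
  then show ?thesis using less x by (simp add: Phi1_piece_def gap_def)
qed

lemma Phi2_index: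
  assumes "strict_mono lam" "mid lam (n - 1) \<le> x" "x < mid lam n"
  shows "(THE k. mid lam (k - 1) \<le> x \<and> x < mid lam k) = n"
proof -
  have "strict_mono (\<lambda>k. mid lam (k - 1))"
    using strict_mono_mid[OF assms(1)] by (simp add: strict_mono_def)
  from The_strict_mono_interval[OF this, of n x] assms(2,3) show ?thesis by simp
qed

lemma Phi2_eq_left:
  assumes "strict_mono lam" "mid lam (n - 1) \<le> x" "x \<le> lam n"
  shows "Phi2 lam f x = Phi2_left lam f n x"
  using Phi2_index[OF assms(1,2)] assms(3) mid_bounds[OF assms(1), of n]
  by (simp add: Phi2_def)

lemma Phi2_pieces_agree_at_mid:
  assumes "strict_mono lam"
  shows "Phi2_right lam f n (mid lam n) = Phi2_left lam f (n + 1) (mid lam n)"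
proof -
  define a b c where "a = gap lam (n - 1)" and "b = gap lam n" and "c = gap lam (n + 1)"
  have pos: "a > 0" "b > 0" "c > 0"
    using assms by (simp_all add: a_def b_def c_def gap_def strict_mono_less)
  define u v w where "u = divdiff f [lam (n - 1), lam n]" and "v = divdiff f [lam n, lam (n + 1)]"
    and "w = divdiff f [lam (n + 1), lam (n + 2)]"
  let ?A = "complex_of_real a" and ?B = "complex_of_real b" and ?C = "complex_of_real c"
  have nz: "?A + ?B \<noteq> 0" "?B + ?C \<noteq> 0" "?B \<noteq> 0"
    using pos by (simp_all flip: of_real_add)
  have v: "f (lam (n + 1)) = f (lam n) + ?B * v"
    using nz by (simp add: v_def b_def gap_def)
  have d1: "divdiff f [lam (n - 1), lam n, lam (n + 1)] = (v - u) / (?A + ?B)"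
    by (simp add: u_def v_def a_def b_def gap_def)
  have d2: "divdiff f [lam n, lam (n + 1), lam (n + 2)] = (w - v) / (?B + ?C)"
    by (simp add: v_def w_def b_def c_def gap_def add.commute)
  have a1: "alpha lam f n = (?B * u + ?A * v) / (?A + ?B)"
    unfolding alpha_def u_def v_def a_def b_def by simp
  have a2: "alpha lam f (n + 1) = (?C * v + ?B * w) / (?B + ?C)"
    unfolding alpha_def v_def w_def b_def c_def by (simp add: add.commute)
  have half: "(mid lam n - lam n) / gap lam n = 1 / 2"
    "(lam (n + 1) - mid lam n) / gap lam n = 1 / 2"
    "mid lam n - lam n = b / 2" "mid lam n - lam (n + 1) = - (b / 2)"
    using pos(2) by (simp_all add: mid_def b_def gap_def field_simps)
  have q: "qcubic (1 / 2) = 1 / 2" by (simp add: qcubic_def power2_eq_square power3_eq_cube)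
  have alg: "X / d * (B / 2) + B\<^sup>2 * (Y / d) * (1 / 2) = B * ((X + B * Y) / d) / 2"
    "- (X / d * (B / 2)) + B\<^sup>2 * (Y / d) * (1 / 2) = - (B * ((X - B * Y) / d) / 2)"
    for X Y d B :: complex
    by (simp_all add: add_divide_distrib diff_divide_distrib power2_eq_square algebra_simps)
  have "Phi2_right lam f n (mid lam n) =
      f (lam n) + (?B * u + ?A * v) / (?A + ?B) * (?B / 2) + ?B\<^sup>2 * ((v - u) / (?A + ?B)) * (1 / 2)"
    unfolding Phi2_right_def half d1 a1 by (simp add: q b_def)
  also have "\<dots> = f (lam n) + ?B * ((?B * u + ?A * v + ?B * (v - u)) / (?A + ?B)) / 2"
    using alg(1)[of "?B * u + ?A * v" "?A + ?B" ?B "v - u"] by (simp only: add.assoc)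
  also have "?B * u + ?A * v + ?B * (v - u) = (?A + ?B) * v"
    by (simp add: algebra_simps)
  finally have R: "Phi2_right lam f n (mid lam n) = f (lam n) + ?B * v / 2"
    using nz by simp
  have e: "n + 1 - 1 = n" "n + 1 + 1 = n + 2" by simp_all
  have "Phi2_left lam f (n + 1) (mid lam n) =
      f (lam n) + ?B * v - (?C * v + ?B * w) / (?B + ?C) * (?B / 2) +
      ?B\<^sup>2 * ((w - v) / (?B + ?C)) * (1 / 2)"
    unfolding Phi2_left_def e half d2 a2 v by (simp add: q b_def)
  also have "\<dots> = f (lam n) + ?B * v - ?B * ((?C * v + ?B * w - ?B * (w - v)) / (?B + ?C)) / 2"
    using alg(2)[of "?C * v + ?B * w" "?B + ?C" ?B "w - v"]
    by (simp only: diff_conv_add_uminus add.assoc)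
  also have "?C * v + ?B * w - ?B * (w - v) = (?B + ?C) * v"
    by (simp add: algebra_simps)
  finally have L: "Phi2_left lam f (n + 1) (mid lam n) = f (lam n) + ?B * v / 2"
    using nz by simp
  show ?thesis using R L by simp
qed

lemma Phi2_eq_right:
  assumes "strict_mono lam" "lam n \<le> x" "x \<le> mid lam n"
  shows "Phi2 lam f x = Phi2_right lam f n x"
proof (cases "x < mid lam n")
  case True
  moreover have "mid lam (n - 1) \<le> x" using mid_bounds[OF assms(1), of "n - 1"] assms(2) by simp
  ultimately have "(THE k. mid lam (k - 1) \<le> x \<and> x < mid lam k) = n"
    using Phi2_index[OF assms(1)] by blast
  then show ?thesis
    using assms(2) by (auto simp: Phi2_def Phi2_left_def Phi2_right_def qcubic_def)
next
  case False
  then have x: "x = mid lam n" using assms(3) by simp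
  have "Phi2 lam f x = Phi2_left lam f (n + 1) x"
    using mid_bounds[OF assms(1), of n] x by (intro Phi2_eq_left assms(1)) auto
  then show ?thesis using Phi2_pieces_agree_at_mid[OF assms(1)] x by simp
qed

end

theory Submission
  imports Defs
begin

text \<open>
  Everything is local to the windows \<open>[lam n, lam (n + r)]\<close>, of length \<open>H\<close>: a point lies in at most
  \<open>r + 1\<close> of them, so the estimates on single windows can be summed, and multiplicities enter only as
  factors \<open>(r + 1) powr (1 / p) \<le> r + 1\<close>, uniformly in \<open>p\<close>.

  Lower bounds: by the fundamental theorem of calculus for absolutely continuous functions, the
  oscillation of \<open>F^(r-1)\<close> on a window is at most \<open>B\<close>, the integral of \<open>|F^(r)|\<close>, and
  \<open>H (B / H)^p\<close> is at most the integral of \<open>|F^(r)|^p\<close> by Jensen's inequality. The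
  divided difference of order \<open>r\<close> is at most \<open>2 B / H\<close>, and those of lower order are controlled by \<open>B\<close>
  and the values of \<open>F\<close> at two points where \<open>|F|^p\<close> does not exceed its mean.

  Upper bounds: on the part of the window that the interpolator treats with one formula, its \<open>r\<close>-th
  derivative is at most 8 times the divided difference of order \<open>r\<close>, and its value is at most
  \<open>2 \<Sum>j\<le>r. H^j |f(lam n, ..., lam (n + j))|\<close>.
\<close>

subsection \<open>Absolutely continuous functions and their derivatives\<close>

text \<open>The power of the window length \<open>H\<close> decides where the gap bound is needed.
  In part (a) the order \<open>r\<close> carries the weight \<open>H\<close> on both sides, so the
  constants are absolute. In part (b) it competes with the values of \<open>F\<close>: in the lower
  bound \<open>H ^ (r - 1) * B\<close> is \<open>H ^ r\<close> times a mean, and in the upper bound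
  the order \<open>r\<close> arrives with weight \<open>H powr (r * p + 1)\<close>. Both times the
  excess \<open>H ^ r\<close> is bounded by \<open>(1 + 2 * K)\<^sup>2\<close>. The shape of
  \<open>Phi2\<close> comes from four values of q = \<open>qcubic\<close>: q(0) = q'(0) = 0, q(1/2)
  = 1/2 and q'(1/2) = 1. At a node the spline has the slope of the parabola through three
  consecutive nodes, and at the middle of a gap it touches the chord with the slope of the chord.
  Hence neighbouring formulas fit in value and slope although each depends on three nodes only, that
  is, on one window. The constant 8 is the maximum of |q''| on [0, 1/2].\<close>

lemma nth_deriv_on_0 [simp]: "nth_deriv_on I 0 F = F"
  by (simp add: nth_deriv_on_def)

lemma nth_deriv_on_Suc:
  "nth_deriv_on I (Suc k) F = (\<lambda>x. vector_derivative (nth_deriv_on I k F) (at x within I))"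
  by (simp add: nth_deriv_on_def)

lemma absolutely_continuous_fun_onD:
  assumes "absolutely_continuous_fun_on a b G" "\<epsilon> > 0"
  obtains \<delta> where "\<delta> > 0"
    "\<And>d T. d division_of T \<Longrightarrow> T \<subseteq> {a..b} \<Longrightarrow> (\<Sum>k\<in>d. Sup k - Inf k) < \<delta> \<Longrightarrow>
        (\<Sum>k\<in>d. cmod (G (Sup k) - G (Inf k))) < \<epsilon>"
proof -
  obtain \<delta> where "\<delta> > 0" "\<forall>d T. d division_of T \<and> T \<subseteq> {a..b} \<and> (\<Sum>k\<in>d. Sup k - Inf k) < \<delta> \<longrightarrow>
        (\<Sum>k\<in>d. cmod (G (Sup k) - G (Inf k))) < \<epsilon>"
    using assms unfolding absolutely_continuous_fun_on_def by meson
  then show thesis by (intro that[of \<delta>]) auto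
qed

text \<open>Fundamental theorem of calculus for the gauge integral, with an exceptional null set. At
  a tag outside \<open>N\<close> the derivative controls the increment of \<open>G\<close>. The
  intervals tagged in \<open>N\<close> lie in an open set of measure below the \<delta> of absolute
  continuity, so the increments of \<open>G\<close> over them have a small sum.\<close>

lemma has_integral_absolutely_continuous:
  assumes ac: "absolutely_continuous_fun_on a b G" and "a \<le> b" and N: "negligible N"
    and der: "\<And>x. x \<in> {a..b} - N \<Longrightarrow> (G has_vector_derivative g x) (at x within {a..b})"
  shows "(g has_integral (G b - G a)) {a..b}"
proof (cases "a = b")
  case True then show ?thesis using has_integral_refl(2)[of g b] by simp
next
  case False
  then have ab: "a < b" using assms by simp
  \<comment> \<open>With the integrand zeroed on \<open>N\<close>, only the increments of
    \<open>G\<close> remain at the tags in \<open>N\<close>.\<close>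
  define g' where "g' x = (if x \<in> N then 0 else g x)" for x
  have "(g' has_integral (G b - G a)) {a..b}"
    unfolding has_integral_factor_content_real
  proof (intro allI impI)
    fix e :: real assume e: "e > 0"
    \<comment> \<open>One half of the admissible error goes to the tags in \<open>N\<close>, the
      other half to the remaining tags.\<close>
    define e' where "e' = e / 2"
    have e': "e' > 0" using e by (simp add: e'_def)
    obtain \<delta> where \<delta>: "\<delta> > 0" "\<And>d T. d division_of T \<Longrightarrow> T \<subseteq> {a..b} \<Longrightarrow>
        (\<Sum>k\<in>d. Sup k - Inf k) < \<delta> \<Longrightarrow> (\<Sum>k\<in>d. cmod (G (Sup k) - G (Inf k))) < e' * (b - a)"
      using absolutely_continuous_fun_onD[OF ac, of "e' * (b - a)"] e' ab by auto
    have Ns: "N \<in> sets lebesgue" using N by (simp add: negligible_imp_sets)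
    obtain U where U: "open U" "N \<subseteq> U" "U - N \<in> lmeasurable" "emeasure lebesgue (U - N) < ennreal \<delta>"
      using sets_lebesgue_outer_open[OF Ns \<delta>(1)] by blast
    have UN: "U = (U - N) \<union> N" using U(2) by blast
    have Um: "U \<in> lmeasurable"
      using U(3) N by (metis UN fmeasurable.Un negligible_imp_measurable)
    have "measure lebesgue U = measure lebesgue (U - N)"
      using N by (metis UN measure_Un_null_set U(3) fmeasurableD negligible_iff_null_sets)
    then have Ud: "measure lebesgue U < \<delta>"
      using U(3,4) \<delta>(1) by (simp add: emeasure_eq_measure2 ennreal_less_iff)
    \<comment> \<open>Straddle estimate: \<open>G\<close> is compared with its linearization at
      \<open>x\<close> on both sides of \<open>x\<close>, and the two lengths add up to
      \<open>v - u\<close>.\<close>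
    have "\<exists>d>0. \<forall>u v. u \<le> x \<and> x \<le> v \<and> {u..v} \<subseteq> ball x d \<and> {u..v} \<subseteq> {a..b} \<longrightarrow>
        cmod (G v - G u - (v - u) *\<^sub>R g x) \<le> e' * (v - u)" if x: "x \<in> {a..b} - N" for x
    proof -
      obtain d where d: "d > 0"
        "\<And>y. y \<in> {a..b} \<Longrightarrow> norm (y - x) < d \<Longrightarrow>
           norm (G y - G x - (y - x) *\<^sub>R g x) \<le> e' * norm (y - x)"
        using der[OF x] e' unfolding has_vector_derivative_def has_derivative_within_alt by blast
      show ?thesis
      proof (intro exI conjI allI impI)
        fix u v assume uv: "u \<le> x \<and> x \<le> v \<and> {u..v} \<subseteq> ball x d \<and> {u..v} \<subseteq> {a..b}"
        then have "u \<in> {u..v}" "v \<in> {u..v}" by auto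
        then have m: "u \<in> ball x d" "v \<in> ball x d" "u \<in> {a..b}" "v \<in> {a..b}" using uv by blast+
        then have 1: "norm (G v - G x - (v - x) *\<^sub>R g x) \<le> e' * (v - x)"
          "norm (G u - G x - (u - x) *\<^sub>R g x) \<le> e' * (x - u)"
          using d(2)[of v] d(2)[of u] uv by (auto simp: dist_real_def)
        have "G v - G u - (v - u) *\<^sub>R g x =
            (G v - G x - (v - x) *\<^sub>R g x) - (G u - G x - (u - x) *\<^sub>R g x)"
          by (simp add: algebra_simps)
        then have "norm (G v - G u - (v - u) *\<^sub>R g x) \<le> e' * (v - x) + e' * (x - u)"
          by (simp only:) (rule order_trans[OF norm_triangle_ineq4 add_mono[OF 1]])
        then show "norm (G v - G u - (v - u) *\<^sub>R g x) \<le> e' * (v - u)"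
          by (simp add: algebra_simps)
      qed (rule d)
    qed
    then obtain \<rho> where \<rho>: "\<And>x. x \<in> {a..b} - N \<Longrightarrow> \<rho> x > 0"
      "\<And>x u v. x \<in> {a..b} - N \<Longrightarrow> u \<le> x \<Longrightarrow> x \<le> v \<Longrightarrow> {u..v} \<subseteq> ball x (\<rho> x) \<Longrightarrow>
          {u..v} \<subseteq> {a..b} \<Longrightarrow> cmod (G v - G u - (v - u) *\<^sub>R g x) \<le> e' * (v - u)"
      by metis
    \<comment> \<open>A tag in \<open>N\<close> forces its interval into \<open>U\<close>. The
      radius 1 is a filler for points outside \<open>{a..b}\<close>, where no tag lies.\<close>
    define d where "d x = (if x \<in> N then U else if x \<in> {a..b} then ball x (\<rho> x) else ball x 1)" for x
    have gd: "gauge d"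
      unfolding gauge_def d_def using U \<rho>(1) by auto
    show "\<exists>d. gauge d \<and> (\<forall>p. p tagged_division_of {a..b} \<and> d fine p \<longrightarrow>
        norm ((\<Sum>(x, k)\<in>p. measure lborel k *\<^sub>R g' x) - (G b - G a)) \<le> e * measure lborel {a..b})"
    proof (intro exI conjI allI impI, rule gd)
      fix p assume p: "p tagged_division_of {a..b} \<and> d fine p"
      then have pf: "finite p" by blast
      have pD: "\<exists>u v. k = {u..v} \<and> u \<le> x \<and> x \<le> v \<and> {u..v} \<subseteq> {a..b} \<and> k \<subseteq> d x" if "(x, k) \<in> p" for x k
      proof -
        have "x \<in> k" "k \<subseteq> {a..b}" "\<exists>u v. k = cbox u v" "k \<subseteq> d x"
          using p that tagged_division_ofD(2,3,4)[of p "{a..b}"] unfolding fine_def by auto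
        then show ?thesis by auto
      qed
      define E where "E = (\<lambda>(x, k). measure lborel k *\<^sub>R g' x - (G (Sup k) - G (Inf k)))"
      define p1 where "p1 = {q \<in> p. fst q \<in> N}"
      define p2 where "p2 = {q \<in> p. fst q \<notin> N}"
      have pun: "p = p1 \<union> p2" "p1 \<inter> p2 = {}" by (auto simp: p1_def p2_def)
      have E2: "norm (E q) \<le> e' * measure lborel (snd q)" if q2: "q \<in> p2" for q
      proof -
        obtain x k where q: "q = (x, k)" "(x, k) \<in> p" "x \<notin> N"
          using q2 by (cases q) (auto simp: p2_def)
        then obtain u v where uv: "k = {u..v}" "u \<le> x" "x \<le> v" "{u..v} \<subseteq> {a..b}" "k \<subseteq> d x"
          using pD by blast
        then have "x \<in> {a..b} - N" using q by auto
        then have "cmod (G v - G u - (v - u) *\<^sub>R g x) \<le> e' * (v - u)"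
          using uv \<rho>(2)[of x u v] by (auto simp: d_def)
        then show ?thesis using uv q by (simp add: E_def g'_def norm_minus_commute)
      qed
      have "norm (\<Sum>q\<in>p2. E q) \<le> (\<Sum>q\<in>p2. e' * measure lborel (snd q))"
        using E2 by (rule sum_norm_le)
      also have "\<dots> \<le> (\<Sum>q\<in>p. e' * measure lborel (snd q))"
        using pf pun e' by (intro sum_mono2) auto
      also have "\<dots> = e' * (b - a)"
        using additive_content_tagged_division[of p a b] p ab
        by (simp add: sum_distrib_left[symmetric] case_prod_unfold)
      finally have B2: "norm (\<Sum>q\<in>p2. E q) \<le> e' * (b - a)" .
      have p1t: "p1 tagged_partial_division_of {a..b}"
        using p by (auto simp: p1_def tagged_division_of_def intro: tagged_partial_division_subset)
      define q1 where "q1 = snd ` p1"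
      have q1: "q1 division_of \<Union>q1"
        unfolding q1_def by (rule partial_division_of_tagged_division[OF p1t])
      have q1D: "\<exists>u v. k = {u..v} \<and> u \<le> v \<and> k \<subseteq> {a..b} \<and> k \<subseteq> U" if "k \<in> q1" for k
      proof -
        obtain x where x: "(x, k) \<in> p" "x \<in> N" using \<open>k \<in> q1\<close> by (auto simp: q1_def p1_def)
        obtain u v where "k = {u..v}" "u \<le> x" "x \<le> v" "{u..v} \<subseteq> {a..b}" "k \<subseteq> d x"
          using pD[OF x(1)] by blast
        with x show ?thesis by (intro exI[of _ u] exI[of _ v]) (simp add: d_def)
      qed
      have "(\<Sum>k\<in>q1. Sup k - Inf k) = (\<Sum>k\<in>q1. measure lebesgue k)"
      proof (rule sum.cong[OF refl])
        fix k assume "k \<in> q1"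
        then show "Sup k - Inf k = measure lebesgue k" using q1D[of k] by auto
      qed
      also have "\<dots> = measure lebesgue (\<Union>q1)" using content_division[OF q1] by simp
      also have "\<dots> \<le> measure lebesgue U"
      proof (rule measure_mono_fmeasurable)
        show "\<Union>q1 \<subseteq> U" using q1D by blast
        show "\<Union>q1 \<in> sets lebesgue" using q1 lmeasurable_division by blast
      qed (rule Um)
      finally have "(\<Sum>k\<in>q1. Sup k - Inf k) < \<delta>" using Ud by simp
      moreover have "\<Union>q1 \<subseteq> {a..b}" using q1D by blast
      ultimately have B: "(\<Sum>k\<in>q1. cmod (G (Sup k) - G (Inf k))) < e' * (b - a)"
        using \<delta>(2) q1 by blast
      \<comment> \<open>Different tags can share an interval only if it is degenerate, so a sum over
        tagged intervals becomes a sum over intervals for a function that vanishes on degenerate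
        ones. The empty set gets its own value because \<open>Sup {}\<close> and
        \<open>Inf {}\<close> are unspecified.\<close>
      define h where "h k = (if k = {} then 0 else cmod (G (Sup k) - G (Inf k)))" for k
      have p1n: "snd q \<noteq> {}" if "q \<in> p1" for q
        using that pD[of "fst q" "snd q"] by (auto simp: p1_def)
      have "(\<Sum>q\<in>p1. norm (E q)) = (\<Sum>(x, k)\<in>p1. h k)"
        using p1n by (intro sum.cong) (auto simp: E_def g'_def p1_def h_def norm_minus_commute)
      also have "\<dots> = sum h q1"
        unfolding q1_def
      proof (rule sum.over_tagged_division_lemma[OF tagged_partial_division_of_Union_self[OF p1t]])
        fix u v :: real assume "box u v = {}"
        then show "h (cbox u v) = 0" by (cases "u = v") (auto simp: h_def)
      qed
      also have "\<dots> = (\<Sum>k\<in>q1. cmod (G (Sup k) - G (Inf k)))"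
        using p1n by (intro sum.cong) (auto simp: h_def q1_def)
      finally have "(\<Sum>q\<in>p1. norm (E q)) < e' * (b - a)" using B by simp
      then have B1: "norm (\<Sum>q\<in>p1. E q) \<le> e' * (b - a)"
        using norm_sum[of E p1] by simp
      have "(\<Sum>(x, k)\<in>p. measure lborel k *\<^sub>R g' x) - (G b - G a) = (\<Sum>q\<in>p. E q)"
        using additive_tagged_division_1[of a b p G] p ab
        by (simp add: E_def sum_subtractf case_prod_unfold)
      also have "\<dots> = (\<Sum>q\<in>p1. E q) + (\<Sum>q\<in>p2. E q)"
        using pf pun by (metis finite_Un sum.union_disjoint)
      finally have "norm ((\<Sum>(x, k)\<in>p. measure lborel k *\<^sub>R g' x) - (G b - G a)) \<le> e' * (b - a) + e' * (b - a)"
        using B1 B2 norm_triangle_mono by metis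
      then show "norm ((\<Sum>(x, k)\<in>p. measure lborel k *\<^sub>R g' x) - (G b - G a)) \<le> e * measure lborel {a..b}"
        using ab by (simp add: e'_def)
    qed
  qed
  then show ?thesis
    by (rule has_integral_spike[OF N, rotated]) (simp add: g'_def)
qed

text \<open>A convex function lies above its tangent at \<open>A\<close>. The endpoint 0 is treated
  apart because convexity is applied on the open half-line; for \<open>A = 0\<close> and
  \<open>p = 1\<close> the convention \<open>0 powr 0 = 0\<close> applies.\<close>

lemma powr_tangent_line_le:
  fixes s A p :: real
  assumes "s \<ge> 0" "A \<ge> 0" "1 \<le> p"
  shows "A powr p + p * A powr (p - 1) * (s - A) \<le> s powr p"
proof (cases "A = 0 \<or> s = 0")
  case True
  then show ?thesis
  proof
    assume "A = 0" then show ?thesis using assms by (cases "p = 1") auto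
  next
    assume s: "s = 0"
    have "A powr p = A powr (p - 1) * A" if "A > 0"
      using powr_add[of A "p - 1" 1] that by simp
    then have "A powr p + p * A powr (p - 1) * (s - A) = (1 - p) * A powr p"
      using s assms by (cases "A = 0") (simp_all add: algebra_simps)
    also have "\<dots> \<le> 0" using assms by (simp add: mult_nonpos_nonneg)
    finally show ?thesis using s by simp
  qed
next
  case False
  then have pos: "A > 0" "s > 0" using assms by auto
  have "p * A powr (p - 1) * (s - A) \<le> s powr p - A powr p"
  proof (rule convex_on_imp_above_tangent[OF powr_convex[OF assms(3)]])
    show "connected {0::real<..}" by simp
    show "A \<in> interior {0<..}" using pos by (simp add: interior_open)
    show "s \<in> {0<..}" using pos by simp
    show "((\<lambda>x. x powr p) has_field_derivative p * A powr (p - 1)) (at A within {0<..})"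
      using pos by (auto intro!: derivative_eq_intros)
  qed
  then show ?thesis by simp
qed

text \<open>Jensen's inequality, by integrating the tangent line at the mean \<open>A\<close> of
  \<open>cmod (g x)\<close>: its linear term integrates to zero, which leaves
  \<open>(b - a) * A powr p\<close>. An infinite right-hand side makes the claim trivial.\<close>

lemma powr_mean_le_nn_integral:
  assumes int: "g absolutely_integrable_on {a..b}" and "a < b" "1 \<le> p"
  shows "ennreal ((b - a) * (integral {a..b} (\<lambda>x. cmod (g x)) / (b - a)) powr p) \<le>
      (\<integral>\<^sup>+x\<in>{a..b}. ennreal (cmod (g x) powr p) \<partial>lebesgue)"
proof (cases "(\<integral>\<^sup>+x\<in>{a..b}. ennreal (cmod (g x) powr p) \<partial>lebesgue) < \<infinity>")
  case True
  let ?i = "indicator {a..b} :: real \<Rightarrow> real"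
  define B where "B = integral {a..b} (\<lambda>x. cmod (g x))"
  define A where "A = B / (b - a)"
  have gi: "set_integrable lebesgue {a..b} (\<lambda>x. cmod (g x))"
    using int by (rule set_integrable_norm)
  have B: "B = (LINT x:{a..b}|lebesgue. cmod (g x))"
    unfolding B_def using set_lebesgue_integral_eq_integral(2)[OF gi] by simp
  have B0: "B \<ge> 0" unfolding B_def by (rule Henstock_Kurzweil_Integration.integral_nonneg)
      (use int absolutely_integrable_on_def in auto)
  then have A0: "A \<ge> 0" using \<open>a < b\<close> by (simp add: A_def)
  have [measurable]: "(\<lambda>x. ?i x * cmod (g x)) \<in> borel_measurable lebesgue"
    using gi by (simp add: set_integrable_def)
  have mp: "(\<lambda>x. ?i x * cmod (g x) powr p) \<in> borel_measurable lebesgue"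
  proof -
    have "(\<lambda>x. ?i x * cmod (g x) powr p) = (\<lambda>x. (?i x * cmod (g x)) powr p)"
      using \<open>1 \<le> p\<close> by (auto simp: indicator_def)
    then show ?thesis by simp
  qed
  have en: "ennreal (cmod (g x) powr p) * indicator {a..b} x = ennreal (?i x * cmod (g x) powr p)" for x
    by (simp add: indicator_def)
  have ip: "integrable lebesgue (\<lambda>x. ?i x * cmod (g x) powr p)"
    using mp True by (intro integrableI_nonneg) (simp_all add: en)
  have i1: "integrable lebesgue (\<lambda>x. ?i x * cmod (g x))"
    using gi by (simp add: set_integrable_def)
  have i2: "integrable lebesgue ?i" by (intro integrable_real_indicator) (auto simp: emeasure_lborel_Icc_eq)
  have "(b - a) * A powr p = (LINT x|lebesgue. (A powr p - p * A powr (p - 1) * A) * ?i x +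
      p * A powr (p - 1) * (?i x * cmod (g x)))"
  proof -
    have "(LINT x|lebesgue. (A powr p - p * A powr (p - 1) * A) * ?i x +
      p * A powr (p - 1) * (?i x * cmod (g x))) =
      (A powr p - p * A powr (p - 1) * A) * (b - a) + p * A powr (p - 1) * B"
      using \<open>a < b\<close> i1 i2 by (subst Bochner_Integration.integral_add)
        (simp_all add: B set_lebesgue_integral_def)
    also have "B = A * (b - a)" using \<open>a < b\<close> by (simp add: A_def)
    finally show ?thesis by (simp add: algebra_simps)
  qed
  also have "\<dots> \<le> (LINT x|lebesgue. ?i x * cmod (g x) powr p)"
  proof (rule integral_mono)
    fix x
    show "(A powr p - p * A powr (p - 1) * A) * ?i x + p * A powr (p - 1) * (?i x * cmod (g x)) \<le>
        ?i x * cmod (g x) powr p"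
      using powr_tangent_line_le[of "cmod (g x)" A p] A0 \<open>1 \<le> p\<close>
      by (auto simp: indicator_def algebra_simps)
  qed (use ip i1 i2 in auto)
  finally have "ennreal ((b - a) * A powr p) \<le> ennreal (LINT x|lebesgue. ?i x * cmod (g x) powr p)"
    by (rule ennreal_leI)
  also have "\<dots> = (\<integral>\<^sup>+x\<in>{a..b}. ennreal (cmod (g x) powr p) \<partial>lebesgue)"
    using nn_integral_eq_integral[OF ip] by (simp add: en)
  finally show ?thesis by (simp add: A_def B_def)
next
  case False
  then have "(\<integral>\<^sup>+x\<in>{a..b}. ennreal (cmod (g x) powr p) \<partial>lebesgue) = top"
    by (metis infinity_ennreal_def less_top)
  then show ?thesis by simp
qed

section \<open>Sobolev regular functions on a compact subinterval\<close>

lemma sobolev_regular_has_integral: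
  assumes reg: "sobolev_regular r I F" and "r \<ge> 1" "open I" "{a..b} \<subseteq> I" "a \<le> b"
  shows "(nth_deriv_on I r F has_integral
      (nth_deriv_on I (r - 1) F b - nth_deriv_on I (r - 1) F a)) {a..b}"
proof -
  define G where "G = nth_deriv_on I (r - 1) F"
  have D: "nth_deriv_on I r F = (\<lambda>x. vector_derivative G (at x within I))"
    unfolding G_def using \<open>r \<ge> 1\<close> nth_deriv_on_Suc[of I "r - 1" F] by simp
  have "absolutely_continuous_fun_on a b G"
    using reg assms unfolding sobolev_regular_def locally_absolutely_continuous_on_def G_def by blast
  have "AE x\<in>I in lebesgue. G differentiable (at x within I)"
    using reg unfolding sobolev_regular_def G_def by blast
  then obtain N where N: "N \<in> null_sets lebesgue" "{x. \<not> (x \<in> I \<longrightarrow> G differentiable (at x within I))} \<subseteq> N"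
    unfolding eventually_ae_filter by auto
  show ?thesis
    unfolding D G_def[symmetric]
  proof (rule has_integral_absolutely_continuous[of _ _ _ N])
    fix x assume x: "x \<in> {a..b} - N"
    then have "G differentiable (at x within I)" "x \<in> I" using N(2) \<open>{a..b} \<subseteq> I\<close> by auto
    then show "(G has_vector_derivative vector_derivative G (at x within I)) (at x within {a..b})"
      using \<open>{a..b} \<subseteq> I\<close> at_within_open[OF \<open>x \<in> I\<close> \<open>open I\<close>]
      by (metis has_vector_derivative_within_subset vector_derivative_works)
  qed (use N(1) \<open>a \<le> b\<close> \<open>absolutely_continuous_fun_on a b G\<close> in \<open>auto simp: negligible_iff_null_sets\<close>)
qed

lemma sobolev_regular_measurable:
  assumes "sobolev_regular r I F" and "r \<ge> 1" "open I" "{a..b} \<subseteq> I" "a \<le> b"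
  shows "(\<lambda>x. ennreal (cmod (nth_deriv_on I r F x) powr p) * indicator {a..b} x) \<in> borel_measurable lebesgue"
proof -
  have "nth_deriv_on I r F integrable_on {a..b}"
    using sobolev_regular_has_integral[OF assms] by blast
  then have [measurable]: "nth_deriv_on I r F \<in> borel_measurable (lebesgue_on {a..b})"
    by (rule integrable_imp_measurable)
  have "(\<lambda>x. ennreal (cmod (nth_deriv_on I r F x) powr p)) \<in> borel_measurable (lebesgue_on {a..b})"
    by measurable
  then show ?thesis
    by (subst (asm) borel_measurable_restrict_space_iff_ennreal) (auto simp: mult.commute)
qed

text \<open>Hides the integral of the modulus behind one number \<open>B\<close>, so that the
  estimates on windows use only the oscillation of a function and a scalar inequality.\<close>

lemma sobolev_regular_oscillation:
  assumes "sobolev_regular r I F" and "r \<ge> 1" "open I" "{a..b} \<subseteq> I" "a < b" "1 \<le> p"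
    and fin: "(\<integral>\<^sup>+x\<in>{a..b}. ennreal (cmod (nth_deriv_on I r F x) powr p) \<partial>lebesgue) < \<infinity>"
  obtains B where "B \<ge> 0"
    "\<And>u v. u \<in> {a..b} \<Longrightarrow> v \<in> {a..b} \<Longrightarrow>
        cmod (nth_deriv_on I (r - 1) F v - nth_deriv_on I (r - 1) F u) \<le> B"
    "ennreal ((b - a) * (B / (b - a)) powr p) \<le>
        (\<integral>\<^sup>+x\<in>{a..b}. ennreal (cmod (nth_deriv_on I r F x) powr p) \<partial>lebesgue)"
proof -
  define g where "g = nth_deriv_on I r F"
  have gi: "g integrable_on {a..b}"
    using sobolev_regular_has_integral[OF assms(1-4)] \<open>a < b\<close> unfolding g_def by force
  then have gm: "g \<in> borel_measurable (lebesgue_on {a..b})"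
    by (rule integrable_imp_measurable)
  let ?i = "indicator {a..b} :: real \<Rightarrow> real"
  have "(\<integral>\<^sup>+x. ennreal (norm (?i x *\<^sub>R g x)) \<partial>lebesgue) \<le>
      (\<integral>\<^sup>+x. indicator {a..b} x + ennreal (cmod (g x) powr p) * indicator {a..b} x \<partial>lebesgue)"
  proof (rule nn_integral_mono)
    fix x
    \<comment> \<open>This bound and the finite length of \<open>{a..b}\<close> turn the finite
      \<open>p\<close>-th power integral into absolute integrability.\<close>
    have "cmod (g x) \<le> 1 + cmod (g x) powr p"
    proof (cases "cmod (g x) \<le> 1")
      case False
      then show ?thesis using powr_mono[of 1 p "cmod (g x)"] \<open>1 \<le> p\<close> by simp
    qed (simp add: add_increasing2)
    then have "ennreal (cmod (g x)) \<le> 1 + ennreal (cmod (g x) powr p)"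
      by (metis ennreal_1 ennreal_leI ennreal_plus powr_ge_zero zero_le_one)
    then show "ennreal (norm (?i x *\<^sub>R g x)) \<le>
        indicator {a..b} x + ennreal (cmod (g x) powr p) * indicator {a..b} x"
      by (auto simp: indicator_def)
  qed
  also have "\<dots> = (\<integral>\<^sup>+x. indicator {a..b} x \<partial>lebesgue) +
      (\<integral>\<^sup>+x\<in>{a..b}. ennreal (cmod (g x) powr p) \<partial>lebesgue)"
    using sobolev_regular_measurable[OF assms(1-4)] \<open>a < b\<close>
    by (intro nn_integral_add) (auto simp: g_def intro!: borel_measurable_indicator)
  also have "\<dots> < \<infinity>"
    using fin by (auto simp: g_def emeasure_lborel_Icc_eq)
  finally have "(\<integral>\<^sup>+x. ennreal (norm (?i x *\<^sub>R g x)) \<partial>lebesgue) < \<infinity>" .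
  moreover have "(\<lambda>x. ?i x *\<^sub>R g x) \<in> borel_measurable lebesgue"
    using gm by (simp add: borel_measurable_restrict_space_iff)
  ultimately have ai: "g absolutely_integrable_on {a..b}"
    unfolding set_integrable_def by (intro integrableI_bounded)
  then have ni: "(\<lambda>x. cmod (g x)) integrable_on {a..b}"
    by (simp add: absolutely_integrable_on_def)
  define B where "B = integral {a..b} (\<lambda>x. cmod (g x))"
  have *: "cmod (nth_deriv_on I (r - 1) F v - nth_deriv_on I (r - 1) F u) \<le> B"
    if "u \<in> {a..b}" "v \<in> {a..b}" "u \<le> v" for u v
  proof -
    have "{u..v} \<subseteq> {a..b}" using that by auto
    have hi: "(g has_integral (nth_deriv_on I (r - 1) F v - nth_deriv_on I (r - 1) F u)) {u..v}"
      unfolding g_def using that \<open>{a..b} \<subseteq> I\<close>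
      by (intro sobolev_regular_has_integral assms) auto
    have ni': "(\<lambda>x. cmod (g x)) integrable_on {u..v}"
      using ni \<open>{u..v} \<subseteq> {a..b}\<close> integrable_on_subinterval by blast
    have "cmod (integral {u..v} g) \<le> integral {u..v} (\<lambda>x. cmod (g x))"
      using hi ni' by (intro integral_norm_bound_integral) auto
    also have "\<dots> \<le> B"
      unfolding B_def by (rule integral_subset_le[OF \<open>{u..v} \<subseteq> {a..b}\<close> ni' ni]) simp
    finally show ?thesis using integral_unique[OF hi] by simp
  qed
  show thesis
  proof (rule that)
    show "B \<ge> 0" unfolding B_def using ni by (rule Henstock_Kurzweil_Integration.integral_nonneg) simp
    show "cmod (nth_deriv_on I (r - 1) F v - nth_deriv_on I (r - 1) F u) \<le> B"
      if "u \<in> {a..b}" "v \<in> {a..b}" for u v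
      using *[of u v] *[of v u] that norm_minus_commute by (cases "u \<le> v") (auto simp: norm_minus_commute)
    show "ennreal ((b - a) * (B / (b - a)) powr p) \<le>
        (\<integral>\<^sup>+x\<in>{a..b}. ennreal (cmod (nth_deriv_on I r F x) powr p) \<partial>lebesgue)"
      unfolding B_def using powr_mean_le_nn_integral[OF ai \<open>a < b\<close> \<open>1 \<le> p\<close>] by (simp add: g_def)
  qed
qed

subsection \<open>Sums over overlapping families of sets\<close>

lemma ennroot_lt_infinity_iff [simp]: "ennroot p x < top \<longleftrightarrow> x < top"
  by (simp add: ennroot_def less_top)

text \<open>A factor \<open>M powr p\<close> under the root comes out as \<open>M\<close>. This is
  why all constants are collected as \<open>p\<close>-th powers: they end up independent of
  \<open>p\<close>.\<close>

lemma ennroot_le: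
  assumes "x \<le> ennreal (M powr p) * y" "M > 0" "1 \<le> p"
  shows "ennroot p x \<le> ennreal M * ennroot p y"
proof (cases "y = \<infinity>")
  case True then show ?thesis using \<open>M > 0\<close> by (simp add: ennroot_def ennreal_mult_top)
next
  case False
  then obtain v where v: "y = ennreal v" "v \<ge> 0" by (cases y) auto
  have xle: "x \<le> ennreal (M powr p * v)" using assms v by (simp add: ennreal_mult)
  then obtain u where u: "x = ennreal u" "u \<ge> 0" by (cases x) (auto simp: top_unique)
  have "u \<le> M powr p * v" using xle u v by (simp add: ennreal_le_iff)
  then have "u powr (1 / p) \<le> (M powr p * v) powr (1 / p)"
    using u assms by (intro powr_mono2) auto
  also have "\<dots> = M * v powr (1 / p)"
    using assms v by (simp add: powr_mult powr_powr)
  finally show ?thesis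
    using u v assms by (simp add: ennroot_def ennreal_mult[symmetric] ennreal_leI)
qed

text \<open>Every summand is at most the largest one, whose power is a term on the right. The factor
  \<open>card A powr p\<close> is cruder than what convexity gives, but harmless after the
  \<open>p\<close>-th root.\<close>

lemma sum_powr_le:
  fixes a :: "'i \<Rightarrow> real"
  assumes "finite A" "\<And>i. i \<in> A \<Longrightarrow> a i \<ge> 0" "1 \<le> p"
  shows "(\<Sum>i\<in>A. a i) powr p \<le> real (card A) powr p * (\<Sum>i\<in>A. a i powr p)"
proof (cases "A = {}")
  case False
  define m where "m = Max (a ` A)"
  have m: "a i \<le> m" if "i \<in> A" for i using assms(1) that by (simp add: m_def)
  have "m \<in> a ` A" unfolding m_def using assms(1) False by (intro Max_in) auto
  then obtain k where k: "k \<in> A" "m = a k" by auto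
  have "(\<Sum>i\<in>A. a i) powr p \<le> (real (card A) * m) powr p"
    using assms m sum_bounded_above[of A a m] by (intro powr_mono2 sum_nonneg) auto
  also have "\<dots> = real (card A) powr p * a k powr p"
    using assms k by (simp add: powr_mult)
  also have "\<dots> \<le> real (card A) powr p * (\<Sum>i\<in>A. a i powr p)"
    using assms(1) k by (intro mult_left_mono member_le_sum) auto
  finally show ?thesis .
qed simp

text \<open>As integrals against counting measure, unordered sums inherit additivity, monotonicity
  and the exchange with integrals from \<open>nn_integral\<close>.\<close>

lemma infsum_eq_nn_integral_count_space:
  fixes f :: "int \<Rightarrow> ennreal"
  shows "infsum f UNIV = (\<integral>\<^sup>+n. f n \<partial>count_space UNIV)"
proof (rule antisym)
  have S: "infsum f UNIV = (SUP F\<in>{F. finite F \<and> F \<subseteq> UNIV}. sum f F)"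
    by (intro nonneg_infsum_complete) auto
  show "infsum f UNIV \<le> (\<integral>\<^sup>+n. f n \<partial>count_space UNIV)"
    unfolding S
  proof (rule SUP_least)
    fix F :: "int set" assume "F \<in> {F. finite F \<and> F \<subseteq> UNIV}"
    then have "sum f F = (\<integral>\<^sup>+n. f n \<partial>count_space F)"
      by (simp add: nn_integral_count_space_finite)
    also have "\<dots> = (\<integral>\<^sup>+n. f n * indicator F n \<partial>count_space UNIV)"
      by (simp add: nn_integral_count_space_indicator)
    also have "\<dots> \<le> (\<integral>\<^sup>+n. f n \<partial>count_space UNIV)"
      by (intro nn_integral_mono) (simp add: indicator_def)
    finally show "sum f F \<le> (\<integral>\<^sup>+n. f n \<partial>count_space UNIV)" .
  qed
  \<comment> \<open>For the converse inequality \<open>int_decode\<close> enumerates the integers;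
    each partial sum of the resulting series is one of the finite sums under the supremum.\<close>
  have bij: "bij_betw int_decode UNIV UNIV" by (rule bij_int_decode)
  have "(\<integral>\<^sup>+n. f n \<partial>count_space UNIV) = (\<integral>\<^sup>+k. f (int_decode k) \<partial>count_space UNIV)"
    by (rule nn_integral_bij_count_space[OF bij, symmetric])
  also have "\<dots> = (SUP m. \<Sum>k<m. f (int_decode k))"
    by (simp add: nn_integral_count_space_nat suminf_eq_SUP)
  also have "\<dots> \<le> infsum f UNIV"
  proof (rule SUP_least)
    fix m
    have "(\<Sum>k<m. f (int_decode k)) = sum f (int_decode ` {..<m})"
      using inj_int_decode by (subst sum.reindex) (auto intro: inj_on_subset)
    then show "(\<Sum>k<m. f (int_decode k)) \<le> infsum f UNIV"
      unfolding S by (auto intro!: SUP_upper)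
  qed
  finally show "(\<integral>\<^sup>+n. f n \<partial>count_space UNIV) \<le> infsum f UNIV" .
qed

lemma infsum_cmult_ennreal:
  fixes f :: "int \<Rightarrow> ennreal"
  shows "(\<Sum>\<^sub>\<infinity>n. c * f n) = c * (\<Sum>\<^sub>\<infinity>n. f n)"
  by (simp add: infsum_eq_nn_integral_count_space nn_integral_cmult)

lemma infsum_mono_ennreal:
  fixes f :: "int \<Rightarrow> ennreal"
  assumes "\<And>n. f n \<le> g n"
  shows "(\<Sum>\<^sub>\<infinity>n. f n) \<le> (\<Sum>\<^sub>\<infinity>n. g n)"
  using assms by (simp add: infsum_eq_nn_integral_count_space nn_integral_mono)

lemma infsum_add_ennreal:
  fixes f :: "int \<Rightarrow> ennreal"
  shows "(\<Sum>\<^sub>\<infinity>n. f n + g n) = (\<Sum>\<^sub>\<infinity>n. f n) + (\<Sum>\<^sub>\<infinity>n. g n)"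
  by (simp add: infsum_eq_nn_integral_count_space nn_integral_add)

lemma infsum_sum_ennreal:
  fixes f :: "'i \<Rightarrow> int \<Rightarrow> ennreal"
  shows "(\<Sum>\<^sub>\<infinity>n. \<Sum>j\<in>A. f j n) = (\<Sum>j\<in>A. \<Sum>\<^sub>\<infinity>n. f j n)"
  by (simp add: infsum_eq_nn_integral_count_space nn_integral_sum)

text \<open>Tonelli's theorem turns the sum of integrals into the integral of
  \<open>\<phi> x\<close> times the number of sets \<open>J n\<close> that contain
  \<open>x\<close>.\<close>

lemma infsum_nn_integral_overlap_le:
  fixes J :: "int \<Rightarrow> 'a set"
  assumes meas: "\<And>n. (\<lambda>x. \<phi> x * indicator (J n) x) \<in> borel_measurable M"
    and card: "\<And>x. x \<in> (\<Union>n. J n) \<Longrightarrow> finite {n. x \<in> J n} \<and> card {n. x \<in> J n} \<le> k"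
  shows "(\<Sum>\<^sub>\<infinity>n. \<integral>\<^sup>+x\<in>J n. \<phi> x \<partial>M) \<le> ennreal (real k) * (\<integral>\<^sup>+x\<in>(\<Union>n. J n). \<phi> x \<partial>M)"
proof -
  let ?I = "\<Union>n. J n"
  \<comment> \<open>The restriction to the union is a supremum of the restrictions to the single
    sets, which transfers measurability to it.\<close>
  have eq: "\<phi> x * indicator ?I x = (SUP n. \<phi> x * indicator (J n) x)" for x
  proof (cases "x \<in> ?I")
    case True
    then obtain m where m: "x \<in> J m" by blast
    show ?thesis
    proof (rule antisym)
      show "\<phi> x * indicator ?I x \<le> (SUP n. \<phi> x * indicator (J n) x)"
        using m by (intro SUP_upper2[of m]) (auto simp: indicator_def)
      show "(SUP n. \<phi> x * indicator (J n) x) \<le> \<phi> x * indicator ?I x"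
        by (intro SUP_least) (auto simp: indicator_def)
    qed
  qed simp
  have mI: "(\<lambda>x. \<phi> x * indicator ?I x) \<in> borel_measurable M"
    unfolding eq by (intro borel_measurable_SUP meas) auto
  have "(\<Sum>\<^sub>\<infinity>n. \<integral>\<^sup>+x\<in>J n. \<phi> x \<partial>M) =
      (\<integral>\<^sup>+x. \<integral>\<^sup>+n. \<phi> x * indicator (J n) x \<partial>count_space UNIV \<partial>M)"
    unfolding infsum_eq_nn_integral_count_space
    by (rule nn_integral_count_space_nn_integral[symmetric]) (use meas in auto)
  also have "\<dots> \<le> (\<integral>\<^sup>+x. ennreal (real k) * (\<phi> x * indicator ?I x) \<partial>M)"
  proof (rule nn_integral_mono)
    fix x
    have "(\<integral>\<^sup>+n. \<phi> x * indicator (J n) x \<partial>count_space UNIV) =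
        (\<integral>\<^sup>+n. \<phi> x * indicator {n. x \<in> J n} n \<partial>count_space UNIV)"
      by (intro nn_integral_cong) (simp add: indicator_def)
    also have "\<dots> = \<phi> x * emeasure (count_space UNIV) {n. x \<in> J n}"
      by (subst nn_integral_cmult) auto
    also have "\<dots> \<le> ennreal (real k) * (\<phi> x * indicator ?I x)"
    proof (cases "x \<in> ?I")
      case True
      then have "emeasure (count_space UNIV) {n. x \<in> J n} \<le> ennreal (real k)"
        using card[OF True] by (simp add: emeasure_count_space ennreal_of_nat_eq_real_of_nat)
      then have "\<phi> x * emeasure (count_space UNIV) {n. x \<in> J n} \<le> \<phi> x * ennreal (real k)"
        by (rule mult_left_mono) simp
      then show ?thesis using True by (simp add: mult.commute)
    next
      case False
      then have "{n. x \<in> J n} = {}" by blast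
      then show ?thesis by simp
    qed
    finally show "(\<integral>\<^sup>+n. \<phi> x * indicator (J n) x \<partial>count_space UNIV) \<le>
        ennreal (real k) * (\<phi> x * indicator ?I x)" .
  qed
  also have "\<dots> = ennreal (real k) * (\<integral>\<^sup>+x\<in>?I. \<phi> x \<partial>M)"
    by (rule nn_integral_cmult[OF mI])
  finally show ?thesis .
qed

text \<open>Each point of \<open>I\<close> needs only one suitable \<open>n\<close>, which may vary
  with the point: this single term already dominates \<open>\<phi> x\<close> in the sum of all
  \<open>c n * indicator (J n) x\<close>, and that sum is integrated term by term.\<close>

lemma nn_integral_cover_le:
  fixes J :: "int \<Rightarrow> 'a set"
  assumes meas: "\<And>n. J n \<in> sets M"
    and cover: "AE x in M. x \<in> I \<longrightarrow> (\<exists>n. x \<in> J n \<and> \<phi> x \<le> c n)"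
  shows "(\<integral>\<^sup>+x\<in>I. \<phi> x \<partial>M) \<le> (\<Sum>\<^sub>\<infinity>n. c n * emeasure M (J n))"
proof -
  have "(\<integral>\<^sup>+x\<in>I. \<phi> x \<partial>M) \<le> (\<integral>\<^sup>+x. \<integral>\<^sup>+n. c n * indicator (J n) x \<partial>count_space UNIV \<partial>M)"
  proof (rule nn_integral_mono_AE, use cover in eventually_elim)
    fix x assume *: "x \<in> I \<longrightarrow> (\<exists>n. x \<in> J n \<and> \<phi> x \<le> c n)"
    show "\<phi> x * indicator I x \<le> (\<integral>\<^sup>+n. c n * indicator (J n) x \<partial>count_space UNIV)"
    proof (cases "x \<in> I")
      case True
      then obtain n where n: "x \<in> J n" "\<phi> x \<le> c n" using * by blast
      have "\<phi> x \<le> c n * indicator (J n) x" using n by simp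
      also have "\<dots> \<le> (\<integral>\<^sup>+n. c n * indicator (J n) x \<partial>count_space UNIV)"
        by (rule nn_integral_ge_point) simp
      finally show ?thesis using True by simp
    qed simp
  qed
  also have "\<dots> = (\<integral>\<^sup>+n. \<integral>\<^sup>+x. c n * indicator (J n) x \<partial>M \<partial>count_space UNIV)"
    using meas by (intro nn_integral_count_space_nn_integral) auto
  also have "\<dots> = (\<Sum>\<^sub>\<infinity>n. c n * emeasure M (J n))"
    using meas by (simp add: infsum_eq_nn_integral_count_space nn_integral_cmult_indicator)
  finally show ?thesis .
qed

subsection \<open>Lower bounds on a window\<close>

locale node_sequence =
  fixes lam :: "int \<Rightarrow> real"
  assumes strict_mono_lam: "strict_mono lam"
begin

definition "window r n = {lam n..lam (n + int r)}"

lemma lam_less_iff [simp]: "lam m < lam n \<longleftrightarrow> m < n"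
  using strict_mono_lam by (simp add: strict_mono_less)

lemma lam_le_iff [simp]: "lam m \<le> lam n \<longleftrightarrow> m \<le> n"
  using strict_mono_lam by (simp add: strict_mono_less_eq)

lemma gap_pos [simp]: "gap lam n > 0"
  by (simp add: gap_def)

lemma between_nodes:
  assumes "lam i \<le> x" "x < lam j"
  obtains n where "lam n \<le> x" "x < lam (n + 1)" "i \<le> n" "n < j"
proof -
  have "i < j" using assms by (metis lam_less_iff order_le_less_trans)
  define k where "k = (LEAST k. x < lam (i + int k))"
  have ex: "x < lam (i + int (nat (j - i)))" using assms \<open>i < j\<close> by simp
  have k: "x < lam (i + int k)" unfolding k_def using ex by (rule LeastI)
  have k0: "k \<noteq> 0" using k assms by (intro notI) simp
  have "\<not> x < lam (i + int (k - 1))" unfolding k_def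
    by (rule not_less_Least) (use k0 k_def in simp)
  moreover have "k \<le> nat (j - i)" unfolding k_def using ex by (rule Least_le)
  ultimately show thesis using k k0 \<open>i < j\<close>
    by (intro that[of "i + int (k - 1)"]) (auto simp: of_nat_diff algebra_simps)
qed

text \<open>There is no first and no last node, so each closed piece lies strictly between two
  further nodes. The strict form exhibits the interval as open, which makes derivatives within it
  ordinary derivatives.\<close>

lemma mem_node_interval_iff: "x \<in> node_interval lam \<longleftrightarrow> (\<exists>m n. lam m < x \<and> x < lam n)"
proof
  assume "x \<in> node_interval lam"
  then obtain n where "lam n \<le> x" "x \<le> lam (n + 1)" by (auto simp: node_interval_def)
  then have "lam (n - 1) < x" "x < lam (n + 2)"
    using lam_less_iff[of "n - 1" n] lam_less_iff[of "n + 1" "n + 2"] by linarith+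
  then show "\<exists>m n. lam m < x \<and> x < lam n" by blast
next
  assume "\<exists>m n. lam m < x \<and> x < lam n"
  then obtain m n where "lam m \<le> x" "x < lam n" using less_imp_le by blast
  then obtain k where "lam k \<le> x" "x < lam (k + 1)" by (rule between_nodes)
  then show "x \<in> node_interval lam" by (auto simp: node_interval_def)
qed

lemma node_interval_piece:
  assumes "x \<in> node_interval lam"
  obtains n where "lam n \<le> x" "x < lam (n + 1)"
  using assms between_nodes by (metis less_imp_le mem_node_interval_iff)

lemma node_interval_eq: "node_interval lam = (\<Union>m n. {lam m<..<lam n})"
  by (auto simp: mem_node_interval_iff)

lemma open_node_interval [simp]: "open (node_interval lam)"
  unfolding node_interval_eq by (intro open_UN ballI) auto

lemma Icc_subset_node_interval [simp]: "{lam m..lam n} \<subseteq> node_interval lam"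
proof
  fix x assume "x \<in> {lam m..lam n}"
  then have "lam (m - 1) < x" "x < lam (n + 1)"
    using lam_less_iff[of "m - 1" m] lam_less_iff[of n "n + 1"] by (auto simp del: lam_less_iff)
  then show "x \<in> node_interval lam" unfolding mem_node_interval_iff by blast
qed

lemma Union_window:
  assumes "r \<ge> 1" shows "(\<Union>n. window r n) = node_interval lam"
proof
  show "(\<Union>n. window r n) \<subseteq> node_interval lam"
    unfolding window_def using Icc_subset_node_interval by blast
  show "node_interval lam \<subseteq> (\<Union>n. window r n)"
  proof
    fix x assume "x \<in> node_interval lam"
    then obtain n where n: "lam n \<le> x" "x \<le> lam (n + 1)" by (auto simp: node_interval_def)
    have "lam (n + 1) \<le> lam (n + int r)" using assms by simp
    then have "x \<in> window r n" using n by (auto simp: window_def simp del: lam_le_iff)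
    then show "x \<in> (\<Union>n. window r n)" by blast
  qed
qed

text \<open>If \<open>lam m \<le> x < lam (m + 1)\<close>, a window containing \<open>x\<close>
  starts at an index from \<open>m - r\<close> to \<open>m\<close>. The count \<open>r + 1\<close>
  is attained at the nodes, since \<open>lam m\<close> is also the right end of window
  \<open>m - r\<close>.\<close>

lemma card_window_overlap:
  assumes "x \<in> node_interval lam"
  shows "finite {n. x \<in> window r n} \<and> card {n. x \<in> window r n} \<le> r + 1"
proof -
  obtain m where m: "lam m \<le> x" "x < lam (m + 1)" using assms by (rule node_interval_piece)
  have sub: "{n. x \<in> window r n} \<subseteq> {m - int r..m}"
  proof
    fix n assume "n \<in> {n. x \<in> window r n}"
    then have "lam n < lam (m + 1)" "lam m \<le> lam (n + int r)"
      using m by (auto simp: window_def simp del: lam_le_iff lam_less_iff)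
    then show "n \<in> {m - int r..m}" by simp
  qed
  have "card {n. x \<in> window r n} \<le> card {m - int r..m}"
    by (rule card_mono[OF _ sub]) simp
  then show ?thesis using finite_subset[OF sub] by simp
qed

end

text \<open>The witness is a minimum point of \<open>cmod (F x)\<close>, which exists by continuity
  on a compact interval.\<close>

lemma exists_powr_le_mean:
  assumes "continuous_on {a..b} F" "a < b" "1 \<le> p"
  obtains x where "x \<in> {a..b}"
    "ennreal ((b - a) * cmod (F x) powr p) \<le> (\<integral>\<^sup>+x\<in>{a..b}. ennreal (cmod (F x) powr p) \<partial>lebesgue)"
proof -
  have "continuous_on {a..b} (\<lambda>x. cmod (F x))" using assms(1) by (intro continuous_intros)
  then obtain x where x: "x \<in> {a..b}" "\<And>y. y \<in> {a..b} \<Longrightarrow> cmod (F x) \<le> cmod (F y)"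
    using continuous_attains_inf[of "{a..b}" "\<lambda>x. cmod (F x)"] \<open>a < b\<close> by auto
  have "ennreal ((b - a) * cmod (F x) powr p) = (\<integral>\<^sup>+y. ennreal (cmod (F x) powr p) * indicator {a..b} y \<partial>lebesgue)"
    using \<open>a < b\<close> by (subst nn_integral_cmult_indicator) (auto simp: ennreal_mult mult.commute)
  also have "\<dots> \<le> (\<integral>\<^sup>+x\<in>{a..b}. ennreal (cmod (F x) powr p) \<partial>lebesgue)"
    using x(2) \<open>1 \<le> p\<close> by (intro nn_integral_mono) (auto simp: indicator_def intro!: ennreal_leI powr_mono2)
  finally show thesis using x that by blast
qed

lemma sobolev_regular_2_has_vector_derivative:
  assumes "sobolev_regular 2 I F" "open I" "x \<in> I"
  shows "(F has_vector_derivative nth_deriv_on I 1 F x) (at x)"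
proof -
  have "nth_deriv_on I 0 F differentiable_on I"
    using assms(1) unfolding sobolev_regular_def by (metis add_0 one_less_numeral_iff semiring_norm(76))
  then have "F differentiable (at x within I)"
    using assms(3) by (simp add: differentiable_on_def)
  then show ?thesis
    using assms nth_deriv_on_Suc[of I 0 F] at_within_open[of x I]
    by (simp add: vector_derivative_works)
qed

text \<open>For \<open>r = 1\<close>, divisions into a single interval in the definition of absolute
  continuity give continuity. For \<open>r = 2\<close>, \<open>F\<close> is even
  differentiable.\<close>

lemma sobolev_regular_continuous_on:
  assumes "sobolev_regular r I F" "r \<in> {1, 2}" "open I"
  shows "continuous_on I F"
proof (cases "r = 1")
  case True
  show ?thesis
  proof (rule continuous_at_imp_continuous_on, rule ballI)
    fix x assume "x \<in> I"
    then obtain d where d: "d > 0" "cball x d \<subseteq> I"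
      using \<open>open I\<close> open_contains_cball by blast
    define a b where "a = x - d" and "b = x + d"
    have ab: "a < x" "x < b" "{a..b} \<subseteq> I" using d by (auto simp: a_def b_def cball_eq_atLeastAtMost)
    have "absolutely_continuous_fun_on a b F"
      using assms(1) True ab unfolding sobolev_regular_def locally_absolutely_continuous_on_def
      by (metis diff_self_eq_0 less_imp_le nth_deriv_on_0 order_trans)
    have "\<exists>\<delta>>0. \<forall>y. dist y x < \<delta> \<longrightarrow> dist (F y) (F x) < \<epsilon>" if \<epsilon>: "\<epsilon> > 0" for \<epsilon>
    proof -
      obtain \<delta> where \<delta>: "\<delta> > 0" "\<And>d T. d division_of T \<Longrightarrow> T \<subseteq> {a..b} \<Longrightarrow>
          (\<Sum>k\<in>d. Sup k - Inf k) < \<delta> \<Longrightarrow> (\<Sum>k\<in>d. cmod (F (Sup k) - F (Inf k))) < \<epsilon>"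
        using absolutely_continuous_fun_onD[OF \<open>absolutely_continuous_fun_on a b F\<close> \<epsilon>] by auto
      have *: "cmod (F v - F u) < \<epsilon>" if "u \<le> v" "v - u < \<delta>" "u \<in> {a..b}" "v \<in> {a..b}" for u v
      proof -
        have "{{u..v}} division_of {u..v}"
          using that division_of_self[of u v] by simp
        then show ?thesis using \<delta>(2)[of "{{u..v}}" "{u..v}"] that by simp
      qed
      show ?thesis
      proof (intro exI conjI allI impI)
        show "min \<delta> d > 0" using \<delta> d by simp
        fix y assume "dist y x < min \<delta> d"
        then show "dist (F y) (F x) < \<epsilon>"
          using *[of x y] *[of y x] ab by (cases "x \<le> y") (auto simp: dist_real_def dist_norm a_def b_def norm_minus_commute)
      qed
    qed
    then show "isCont F x" by (simp add: continuous_at_eps_delta)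
  qed
next
  case False
  then show ?thesis
    using assms sobolev_regular_2_has_vector_derivative
    by (auto intro!: continuous_at_imp_continuous_on has_vector_derivative_continuous)
qed

text \<open>Mean value inequality for \<open>F x - x *\<^sub>R F' c\<close>, whose derivative
  \<open>F' x - F' c\<close> is bounded by the oscillation \<open>B\<close>.\<close>

lemma difference_minus_derivative_le:
  assumes der: "\<And>x. x \<in> {a..b} \<Longrightarrow> (F has_vector_derivative F' x) (at x)"
    and osc: "\<And>u v. u \<in> {a..b} \<Longrightarrow> v \<in> {a..b} \<Longrightarrow> cmod (F' v - F' u) \<le> B"
    and m: "u \<in> {a..b}" "v \<in> {a..b}" "c \<in> {a..b}"
  shows "cmod (F v - F u - complex_of_real (v - u) * F' c) \<le> B * \<bar>v - u\<bar>"
proof -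
  define G where "G x = F x - x *\<^sub>R F' c" for x
  have G: "(G has_derivative (\<lambda>h. h *\<^sub>R (F' x - F' c))) (at x within {a..b})" if "x \<in> {a..b}" for x
  proof -
    have "((\<lambda>x. x *\<^sub>R F' c) has_vector_derivative F' c) (at x)"
      by (auto intro!: derivative_eq_intros)
    then have "(G has_vector_derivative (F' x - F' c)) (at x)"
      unfolding G_def by (intro has_vector_derivative_diff der that)
    then show ?thesis
      unfolding has_vector_derivative_def by (rule has_derivative_at_withinI)
  qed
  have "onorm (\<lambda>h. h *\<^sub>R (F' x - F' c)) \<le> B" if "x \<in> {a..b}" for x
  proof (rule onorm_le)
    fix h :: real
    have "\<bar>h\<bar> * cmod (F' x - F' c) \<le> \<bar>h\<bar> * B" by (intro mult_left_mono osc m that) simp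
    then show "norm (h *\<^sub>R (F' x - F' c)) \<le> B * norm h" by (simp add: mult.commute)
  qed
  then have "norm (G v - G u) \<le> B * norm (v - u)"
    using G m by (intro differentiable_bound[of "{a..b}" G]) auto
  also have "G v - G u = F v - F u - complex_of_real (v - u) * F' c"
    by (simp add: G_def scaleR_conv_of_real algebra_simps)
  finally show ?thesis by simp
qed

lemma node_dd_cong:
  assumes "\<And>m. f (lam m) = g (lam m)"
  shows "node_dd lam f n k = node_dd lam g n k"
  by (induction k arbitrary: n) (simp_all add: node_dd_0 node_dd_Suc assms)

lemma node_dd_1: "node_dd lam f n (Suc 0) = (f (lam (n + 1)) - f (lam n)) / complex_of_real (lam (n + 1) - lam n)"
  by (simp add: node_dd_Suc node_dd_0)

lemma node_dd_2: "node_dd lam f n 2 =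
    (node_dd lam f (n + 1) (Suc 0) - node_dd lam f n (Suc 0)) / complex_of_real (lam (n + 2) - lam n)"
  unfolding numeral_2_eq_2 by (subst node_dd_Suc) simp

context node_sequence
begin

lemma window_subset: "window r n \<subseteq> node_interval lam"
  by (simp add: window_def)

text \<open>A difference quotient over either gap of the window is in effect an average of
  \<open>F'\<close>, so it is within the oscillation of any single value of \<open>F'\<close>
  there.\<close>

lemma first_difference_quotient_bound:
  assumes der: "\<And>x. x \<in> window 2 n \<Longrightarrow> (F has_vector_derivative F' x) (at x)"
    and osc: "\<And>u v. u \<in> window 2 n \<Longrightarrow> v \<in> window 2 n \<Longrightarrow> cmod (F' v - F' u) \<le> B"
    and m: "n \<le> m" "m < n + 2" and c: "c \<in> window 2 n"
  shows "cmod (node_dd lam F m (Suc 0) - F' c) \<le> B"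
proof -
  let ?h = "lam (m + 1) - lam m"
  have h: "?h > 0" by simp
  have mem: "lam (m + 1) \<in> window 2 n" "lam m \<in> window 2 n" using m by (auto simp: window_def)
  have "cmod (F (lam (m + 1)) - F (lam m) - complex_of_real ?h * F' c) \<le> B * \<bar>?h\<bar>"
    using difference_minus_derivative_le[of "lam n" "lam (n + int 2)" F F' B] der osc mem c
    unfolding window_def by blast
  moreover have "node_dd lam F m (Suc 0) - F' c =
      (F (lam (m + 1)) - F (lam m) - complex_of_real ?h * F' c) / complex_of_real ?h"
  proof -
    have "complex_of_real ?h \<noteq> 0" using h by (metis less_irrefl of_real_eq_0_iff)
    then show ?thesis unfolding node_dd_1 by (simp add: diff_divide_distrib del: of_real_diff)
  qed
  ultimately show ?thesis using h by (simp add: norm_divide pos_divide_le_eq del: of_real_diff)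
qed

lemma window_length_pos: "r \<ge> 1 \<Longrightarrow> lam (n + int r) - lam n > 0"
  by simp

text \<open>For \<open>r = 2\<close> both first-order differences are within \<open>B\<close> of the
  derivative at \<open>lam n\<close>, hence within \<open>2 * B\<close> of each other; the
  second-order difference divides this by the window length.\<close>

lemma node_dd_bound_oscillation:
  assumes "sobolev_regular r (node_interval lam) F" "r \<in> {1, 2}"
    and osc: "\<And>u v. u \<in> window r n \<Longrightarrow> v \<in> window r n \<Longrightarrow>
        cmod (nth_deriv_on (node_interval lam) (r - 1) F v - nth_deriv_on (node_interval lam) (r - 1) F u) \<le> B"
  shows "cmod (node_dd lam F n r) \<le> (if r = 1 then 1 else 2) * (B / (lam (n + int r) - lam n))"
proof (cases "r = 1")
  case True
  then have "cmod (F (lam (n + 1)) - F (lam n)) \<le> B"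
    using osc[of "lam n" "lam (n + 1)"] by (simp add: window_def)
  then show ?thesis using True window_length_pos[of 1 n]
    by (simp add: node_dd_1 norm_divide divide_right_mono flip: of_real_diff)
next
  case False
  then have r: "r = 2" using assms by simp
  let ?I = "node_interval lam"
  let ?F' = "nth_deriv_on ?I 1 F"
  have der: "(F has_vector_derivative ?F' x) (at x)" if "x \<in> window 2 n" for x
    using sobolev_regular_2_has_vector_derivative[OF _ open_node_interval subsetD[OF window_subset that]]
      assms(1) r by simp
  have osc': "\<And>u v. u \<in> window 2 n \<Longrightarrow> v \<in> window 2 n \<Longrightarrow> cmod (?F' v - ?F' u) \<le> B"
    using osc r by simp
  have c: "lam n \<in> window 2 n" by (simp add: window_def)
  have "cmod (node_dd lam F (n + 1) (Suc 0) - ?F' (lam n)) \<le> B"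
    "cmod (node_dd lam F n (Suc 0) - ?F' (lam n)) \<le> B"
    by (rule first_difference_quotient_bound[OF der osc' _ _ c]; simp)+
  then have "cmod (node_dd lam F (n + 1) (Suc 0) - node_dd lam F n (Suc 0)) \<le> 2 * B"
    using norm_triangle_ineq4[of "node_dd lam F (n + 1) (Suc 0) - ?F' (lam n)"
      "node_dd lam F n (Suc 0) - ?F' (lam n)"] by simp
  then show ?thesis using window_length_pos[of 2 n] r
    by (simp add: node_dd_2 norm_divide divide_right_mono flip: of_real_diff)
qed

lemma node_dd_powr_le_window_integral:
  assumes reg: "sobolev_regular r (node_interval lam) F" and r: "r \<in> {1, 2}" and "1 \<le> p"
    and fin: "(\<integral>\<^sup>+x\<in>window r n. ennreal (cmod (nth_deriv_on (node_interval lam) r F x) powr p) \<partial>lebesgue) < \<infinity>"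
  shows "ennreal ((lam (n + int r) - lam n) * cmod (node_dd lam F n r) powr p) \<le>
    ennreal (2 powr p) *
      (\<integral>\<^sup>+x\<in>window r n. ennreal (cmod (nth_deriv_on (node_interval lam) r F x) powr p) \<partial>lebesgue)"
proof -
  let ?I = "node_interval lam" and ?H = "lam (n + int r) - lam n"
  have H: "?H > 0" using r by auto
  obtain B where B: "B \<ge> 0" "\<And>u v. u \<in> window r n \<Longrightarrow> v \<in> window r n \<Longrightarrow>
        cmod (nth_deriv_on ?I (r - 1) F v - nth_deriv_on ?I (r - 1) F u) \<le> B"
    "ennreal (?H * (B / ?H) powr p) \<le>
        (\<integral>\<^sup>+x\<in>window r n. ennreal (cmod (nth_deriv_on ?I r F x) powr p) \<partial>lebesgue)"
    using sobolev_regular_oscillation[OF reg _ _ _ _ \<open>1 \<le> p\<close>, of "lam n" "lam (n + int r)"] r H fin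
    unfolding window_def by auto
  have "cmod (node_dd lam F n r) \<le> (if r = 1 then 1 else 2) * (B / ?H)"
    by (rule node_dd_bound_oscillation[OF reg r B(2)])
  also have "\<dots> \<le> 2 * (B / ?H)" using B(1) H by (intro mult_right_mono) auto
  finally have "cmod (node_dd lam F n r) powr p \<le> (2 * (B / ?H)) powr p"
    using \<open>1 \<le> p\<close> by (intro powr_mono2) auto
  also have "\<dots> = 2 powr p * (B / ?H) powr p" using B(1) H by (subst powr_mult) auto
  finally have "?H * cmod (node_dd lam F n r) powr p \<le> 2 powr p * (?H * (B / ?H) powr p)"
    using H by (simp add: mult_left_mono mult.left_commute)
  then have "ennreal (?H * cmod (node_dd lam F n r) powr p) \<le> ennreal (2 powr p) * ennreal (?H * (B / ?H) powr p)"
    using H by (simp add: ennreal_mult[symmetric] ennreal_leI)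
  also have "\<dots> \<le> ennreal (2 powr p) *
      (\<integral>\<^sup>+x\<in>window r n. ennreal (cmod (nth_deriv_on ?I r F x) powr p) \<partial>lebesgue)"
    by (intro mult_left_mono B(3)) simp
  finally show ?thesis .
qed

text \<open>Two points in the outer thirds of the window, at which \<open>F\<close> is at most its mean, control the
  value and the slope of \<open>F\<close> on the whole window, up to the oscillation \<open>B\<close> of the derivative.\<close>

lemma lower_order_bound_pointwise:
  assumes reg: "sobolev_regular r (node_interval lam) F" and r: "r \<in> {1, 2}" and "j < r"
    and B: "B \<ge> 0" "\<And>u v. u \<in> window r n \<Longrightarrow> v \<in> window r n \<Longrightarrow>
        cmod (nth_deriv_on (node_interval lam) (r - 1) F v - nth_deriv_on (node_interval lam) (r - 1) F u) \<le> B"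
    and H: "H = lam (n + int r) - lam n"
    and xy: "x \<in> {lam n..lam n + H / 3}" "y \<in> {lam n + 2 * H / 3..lam (n + int r)}"
  shows "H ^ j * cmod (node_dd lam F n j) \<le> 4 * (H ^ (r - 1) * B + cmod (F x) + cmod (F y))"
proof (cases "r = 1")
  case True
  have Hpos: "H > 0" using True H by simp
  have "window 1 n = {lam n..lam n + H}" using H True by (simp add: window_def)
  then have "x \<in> window 1 n" "lam n \<in> window 1 n" using xy Hpos by auto
  then have "cmod (F (lam n) - F x) \<le> B" using B(2)[of x "lam n"] True by simp
  then have "cmod (F (lam n)) \<le> B + cmod (F x)"
    using norm_triangle_sub[of "F (lam n)" "F x"] by linarith
  then have "cmod (F (lam n)) \<le> 4 * (B + cmod (F x) + cmod (F y))"
    using B(1) norm_ge_zero[of "F x"] norm_ge_zero[of "F y"] by argo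
  then show ?thesis using True \<open>j < r\<close> by (simp add: node_dd_0)
next
  case False
  then have r2: "r = 2" using r by simp
  have Hpos: "H > 0" using r2 H by simp
  let ?I = "node_interval lam"
  let ?F' = "nth_deriv_on ?I 1 F"
  have osc: "\<And>u v. u \<in> window 2 n \<Longrightarrow> v \<in> window 2 n \<Longrightarrow> cmod (?F' v - ?F' u) \<le> B"
    using B(2) r2 by simp
  have der: "(F has_vector_derivative ?F' x) (at x)" if "x \<in> window 2 n" for x
    using sobolev_regular_2_has_vector_derivative[OF _ open_node_interval subsetD[OF window_subset that]]
      reg r2 by simp
  have W: "window 2 n = {lam n..lam n + H}" using H r2 by (simp add: window_def)
  have mem: "x \<in> window 2 n" "y \<in> window 2 n" "lam n \<in> window 2 n" "y - x \<ge> H / 3"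
  proof -
    have "lam (n + int r) = lam n + H" using H by simp
    then show "x \<in> window 2 n" "y \<in> window 2 n" "lam n \<in> window 2 n" "y - x \<ge> H / 3"
      using xy Hpos unfolding W by auto
  qed
  define c where "c = cmod (?F' (lam n))"
  have MV: "cmod (F v - F u - complex_of_real (v - u) * ?F' (lam n)) \<le> B * \<bar>v - u\<bar>"
    if "u \<in> window 2 n" "v \<in> window 2 n" for u v
    using difference_minus_derivative_le[of "lam n" "lam n + H" F ?F' B] der osc that mem
    unfolding W by blast
  \<comment> \<open>Because \<open>y - x \<ge> H / 3\<close>, the increment \<open>F y - F x\<close>
    determines the slope up to \<open>B\<close>, at the price of a factor 3.\<close>
  have c1: "H * c \<le> H * B + 3 * (cmod (F x) + cmod (F y))"
  proof -
    have "cmod (complex_of_real (y - x) * ?F' (lam n)) \<le> cmod (F y - F x) + B * \<bar>y - x\<bar>"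
      using MV[OF mem(1,2)] norm_triangle_sub[of "complex_of_real (y - x) * ?F' (lam n)" "F y - F x"]
      by (simp add: norm_minus_commute)
    then have "(y - x) * c \<le> cmod (F y - F x) + B * (y - x)"
      using mem(4) Hpos by (simp add: norm_mult c_def flip: of_real_diff)
    then have "(y - x) * (c - B) \<le> cmod (F x) + cmod (F y)"
      using norm_triangle_ineq4[of "F y" "F x"] by (simp add: algebra_simps)
    moreover have "H / 3 * (c - B) \<le> (y - x) * (c - B)" if "c \<ge> B"
      using that mem(4) by (intro mult_right_mono) auto
    \<comment> \<open>For \<open>c < B\<close> the left side is negative, so only
      \<open>c \<ge> B\<close> needs the estimate.\<close>
    ultimately have "H / 3 * (c - B) \<le> cmod (F x) + cmod (F y)"
      using Hpos mult_nonneg_nonpos[of "H / 3" "c - B"] norm_ge_zero[of "F x"] norm_ge_zero[of "F y"]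
      by (cases "c \<ge> B") (simp_all del: norm_ge_zero)
    then show ?thesis by (simp add: algebra_simps)
  qed
  have HB: "0 \<le> H * B" using Hpos B(1) by simp
  have "j = 0 \<or> j = 1" using \<open>j < r\<close> r2 by auto
  then show ?thesis
  proof
    assume j: "j = 0"
    \<comment> \<open>The distance from \<open>x\<close> to \<open>lam n\<close> is at most
      \<open>H / 3\<close>, which cancels the factor 3 in \<open>c1\<close>.\<close>
    have "cmod (F (lam n) - F x) \<le> \<bar>lam n - x\<bar> * c + B * \<bar>lam n - x\<bar>"
      using MV[OF mem(1,3)] norm_triangle_sub[of "F (lam n) - F x" "complex_of_real (lam n - x) * ?F' (lam n)"]
      by (simp add: norm_mult c_def flip: of_real_diff)
    also have "\<dots> = \<bar>lam n - x\<bar> * (c + B)" by (simp add: algebra_simps)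
    also have "\<dots> \<le> (H / 3) * (c + B)"
      using xy B(1) by (intro mult_right_mono) (auto simp: c_def)
    finally have "cmod (F (lam n)) \<le> cmod (F x) + (H * c + H * B) / 3"
    proof -
      assume *: "cmod (F (lam n) - F x) \<le> H / 3 * (c + B)"
      have "H / 3 * (c + B) = (H * c + H * B) / 3" by (simp add: algebra_simps)
      then show ?thesis using * norm_triangle_sub[of "F (lam n)" "F x"] by linarith
    qed
    with c1 HB have "cmod (F (lam n)) \<le> 4 * (H * B + cmod (F x) + cmod (F y))"
      using norm_ge_zero[of "F x"] norm_ge_zero[of "F y"] by argo
    then show ?thesis using j r2 by (simp add: node_dd_0)
  next
    assume j: "j = 1"
    have "cmod (node_dd lam F n (Suc 0) - ?F' (lam n)) \<le> B"
      by (rule first_difference_quotient_bound[OF der osc _ _ mem(3)]) auto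
    then have "cmod (node_dd lam F n (Suc 0)) \<le> c + B"
      using norm_triangle_sub[of "node_dd lam F n (Suc 0)" "?F' (lam n)"] by (simp add: c_def)
    then have "H * cmod (node_dd lam F n (Suc 0)) \<le> H * c + H * B"
      using Hpos by (metis distrib_left less_imp_le mult_left_mono)
    with c1 HB have "H * cmod (node_dd lam F n (Suc 0)) \<le> 4 * (H * B + cmod (F x) + cmod (F y))"
      using norm_ge_zero[of "F x"] norm_ge_zero[of "F y"] by argo
    then show ?thesis using j r2 by simp
  qed
qed

text \<open>The constant 72 is 4 from the pointwise bound, times 3 for splitting the power of a sum
  of three terms, times 6 for two means over thirds of the window. The square bounds
  \<open>H ^ r\<close>.\<close>

lemma lower_order_powr_le_window_integral:
  assumes reg: "sobolev_regular r (node_interval lam) F" and r: "r \<in> {1, 2}" and "j < r" and "1 \<le> p"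
    and gaps: "\<And>n. lam (n + 1) - lam n \<le> K"
    and P: "P = (\<integral>\<^sup>+x\<in>window r n. ennreal (cmod (F x) powr p) \<partial>lebesgue)"
    and Q: "Q = (\<integral>\<^sup>+x\<in>window r n. ennreal (cmod (nth_deriv_on (node_interval lam) r F x) powr p) \<partial>lebesgue)"
    and fin: "P < \<infinity>" "Q < \<infinity>"
  shows "ennreal ((lam (n + int r) - lam n) powr (real j * p + 1) * cmod (node_dd lam F n j) powr p) \<le>
    ennreal ((72 * (1 + 2 * K) ^ 2) powr p) * (P + Q)"
proof -
  define H where "H = lam (n + int r) - lam n"
  define L where "L = (1 + 2 * K) ^ 2"
  have Hpos: "H > 0" using r by (auto simp: H_def)
  have Kpos: "K \<ge> 0" using gaps[of n] lam_less_iff[of n "n + 1"] by linarith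
  have HK: "H \<le> 2 * K"
    using r gaps[of n] gaps[of "n + 1"] Kpos by (auto simp: H_def add.assoc)
  have L1: "1 \<le> L" using Kpos by (simp add: L_def)
  \<comment> \<open>A window has at most two gaps, so \<open>H \<le> 2 * K\<close>. The base
    \<open>1 + 2 * K\<close> is at least 1, so the exponent 2 serves both values of
    \<open>r\<close>.\<close>
  have HL: "H ^ r \<le> L"
  proof -
    have "H ^ r \<le> (1 + 2 * K) ^ r" using Hpos HK by (intro power_mono) auto
    also have "\<dots> \<le> (1 + 2 * K) ^ 2" using r Kpos by (intro power_increasing) auto
    finally show ?thesis by (simp add: L_def)
  qed
  let ?I = "node_interval lam"
  obtain B where B: "B \<ge> 0" "\<And>u v. u \<in> window r n \<Longrightarrow> v \<in> window r n \<Longrightarrow>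
        cmod (nth_deriv_on ?I (r - 1) F v - nth_deriv_on ?I (r - 1) F u) \<le> B"
    "ennreal (H * (B / H) powr p) \<le> Q"
    using sobolev_regular_oscillation[OF reg _ _ _ _ \<open>1 \<le> p\<close>, of "lam n" "lam (n + int r)"] r Hpos fin(2)
    unfolding Q window_def H_def by auto
  obtain \<kappa> where \<kappa>: "Q = ennreal \<kappa>" "\<kappa> \<ge> 0" using fin by (cases Q) auto
  obtain \<pi>' where \<pi>': "P = ennreal \<pi>'" "\<pi>' \<ge> 0" using fin by (cases P) auto
  have B\<kappa>: "H * (B / H) powr p \<le> \<kappa>" using B(3) \<kappa> by simp
  have "continuous_on (window r n) F"
    using continuous_on_subset[OF sobolev_regular_continuous_on[OF reg r] window_subset] by simp
  \<comment> \<open>On a third of the window some value is bounded by the mean over that third; the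
    factor 3 is the ratio of the lengths.\<close>
  have pt: "\<exists>x\<in>{a..b}. H * cmod (F x) powr p \<le> 3 * \<pi>'"
    if len: "b - a = H / 3" and "{a..b} \<subseteq> window r n" for a b
  proof -
    have "continuous_on {a..b} F"
      using \<open>continuous_on (window r n) F\<close> that(2) continuous_on_subset by blast
    then obtain x where x: "x \<in> {a..b}" "ennreal ((b - a) * cmod (F x) powr p) \<le>
        (\<integral>\<^sup>+x\<in>{a..b}. ennreal (cmod (F x) powr p) \<partial>lebesgue)"
    proof (rule exists_powr_le_mean)
      show "a < b" using len Hpos by linarith
    qed (use \<open>1 \<le> p\<close> in auto)
    note x(2)
    also have "(\<integral>\<^sup>+x\<in>{a..b}. ennreal (cmod (F x) powr p) \<partial>lebesgue) \<le> P"
      unfolding P using that(2) by (intro nn_integral_mono mult_left_mono) (auto simp: indicator_def)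
    finally have "H / 3 * cmod (F x) powr p \<le> \<pi>'" using \<pi>' that(1) by simp
    then show ?thesis using x(1) by (intro bexI[of _ x]) auto
  qed
  have e: "lam (n + int r) = lam n + H" by (simp add: H_def)
  have "{lam n..lam n + H / 3} \<subseteq> window r n" "{lam n + 2 * H / 3..lam n + H} \<subseteq> window r n"
    unfolding window_def e using Hpos by auto
  then obtain x y where x: "x \<in> {lam n..lam n + H / 3}" "H * cmod (F x) powr p \<le> 3 * \<pi>'"
    and y: "y \<in> {lam n + 2 * H / 3..lam (n + int r)}" "H * cmod (F y) powr p \<le> 3 * \<pi>'"
    using pt[of "lam n + H / 3" "lam n"] pt[of "lam n + H" "lam n + 2 * H / 3"]
    unfolding e by auto
  define T where "T = (\<Sum>i<3::nat. if i = 0 then H ^ (r - 1) * B else if i = 1 then cmod (F x) else cmod (F y))"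
  have Teq: "T = H ^ (r - 1) * B + cmod (F x) + cmod (F y)"
    by (simp add: T_def numeral_3_eq_3)
  have Tp: "T powr p \<le> 3 powr p * ((H ^ (r - 1) * B) powr p + cmod (F x) powr p + cmod (F y) powr p)"
    using sum_powr_le[of "{..<3::nat}" "\<lambda>i. if i = 0 then H ^ (r - 1) * B else if i = 1 then cmod (F x) else cmod (F y)" p]
      Hpos B(1) \<open>1 \<le> p\<close> by (simp add: T_def numeral_3_eq_3)
  \<comment> \<open>\<open>H ^ (r - 1) * B\<close> is \<open>H ^ r\<close> times the mean
    \<open>B / H\<close>, to which the Jensen bound applies.\<close>
  have HBp: "H * (H ^ (r - 1) * B) powr p \<le> L powr p * \<kappa>"
  proof -
    have HrB: "H ^ (r - 1) * B = H ^ r * (B / H)"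
      using r Hpos by (auto simp: power2_eq_square)
    have "H * (H ^ (r - 1) * B) powr p = (H ^ r) powr p * (H * (B / H) powr p)"
      unfolding HrB using Hpos B(1) by (subst powr_mult) auto
    also have "\<dots> \<le> L powr p * \<kappa>"
      using Hpos HL B\<kappa> \<open>1 \<le> p\<close> B(1) by (intro mult_mono powr_mono2) auto
    finally show ?thesis .
  qed
  \<comment> \<open>The weight splits into the length \<open>H\<close> and the \<open>p\<close>-th
    power of \<open>H ^ j\<close>, the factor that scales a difference of order \<open>j\<close>
    like a value of \<open>F\<close>.\<close>
  have "H powr (real j * p + 1) * cmod (node_dd lam F n j) powr p =
      H * (H ^ j * cmod (node_dd lam F n j)) powr p"
  proof -
    have "H powr (real j * p + 1) = (H ^ j) powr p * H"
      using Hpos by (simp add: powr_add powr_realpow[symmetric] powr_powr)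
    then show ?thesis using Hpos by (simp add: powr_mult)
  qed
  also have "\<dots> \<le> H * (4 * T) powr p"
    using lower_order_bound_pointwise[OF reg r \<open>j < r\<close> B(1,2) H_def x(1) y(1)] Hpos \<open>1 \<le> p\<close>
    unfolding Teq by (intro mult_left_mono powr_mono2) auto
  also have "\<dots> = 4 powr p * (H * T powr p)"
  proof -
    have "T \<ge> 0" using Hpos B(1) by (simp add: Teq)
    then show ?thesis by (subst powr_mult) auto
  qed
  also have "\<dots> \<le> 4 powr p * (H * (3 powr p * ((H ^ (r - 1) * B) powr p + cmod (F x) powr p + cmod (F y) powr p)))"
    using Tp Hpos by (intro mult_left_mono) auto
  also have "\<dots> = 12 powr p * (H * (H ^ (r - 1) * B) powr p + H * cmod (F x) powr p + H * cmod (F y) powr p)"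
    using powr_mult[of 4 3 p] by (simp add: algebra_simps)
  also have "\<dots> \<le> 12 powr p * (L powr p * \<kappa> + 3 * \<pi>' + 3 * \<pi>')"
    using HBp x(2) y(2) by (intro mult_left_mono add_mono) auto
  also have "\<dots> \<le> 12 powr p * (6 powr p * L powr p * (\<pi>' + \<kappa>))"
  proof (intro mult_left_mono)
    have 1: "6 \<le> 6 powr p" using \<open>1 \<le> p\<close> powr_mono[of 1 p 6] by simp
    have 2: "1 \<le> L powr p" using L1 \<open>1 \<le> p\<close> by (simp add: ge_one_powr_ge_zero)
    have "6 * \<pi>' \<le> 6 powr p * L powr p * \<pi>'"
      using mult_mono[OF 1 2] \<pi>' by (intro mult_right_mono) auto
    moreover have "L powr p * \<kappa> \<le> 6 powr p * L powr p * \<kappa>"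
      using 1 \<kappa> mult_right_mono[of 1 "6 powr p" "L powr p"] by (intro mult_right_mono) auto
    ultimately show "L powr p * \<kappa> + 3 * \<pi>' + 3 * \<pi>' \<le> 6 powr p * L powr p * (\<pi>' + \<kappa>)"
      by (simp add: algebra_simps)
  qed simp
  also have "\<dots> = (72 * L) powr p * (\<pi>' + \<kappa>)"
    using L1 powr_mult[of 12 6 p] by (simp add: powr_mult)
  finally have "ennreal (H powr (real j * p + 1) * cmod (node_dd lam F n j) powr p) \<le>
      ennreal ((72 * L) powr p * (\<pi>' + \<kappa>))" by (rule ennreal_leI)
  also have "\<dots> = ennreal ((72 * L) powr p) * (P + Q)"
    using \<kappa> \<pi>' by (simp add: ennreal_mult)
  finally show ?thesis by (simp add: H_def L_def)
qed

end

subsection \<open>Regularity and size of the interpolators\<close>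

lemma lipschitz_on_imp_absolutely_continuous:
  assumes L: "L-lipschitz_on {a..b} G"
  shows "absolutely_continuous_fun_on a b G"
  unfolding absolutely_continuous_fun_on_def
proof (intro allI impI)
  fix \<epsilon> :: real assume \<epsilon>: "\<epsilon> > 0"
  have L0: "L \<ge> 0" using L by (rule lipschitz_on_nonneg)
  show "\<exists>\<delta>>0. \<forall>d T. d division_of T \<and> T \<subseteq> {a..b} \<and> (\<Sum>k\<in>d. Sup k - Inf k) < \<delta> \<longrightarrow>
      (\<Sum>k\<in>d. cmod (G (Sup k) - G (Inf k))) < \<epsilon>"
  proof (intro exI conjI allI impI)
    \<comment> \<open>The denominator is \<open>L + 1\<close> because the Lipschitz constant may be
      0.\<close>
    show "\<epsilon> / (L + 1) > 0" using \<epsilon> L0 by simp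
    fix d T assume d: "d division_of T \<and> T \<subseteq> {a..b} \<and> (\<Sum>k\<in>d. Sup k - Inf k) < \<epsilon> / (L + 1)"
    have "cmod (G (Sup k) - G (Inf k)) \<le> (L + 1) * (Sup k - Inf k)" if "k \<in> d" for k
    proof -
      obtain u v where k: "k = cbox u v" "k \<noteq> {}" "k \<subseteq> T"
        using d \<open>k \<in> d\<close> division_ofD(2,3,4)[of d T] by metis
      then have "{u..v} \<subseteq> {a..b}" using d by (metis box_real(2) subset_trans)
      then have uv: "u \<le> v" "u \<in> {a..b}" "v \<in> {a..b}" using k by auto
      have "cmod (G v - G u) \<le> L * (v - u)"
        using lipschitz_onD[OF L uv(3,2)] uv(1) by (simp add: dist_norm)
      also have "\<dots> \<le> (L + 1) * (v - u)" using uv by (intro mult_right_mono) auto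
      finally show ?thesis using k uv by simp
    qed
    then have "(\<Sum>k\<in>d. cmod (G (Sup k) - G (Inf k))) \<le> (\<Sum>k\<in>d. (L + 1) * (Sup k - Inf k))"
      by (rule sum_mono)
    also have "\<dots> = (L + 1) * (\<Sum>k\<in>d. Sup k - Inf k)" by (simp add: sum_distrib_left)
    also have "\<dots> < (L + 1) * (\<epsilon> / (L + 1))"
      using d L0 by (intro mult_strict_left_mono) auto
    finally show "(\<Sum>k\<in>d. cmod (G (Sup k) - G (Inf k))) < \<epsilon>" using L0 by simp
  qed
qed

lemma lipschitz_on_Icc_union:
  fixes G :: "real \<Rightarrow> 'a::metric_space"
  assumes "L-lipschitz_on {a..b} G" "M-lipschitz_on {b..c} G"
  shows "(max L M)-lipschitz_on {a..c} G"
  using lipschitz_on_concat_max[OF assms] by simp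

lemma piecewise_lipschitz:
  fixes G :: "real \<Rightarrow> 'a::metric_space" and s :: "int \<Rightarrow> real"
  assumes "\<And>n. \<exists>L. L-lipschitz_on {s n..s (n + 1)} G"
  shows "\<exists>L. L-lipschitz_on {s m..s (m + int k)} G"
proof (induction k)
  case 0
  have "0-lipschitz_on {s m} G" by (rule lipschitz_on_singleton) simp
  then show ?case by auto
next
  case (Suc k)
  obtain M where "M-lipschitz_on {s (m + int k)..s (m + int k + 1)} G" using assms by blast
  then show ?case using Suc lipschitz_on_Icc_union by (metis add.assoc of_nat_Suc add.commute)
qed

text \<open>A compact interval inside \<open>I\<close> lies between two knots and so meets finitely
  many pieces; the largest of their Lipschitz constants works on it. No constant common to all
  pieces is asked for.\<close>

lemma piecewise_lipschitz_imp_locally_absolutely_continuous: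
  fixes s :: "int \<Rightarrow> real"
  assumes "strict_mono s" and lip: "\<And>n. \<exists>L. L-lipschitz_on {s n..s (n + 1)} G"
    and cover: "\<And>x. x \<in> I \<Longrightarrow> \<exists>m n. s m \<le> x \<and> x \<le> s n"
  shows "locally_absolutely_continuous_on I G"
  unfolding locally_absolutely_continuous_on_def
proof (intro allI impI)
  fix a b :: real assume ab: "a \<le> b \<and> {a..b} \<subseteq> I"
  then have "a \<in> I" "b \<in> I" by auto
  then obtain m n where mn: "s m \<le> a" "b \<le> s n" using cover by meson
  then have "s m \<le> s n" using ab by linarith
  then have "m \<le> n" using assms(1) by (simp add: strict_mono_less_eq)
  then have n: "n = m + int (nat (n - m))" by simp
  obtain L where "L-lipschitz_on {s m..s n} G"
    using piecewise_lipschitz[of s G m "nat (n - m)"] lip n by auto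
  moreover have "{a..b} \<subseteq> {s m..s n}" using mn by auto
  ultimately have "L-lipschitz_on {a..b} G" by (rule lipschitz_on_subset)
  then show "absolutely_continuous_fun_on a b G"
    by (rule lipschitz_on_imp_absolutely_continuous)
qed

text \<open>\<open>g\<close> is the formula valid on one piece and \<open>G\<close> the glued
  function. Differentiability at the ends is asked of the formula only; \<open>G\<close> may have a
  corner there.\<close>

lemma C1_imp_lipschitz_on_Icc:
  fixes g :: "real \<Rightarrow> 'a::real_normed_vector"
  assumes der: "\<And>x. x \<in> {a..b} \<Longrightarrow> (g has_vector_derivative g' x) (at x)"
    and cont: "continuous_on {a..b} g'"
    and eq: "\<And>x. x \<in> {a..b} \<Longrightarrow> G x = g x"
  shows "\<exists>L. L-lipschitz_on {a..b} G"
proof -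
  have "compact (g' ` {a..b})" using cont by (intro compact_continuous_image) auto
  then obtain B where B: "B > 0" "\<And>x. x \<in> {a..b} \<Longrightarrow> norm (g' x) \<le> B"
    using compact_imp_bounded bounded_pos by (metis image_eqI)
  have "norm (g y - g x) \<le> B * norm (y - x)" if "x \<in> {a..b}" "y \<in> {a..b}" for x y
  proof (rule differentiable_bound[of "{a..b}" g "\<lambda>x h. h *\<^sub>R g' x"])
    show "(g has_derivative (\<lambda>h. h *\<^sub>R g' x)) (at x within {a..b})" if "x \<in> {a..b}" for x
      using der[OF that] unfolding has_vector_derivative_def by (rule has_derivative_at_withinI)
    show "onorm (\<lambda>h. h *\<^sub>R g' x) \<le> B" if "x \<in> {a..b}" for x
    proof (rule onorm_le)
      fix h :: real
      have "\<bar>h\<bar> * norm (g' x) \<le> \<bar>h\<bar> * B" using B(2)[OF that] by (intro mult_left_mono) auto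
      then show "norm (h *\<^sub>R g' x) \<le> B * norm h" by (simp add: mult.commute)
    qed
  qed (use that in auto)
  then have "B-lipschitz_on {a..b} G"
    using B(1) eq by (intro lipschitz_onI) (auto simp: dist_norm)
  then show ?thesis by blast
qed

text \<open>The two one-sided derivatives agree, and the two one-sided neighbourhoods together form
  a full neighbourhood of \<open>x\<close>.\<close>

lemma has_vector_derivative_glue:
  fixes f :: "real \<Rightarrow> 'a::real_normed_vector"
  assumes ab: "a < x" "x < b"
    and eq: "\<And>y. a \<le> y \<Longrightarrow> y \<le> x \<Longrightarrow> f y = f1 y" "\<And>y. x \<le> y \<Longrightarrow> y \<le> b \<Longrightarrow> f y = f2 y"
    and der: "(f1 has_vector_derivative D) (at x)" "(f2 has_vector_derivative D) (at x)"
  shows "(f has_vector_derivative D) (at x)"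
proof -
  have 1: "(f has_vector_derivative D) (at x within {a..x})"
    by (rule has_vector_derivative_transform[of _ _ _ f1])
      (use ab eq der in \<open>auto intro: has_vector_derivative_at_within\<close>)
  have 2: "(f has_vector_derivative D) (at x within {x..b})"
    by (rule has_vector_derivative_transform[of _ _ _ f2])
      (use ab eq der in \<open>auto intro: has_vector_derivative_at_within\<close>)
  have "{a..x} \<union> {x..b} = {a..b}" using ab by auto
  moreover have "(f has_vector_derivative D) (at x within {a..x} \<union> {x..b})"
    using 1 2 unfolding has_vector_derivative_def has_derivative_within by (auto intro: Lim_Un)
  ultimately have "(f has_vector_derivative D) (at x within {a..b})" by simp
  then show ?thesis using ab by (simp add: at_within_Icc_at)
qed

lemma AE_lebesgue_not_in_countable:
  fixes A :: "real set"
  assumes "countable A"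
  shows "AE x in lebesgue. x \<notin> A"
  using assms by (intro AE_completion AE_not_in countable_imp_null_set_lborel)

lemma affine_has_vector_derivative:
  "((\<lambda>x. c + complex_of_real (x - a) * d) has_vector_derivative d) (at x)"
proof -
  have l: "((\<lambda>x. x - a) has_real_derivative 1) (at x)"
    by (auto intro!: derivative_eq_intros)
  have "((\<lambda>x. c + complex_of_real (x - a) * d) has_vector_derivative 0 + complex_of_real 1 * d) (at x)"
    by (intro has_vector_derivative_add has_vector_derivative_const
        has_vector_derivative_mult_left has_vector_derivative_of_real l)
  then show ?thesis by simp
qed

section \<open>The cubic spline interpolant: derivatives and bounds\<close>

lemma node_dd_1_divdiff: "node_dd lam f n (Suc 0) = divdiff f [lam n, lam (n + 1)]"
  by (simp add: node_dd_Suc node_dd_0)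

lemma node_dd_2_divdiff: "node_dd lam f (n - 1) 2 = divdiff f [lam (n - 1), lam n, lam (n + 1)]"
  unfolding numeral_2_eq_2 by (simp add: node_dd_Suc node_dd_0 add.commute)

definition "qcubic' x = 4 * (2 * x - 3 * x\<^sup>2)" for x :: real
definition "qcubic'' x = 4 * (2 - 6 * x)" for x :: real

lemma qcubic_derivs:
  "(qcubic has_real_derivative qcubic' x) (at x)"
  "(qcubic' has_real_derivative qcubic'' x) (at x)"
  unfolding qcubic_def qcubic'_def qcubic''_def
  by (auto intro!: derivative_eq_intros simp: algebra_simps power2_eq_square)

text \<open>Each cubic formula is used only up to the middle of a gap, hence the range of
  \<open>t\<close>. On it \<open>qcubic''\<close> decreases from 8 to -4.\<close>

lemma qcubic_bounds:
  assumes "0 \<le> t" "t \<le> 1 / 2"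
  shows "\<bar>qcubic t\<bar> \<le> 1" "\<bar>qcubic'' t\<bar> \<le> 8"
proof -
  have "t\<^sup>2 \<le> (1 / 2)\<^sup>2" using assms by (intro power_mono) auto
  then have *: "4 * t\<^sup>2 \<le> 1" by (simp add: power2_eq_square)
  have "qcubic t = (4 * t\<^sup>2) * (1 - t)"
    by (simp add: qcubic_def power2_eq_square power3_eq_cube algebra_simps)
  then show "\<bar>qcubic t\<bar> \<le> 1"
    using mult_mono[OF *, of "1 - t" 1] assms by (auto simp: abs_mult)
  show "\<bar>qcubic'' t\<bar> \<le> 8" using assms by (auto simp: qcubic''_def)
qed

lemma continuous_on_qcubic'': "continuous_on A (\<lambda>x. complex_of_real (qcubic'' (g x)) * c)"
  if "continuous_on A g" for g :: "real \<Rightarrow> real"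
  unfolding qcubic''_def using that by (auto intro!: continuous_intros)

context node_sequence
begin

definition "slope f n = divdiff f [lam n, lam (n + 1)]"
text \<open>Centred at \<open>lam n\<close>, this is the second-order difference of the window that
  starts at \<open>n - 1\<close>, the source of the later index shifts.\<close>

definition "curv f n = divdiff f [lam (n - 1), lam n, lam (n + 1)]"

text \<open>The minus sign comes from the chain rule for the argument
  \<open>(lam n - x) / gap lam (n - 1)\<close>, which also cancels one factor of the squared
  gap.\<close>

definition "Phi2_left' f n x = alpha lam f n -
  complex_of_real (gap lam (n - 1) * qcubic' ((lam n - x) / gap lam (n - 1))) * curv f n"
definition "Phi2_right' f n x = alpha lam f n +
  complex_of_real (gap lam n * qcubic' ((x - lam n) / gap lam n)) * curv f n"

text \<open>\<open>alpha\<close> is the slope at \<open>lam n\<close> of the parabola through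
  \<open>lam (n - 1)\<close>, \<open>lam n\<close> and \<open>lam (n + 1)\<close>; the two forms
  come from its Newton expansions based on the left and on the right gap.\<close>

lemma alpha_eq:
  shows "alpha lam f n = slope f (n - 1) + complex_of_real (gap lam (n - 1)) * curv f n" (is ?A)
    and "alpha lam f n = slope f n - complex_of_real (gap lam n) * curv f n" (is ?B)
proof -
  define a b where "a = complex_of_real (gap lam (n - 1))" and "b = complex_of_real (gap lam n)"
  have "a + b = complex_of_real (gap lam (n - 1) + gap lam n)" by (simp add: a_def b_def)
  moreover have "gap lam (n - 1) + gap lam n \<noteq> 0"
    using gap_pos[of "n - 1"] gap_pos[of n] by linarith
  ultimately have ab: "a + b \<noteq> 0" by (metis of_real_eq_0_iff)
  have c: "curv f n = (slope f n - slope f (n - 1)) / (a + b)"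
    by (simp add: curv_def slope_def a_def b_def gap_def)
  have al: "alpha lam f n = (b * slope f (n - 1) + a * slope f n) / (a + b)"
    by (simp add: alpha_def slope_def a_def b_def)
  show ?A ?B unfolding al c a_def[symmetric] b_def[symmetric]
    using ab by (simp_all add: field_simps)
qed

lemma Phi2_right_derivs:
  shows "(Phi2_right lam f n has_vector_derivative Phi2_right' f n x) (at x)"
    and "(Phi2_right' f n has_vector_derivative
      complex_of_real (qcubic'' ((x - lam n) / gap lam n)) * curv f n) (at x)"
proof -
  define h where "h = gap lam n"
  have h: "h > 0" by (simp add: h_def)
  have t: "((\<lambda>x. (x - lam n) / h) has_real_derivative 1 / h) (at x)"
    using h by (auto intro!: derivative_eq_intros)
  \<comment> \<open>With all real factors grouped into one real function, the chain rule is a purely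
    real statement and the complex coefficients enter as constants.\<close>
  have q: "((\<lambda>x. h\<^sup>2 * qcubic ((x - lam n) / h)) has_real_derivative h * qcubic' ((x - lam n) / h)) (at x)"
    using DERIV_cmult[OF DERIV_chain2[OF qcubic_derivs(1) t], of "h\<^sup>2"] h
    by (simp add: power2_eq_square)
  have q': "((\<lambda>x. h * qcubic' ((x - lam n) / h)) has_real_derivative qcubic'' ((x - lam n) / h)) (at x)"
    using DERIV_cmult[OF DERIV_chain2[OF qcubic_derivs(2) t], of h] h
    by simp
  have l: "((\<lambda>x. x - lam n) has_real_derivative 1) (at x)"
    by (auto intro!: derivative_eq_intros)
  note d = has_vector_derivative_of_real
  have "((\<lambda>x. f (lam n) + alpha lam f n * complex_of_real (x - lam n) +
      complex_of_real (h\<^sup>2 * qcubic ((x - lam n) / h)) * curv f n) has_vector_derivative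
      0 + alpha lam f n * complex_of_real 1 + complex_of_real (h * qcubic' ((x - lam n) / h)) * curv f n) (at x)"
    by (intro has_vector_derivative_add has_vector_derivative_const has_vector_derivative_mult_right
        has_vector_derivative_mult_left d q l)
  moreover have "(\<lambda>x. f (lam n) + alpha lam f n * complex_of_real (x - lam n) +
      complex_of_real (h\<^sup>2 * qcubic ((x - lam n) / h)) * curv f n) = Phi2_right lam f n"
    by (auto simp: Phi2_right_def curv_def h_def fun_eq_iff)
  ultimately show "(Phi2_right lam f n has_vector_derivative Phi2_right' f n x) (at x)"
    by (simp add: Phi2_right'_def h_def)
  have "((\<lambda>x. alpha lam f n + complex_of_real (h * qcubic' ((x - lam n) / h)) * curv f n) has_vector_derivative
      0 + complex_of_real (qcubic'' ((x - lam n) / h)) * curv f n) (at x)"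
    by (intro has_vector_derivative_add has_vector_derivative_const
        has_vector_derivative_mult_left d q')
  then show "(Phi2_right' f n has_vector_derivative
      complex_of_real (qcubic'' ((x - lam n) / gap lam n)) * curv f n) (at x)"
    unfolding h_def by (simp add: Phi2_right'_def[abs_def])
qed

lemma Phi2_left_derivs:
  shows "(Phi2_left lam f n has_vector_derivative Phi2_left' f n x) (at x)"
    and "(Phi2_left' f n has_vector_derivative
      complex_of_real (qcubic'' ((lam n - x) / gap lam (n - 1))) * curv f n) (at x)"
proof -
  define h where "h = gap lam (n - 1)"
  have h: "h > 0" by (simp add: h_def)
  have t: "((\<lambda>x. (lam n - x) / h) has_real_derivative - (1 / h)) (at x)"
    using h by (auto intro!: derivative_eq_intros)
  have q: "((\<lambda>x. h\<^sup>2 * qcubic ((lam n - x) / h)) has_real_derivative - (h * qcubic' ((lam n - x) / h))) (at x)"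
    using DERIV_cmult[OF DERIV_chain2[OF qcubic_derivs(1) t], of "h\<^sup>2"] h
    by (simp add: power2_eq_square)
  have q': "((\<lambda>x. - (h * qcubic' ((lam n - x) / h))) has_real_derivative qcubic'' ((lam n - x) / h)) (at x)"
    using DERIV_cmult[OF DERIV_chain2[OF qcubic_derivs(2) t], of "- h"] h
    by simp
  have l: "((\<lambda>x. x - lam n) has_real_derivative 1) (at x)"
    by (auto intro!: derivative_eq_intros)
  note d = has_vector_derivative_of_real
  have "((\<lambda>x. f (lam n) + alpha lam f n * complex_of_real (x - lam n) +
      complex_of_real (h\<^sup>2 * qcubic ((lam n - x) / h)) * curv f n) has_vector_derivative
      0 + alpha lam f n * complex_of_real 1 + complex_of_real (- (h * qcubic' ((lam n - x) / h))) * curv f n) (at x)"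
    by (intro has_vector_derivative_add has_vector_derivative_const has_vector_derivative_mult_right
        has_vector_derivative_mult_left d q l)
  moreover have "(\<lambda>x. f (lam n) + alpha lam f n * complex_of_real (x - lam n) +
      complex_of_real (h\<^sup>2 * qcubic ((lam n - x) / h)) * curv f n) = Phi2_left lam f n"
    by (auto simp: Phi2_left_def curv_def h_def fun_eq_iff)
  ultimately show "(Phi2_left lam f n has_vector_derivative Phi2_left' f n x) (at x)"
    by (simp add: Phi2_left'_def h_def)
  have "((\<lambda>x. alpha lam f n + complex_of_real (- (h * qcubic' ((lam n - x) / h))) * curv f n) has_vector_derivative
      0 + complex_of_real (qcubic'' ((lam n - x) / h)) * curv f n) (at x)"
    by (intro has_vector_derivative_add has_vector_derivative_const
        has_vector_derivative_mult_left d q')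
  then show "(Phi2_left' f n has_vector_derivative
      complex_of_real (qcubic'' ((lam n - x) / gap lam (n - 1))) * curv f n) (at x)"
    unfolding h_def by (simp add: Phi2_left'_def[abs_def])
qed

text \<open>\<open>qcubic'\<close> is 0 at 0 and 1 at 1/2. So both formulas have slope
  \<open>alpha\<close> at a node and, by the two forms of \<open>alpha_eq\<close>, the slope of the
  chord at the middle of a gap.\<close>

lemma Phi2_derivs_agree:
  shows "Phi2_right' f n (lam n) = Phi2_left' f n (lam n)"
    and "Phi2_right' f n (mid lam n) = Phi2_left' f (n + 1) (mid lam n)"
proof -
  show "Phi2_right' f n (lam n) = Phi2_left' f n (lam n)"
    by (simp add: Phi2_right'_def Phi2_left'_def qcubic'_def)
  have half: "(mid lam n - lam n) / gap lam n = 1 / 2" "(lam (n + 1) - mid lam n) / gap lam n = 1 / 2"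
    using gap_pos[of n] by (simp_all add: mid_def gap_def field_simps del: gap_pos lam_less_iff)
  have q: "qcubic' (1 / 2) = 1" by (simp add: qcubic'_def power2_eq_square)
  have "Phi2_right' f n (mid lam n) = slope f n"
    unfolding Phi2_right'_def half q using alpha_eq(2)[of f n] by simp
  moreover have "Phi2_left' f (n + 1) (mid lam n) = slope f n"
    unfolding Phi2_left'_def using alpha_eq(1)[of f "n + 1"] by (simp add: half q)
  ultimately show "Phi2_right' f n (mid lam n) = Phi2_left' f (n + 1) (mid lam n)" by simp
qed

lemma mid_between [simp]: "lam n < mid lam n" "mid lam n < lam (n + 1)"
  using mid_bounds[OF strict_mono_lam] by auto

text \<open>The ends of the piece are included: there the neighbouring formula has the same value
  and the same slope, so the two-sided derivative of the spline exists.\<close>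

lemma Phi2_has_vector_derivative_right:
  assumes x: "lam n \<le> x" "x \<le> mid lam n"
  shows "(Phi2 lam f has_vector_derivative Phi2_right' f n x) (at x)"
proof -
  note R = Phi2_eq_right[OF strict_mono_lam, of n] and L = Phi2_eq_left[OF strict_mono_lam]
  consider "x = lam n" | "x = mid lam n" | "lam n < x" "x < mid lam n" using x by linarith
  then show ?thesis
  proof cases
    case 1
    show ?thesis
    proof (rule has_vector_derivative_glue[of "mid lam (n - 1)" x "mid lam n" _ "Phi2_left lam f n" "Phi2_right lam f n"])
      show "(Phi2_left lam f n has_vector_derivative Phi2_right' f n x) (at x)"
        using Phi2_left_derivs(1)[of f n x] 1 Phi2_derivs_agree(1) by simp
    qed (use 1 R L[of n] Phi2_right_derivs(1) mid_between(2)[of "n - 1"] in auto)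
  next
    case 2
    show ?thesis
    proof (rule has_vector_derivative_glue[of "lam n" x "lam (n + 1)" _ "Phi2_right lam f n" "Phi2_left lam f (n + 1)"])
      show "(Phi2_left lam f (n + 1) has_vector_derivative Phi2_right' f n x) (at x)"
        using Phi2_left_derivs(1)[of f "n + 1" x] 2 Phi2_derivs_agree(2) by simp
    qed (use 2 R L[of "n + 1"] Phi2_right_derivs(1) in auto)
  next
    case 3
    show ?thesis
      by (rule has_vector_derivative_glue[of "lam n" x "mid lam n" _ "Phi2_right lam f n" "Phi2_right lam f n"])
        (use 3 R Phi2_right_derivs(1) in auto)
  qed
qed

lemma Phi2_has_vector_derivative_left:
  assumes x: "mid lam (n - 1) \<le> x" "x \<le> lam n"
  shows "(Phi2 lam f has_vector_derivative Phi2_left' f n x) (at x)"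
proof -
  note L = Phi2_eq_left[OF strict_mono_lam, of n]
  consider "x = lam n" | "x = mid lam (n - 1)" | "mid lam (n - 1) < x" "x < lam n" using x by linarith
  then show ?thesis
  proof cases
    case 1
    then show ?thesis
      using Phi2_has_vector_derivative_right[of n x f] Phi2_derivs_agree(1)[of f n] less_imp_le[OF mid_between(1)[of n]]
      by simp
  next
    case 2
    \<comment> \<open>The left end of this piece is the right end of the right-hand piece of node
      \<open>n - 1\<close>.\<close>
    then show ?thesis
      using Phi2_has_vector_derivative_right[of "n - 1" x f] Phi2_derivs_agree(2)[of f "n - 1"]
        less_imp_le[OF mid_between(1)[of "n - 1"]] by simp
  next
    case 3
    show ?thesis
      by (rule has_vector_derivative_glue[of "mid lam (n - 1)" x "lam n" _ "Phi2_left lam f n" "Phi2_left lam f n"])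
        (use 3 L Phi2_left_derivs(1) in auto)
  qed
qed

lemma node_interval_half_piece:
  assumes "x \<in> node_interval lam"
  obtains (left) n where "mid lam (n - 1) < x" "x < lam n"
  | (right) n where "lam n < x" "x < mid lam n"
  | (knot) "x \<in> range lam \<union> range (mid lam)"
proof -
  obtain n where n: "lam n \<le> x" "x < lam (n + 1)" using assms by (rule node_interval_piece)
  consider "x \<in> range lam \<union> range (mid lam)" | "lam n < x" "x < mid lam n" | "mid lam n < x" "x < lam (n + 1)"
    using n by (metis UnCI not_less_iff_gr_or_eq order_le_less rangeI)
  then show thesis using left[of "n + 1"] right[of n] knot by cases auto
qed

lemma half_piece_subset: "{mid lam (n - 1)..mid lam n} \<subseteq> {lam (n - 1)..lam (n + 1)}"
  using mid_between[of n] mid_between[of "n - 1"] by (auto simp del: mid_between)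

lemma nth_deriv_Phi2:
  shows "lam n \<le> x \<Longrightarrow> x \<le> mid lam n \<Longrightarrow> nth_deriv_on (node_interval lam) 1 (Phi2 lam f) x = Phi2_right' f n x"
    and "mid lam (n - 1) \<le> x \<Longrightarrow> x \<le> lam n \<Longrightarrow> nth_deriv_on (node_interval lam) 1 (Phi2 lam f) x = Phi2_left' f n x"
proof -
  have *: "x \<in> node_interval lam" if "mid lam (n - 1) \<le> x" "x \<le> mid lam n"
    using that half_piece_subset Icc_subset_node_interval by (meson atLeastAtMost_iff in_mono)
  have D: "nth_deriv_on (node_interval lam) 1 (Phi2 lam f) x = d"
    if "x \<in> node_interval lam" "(Phi2 lam f has_vector_derivative d) (at x)" for d
    using that at_within_open[OF that(1) open_node_interval]
    by (simp add: nth_deriv_on_Suc vector_derivative_at)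
  show "nth_deriv_on (node_interval lam) 1 (Phi2 lam f) x = Phi2_right' f n x" if "lam n \<le> x" "x \<le> mid lam n"
    using that order_trans[OF less_imp_le[OF mid_between(2)[of "n - 1"]]] by (intro D * Phi2_has_vector_derivative_right) auto
  show "nth_deriv_on (node_interval lam) 1 (Phi2 lam f) x = Phi2_left' f n x" if "mid lam (n - 1) \<le> x" "x \<le> lam n"
    using that order_trans[OF _ less_imp_le[OF mid_between(1)]] by (intro D * Phi2_has_vector_derivative_left) auto
qed

lemma Phi2_second_derivative:
  shows "lam n < x \<Longrightarrow> x < mid lam n \<Longrightarrow>
      (nth_deriv_on (node_interval lam) 1 (Phi2 lam f) has_vector_derivative
        complex_of_real (qcubic'' ((x - lam n) / gap lam n)) * curv f n) (at x)"
    and "mid lam (n - 1) < x \<Longrightarrow> x < lam n \<Longrightarrow>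
      (nth_deriv_on (node_interval lam) 1 (Phi2 lam f) has_vector_derivative
        complex_of_real (qcubic'' ((lam n - x) / gap lam (n - 1))) * curv f n) (at x)"
proof -
  show "(nth_deriv_on (node_interval lam) 1 (Phi2 lam f) has_vector_derivative
        complex_of_real (qcubic'' ((x - lam n) / gap lam n)) * curv f n) (at x)"
    if "lam n < x" "x < mid lam n"
    by (rule has_vector_derivative_transform_within_open[OF Phi2_right_derivs(2), of "{lam n<..<mid lam n}"])
      (use that nth_deriv_Phi2(1)[of n _ f] in auto)
  show "(nth_deriv_on (node_interval lam) 1 (Phi2 lam f) has_vector_derivative
        complex_of_real (qcubic'' ((lam n - x) / gap lam (n - 1))) * curv f n) (at x)"
    if "mid lam (n - 1) < x" "x < lam n"
    by (rule has_vector_derivative_transform_within_open[OF Phi2_left_derivs(2), of "{mid lam (n - 1)<..<lam n}"])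
      (use that nth_deriv_Phi2(2)[of n _ f] in auto)
qed

lemma AE_not_knot: "AE x in lebesgue. x \<notin> range lam \<union> range (mid lam)"
  by (intro AE_lebesgue_not_in_countable) auto

text \<open>The first derivative is continuous and given by a quadratic on each half gap. It is
  therefore Lipschitz on pieces, and differentiable off the countable set of nodes and
  midpoints.\<close>

lemma sobolev_regular_Phi2: "sobolev_regular 2 (node_interval lam) (Phi2 lam f)"
proof -
  let ?I = "node_interval lam"
  let ?D = "nth_deriv_on ?I 1 (Phi2 lam f)"
  have "Phi2 lam f differentiable (at x within ?I)" if x: "x \<in> ?I" for x
  proof -
    obtain n where n: "lam n \<le> x" "x < lam (n + 1)" using x by (rule node_interval_piece)
    then have "\<exists>d. (Phi2 lam f has_vector_derivative d) (at x)"
      using Phi2_has_vector_derivative_right[of n x] Phi2_has_vector_derivative_left[of "n + 1" x]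
      by (cases "x \<le> mid lam n") auto
    then show ?thesis
      by (meson differentiableI_vector differentiable_at_withinI)
  qed
  then have 1: "\<forall>k. k + 1 < 2 \<longrightarrow> nth_deriv_on ?I k (Phi2 lam f) differentiable_on ?I"
    by (auto simp: less_Suc_eq numeral_2_eq_2 differentiable_on_def)
  \<comment> \<open>Between two consecutive midpoints the quadratic changes at the node
    \<open>lam (n + 1)\<close>, so the piece is split there.\<close>
  have "\<exists>L. L-lipschitz_on {mid lam n..mid lam (n + 1)} ?D" for n
  proof -
    have "\<exists>L. L-lipschitz_on {mid lam n..lam (n + 1)} ?D"
      by (rule C1_imp_lipschitz_on_Icc[OF Phi2_left_derivs(2)[of f "n + 1"]])
        (use nth_deriv_Phi2(2)[of "n + 1" _ f] in \<open>auto intro!: continuous_on_qcubic'' continuous_intros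
            simp: less_imp_neq[OF gap_pos, symmetric]\<close>)
    moreover have "\<exists>L. L-lipschitz_on {lam (n + 1)..mid lam (n + 1)} ?D"
      by (rule C1_imp_lipschitz_on_Icc[OF Phi2_right_derivs(2)[of f "n + 1"]])
        (use nth_deriv_Phi2(1)[of "n + 1" _ f] in \<open>auto intro!: continuous_on_qcubic'' continuous_intros
            simp: less_imp_neq[OF gap_pos, symmetric]\<close>)
    ultimately show ?thesis using lipschitz_on_Icc_union by blast
  qed
  then have 2: "locally_absolutely_continuous_on ?I ?D"
  proof (rule piecewise_lipschitz_imp_locally_absolutely_continuous[OF strict_mono_mid[OF strict_mono_lam]])
    fix x assume "x \<in> ?I"
    then obtain m n where "lam m < x" "x < lam n" by (auto simp: mem_node_interval_iff)
    then have "mid lam (m - 1) \<le> x \<and> x \<le> mid lam n"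
      using mid_between(2)[of "m - 1"] mid_between(1)[of n] by (simp del: mid_between)
    then show "\<exists>m n. mid lam m \<le> x \<and> x \<le> mid lam n" by blast
  qed
  have 3: "AE x\<in>?I in lebesgue. ?D differentiable (at x within ?I)"
    using AE_not_knot
  proof eventually_elim
    fix x assume nk: "x \<notin> range lam \<union> range (mid lam)"
    show "x \<in> ?I \<longrightarrow> ?D differentiable (at x within ?I)"
    proof
      assume "x \<in> ?I"
      then have "\<exists>d. (?D has_vector_derivative d) (at x)"
        by (cases rule: node_interval_half_piece) (use Phi2_second_derivative nk in blast)+
      then show "?D differentiable (at x within ?I)"
        by (meson differentiableI_vector differentiable_at_withinI)
    qed
  qed
  show ?thesis unfolding sobolev_regular_def using 1 2 3 by simp
qed

text \<open>Between the midpoints around \<open>lam n\<close> the spline reads \<open>f\<close> only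
  at \<open>lam (n - 1)\<close>, \<open>lam n\<close> and \<open>lam (n + 1)\<close>; its second
  derivative is a value of \<open>qcubic''\<close> times the second-order difference of window
  \<open>n - 1\<close>.\<close>

lemma AE_second_derivative_Phi2_le:
  "AE x in lebesgue. x \<in> node_interval lam \<longrightarrow>
    (\<exists>n. x \<in> window 2 n \<and> cmod (nth_deriv_on (node_interval lam) 2 (Phi2 lam f) x) \<le> 8 * cmod (node_dd lam f n 2))"
  using AE_not_knot
proof eventually_elim
  fix x assume nk: "x \<notin> range lam \<union> range (mid lam)"
  let ?I = "node_interval lam"
  show "x \<in> ?I \<longrightarrow> (\<exists>n. x \<in> window 2 n \<and> cmod (nth_deriv_on ?I 2 (Phi2 lam f) x) \<le> 8 * cmod (node_dd lam f n 2))"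
  proof
    assume x: "x \<in> ?I"
    have D: "nth_deriv_on ?I 2 (Phi2 lam f) x = d"
      if "(nth_deriv_on ?I 1 (Phi2 lam f) has_vector_derivative d) (at x)" for d
      using that at_within_open[OF x open_node_interval] nth_deriv_on_Suc[of ?I 1 "Phi2 lam f"]
      by (simp add: vector_derivative_at numeral_2_eq_2)
    have W: "x \<in> window 2 (n - 1)" if "mid lam (n - 1) \<le> x" "x \<le> mid lam n" for n
      using that half_piece_subset[of n] by (auto simp: window_def algebra_simps)
    have bound: "cmod (complex_of_real (qcubic'' t) * curv f n) \<le> 8 * cmod (node_dd lam f (n - 1) 2)"
      if "0 \<le> t" "t \<le> 1 / 2" for t n
      using qcubic_bounds(2)[OF that] by (simp add: norm_mult node_dd_2_divdiff curv_def mult_right_mono del: divdiff.simps)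
    show "\<exists>n. x \<in> window 2 n \<and> cmod (nth_deriv_on ?I 2 (Phi2 lam f) x) \<le> 8 * cmod (node_dd lam f n 2)"
      using x
    proof (cases rule: node_interval_half_piece)
      case (left n)
      have "0 \<le> (lam n - x) / gap lam (n - 1)" "(lam n - x) / gap lam (n - 1) \<le> 1 / 2"
        using left gap_pos[of "n - 1"] by (auto simp: pos_divide_le_eq mid_def gap_def simp del: lam_less_iff gap_pos)
      then show ?thesis
        using left W[of n] D[OF Phi2_second_derivative(2)[OF left]] bound mid_between(1)[of n]
        by (intro exI[of _ "n - 1"]) (auto simp del: mid_between)
    next
      case (right n)
      have "0 \<le> (x - lam n) / gap lam n" "(x - lam n) / gap lam n \<le> 1 / 2"
        using right gap_pos[of n] by (auto simp: pos_divide_le_eq mid_def gap_def simp del: lam_less_iff gap_pos)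
      then show ?thesis
        using right W[of n] D[OF Phi2_second_derivative(1)[OF right]] bound mid_between(2)[of "n - 1"]
        by (intro exI[of _ "n - 1"]) (auto simp del: mid_between)
    qed (use nk in blast)
  qed
qed

text \<open>The formulas are centred at the middle node of the window, the bound at its first node.
  Re-expanding \<open>f (lam n)\<close> and \<open>alpha\<close> from the first node produces every
  term of the sum at most twice, hence the factor 2.\<close>

lemma Phi2_le:
  assumes x: "x \<in> node_interval lam"
  shows "\<exists>n. x \<in> window 2 n \<and> cmod (Phi2 lam f x) \<le>
    2 * (\<Sum>j\<le>2. (lam (n + 2) - lam n) ^ j * cmod (node_dd lam f n j))"
proof -
  \<comment> \<open>\<open>y\<close>, \<open>g\<close> and \<open>t\<close> stand for the
    displacement, the gap and the scaled distance of either half piece, so the left and the right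
    formula are covered at once.\<close>
  have key: "cmod (f (lam n) + alpha lam f n * complex_of_real y + complex_of_real (g\<^sup>2) * curv f n * complex_of_real (qcubic t))
      \<le> 2 * (\<Sum>j\<le>2. (lam (n + 1) - lam (n - 1)) ^ j * cmod (node_dd lam f (n - 1) j))"
    if y: "\<bar>y\<bar> \<le> lam (n + 1) - lam (n - 1)" and g: "0 < g" "g \<le> lam (n + 1) - lam (n - 1)"
      and t: "0 \<le> t" "t \<le> 1 / 2" for n y g t
  proof -
    define H where "H = lam (n + 1) - lam (n - 1)"
    have H: "H > 0" by (simp add: H_def)
    define u d where "u = cmod (slope f (n - 1))" and "d = cmod (curv f n)"
    have ud: "u \<ge> 0" "d \<ge> 0" by (simp_all add: u_def d_def)
    have gH: "gap lam (n - 1) \<le> H" by (simp add: gap_def H_def)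
    have "f (lam n) = f (lam (n - 1)) + complex_of_real (gap lam (n - 1)) * slope f (n - 1)"
      using gap_pos[of "n - 1"] by (simp add: slope_def gap_def del: gap_pos lam_less_iff flip: of_real_diff)
    then have "cmod (f (lam n)) \<le> cmod (f (lam (n - 1))) + gap lam (n - 1) * u"
      using norm_triangle_ineq[of "f (lam (n - 1))" "complex_of_real (gap lam (n - 1)) * slope f (n - 1)"]
        gap_pos[of "n - 1"] by (simp add: norm_mult u_def)
    also have "\<dots> \<le> cmod (f (lam (n - 1))) + H * u" using gH ud by (intro add_mono mult_right_mono) auto
    finally have 1: "cmod (f (lam n)) \<le> cmod (f (lam (n - 1))) + H * u" .
    have "cmod (alpha lam f n) \<le> u + gap lam (n - 1) * d"
      unfolding alpha_eq(1) using norm_triangle_ineq[of "slope f (n - 1)" "complex_of_real (gap lam (n - 1)) * curv f n"]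
        gap_pos[of "n - 1"] by (simp add: norm_mult u_def d_def)
    also have "\<dots> \<le> u + H * d" using gH ud by (intro add_mono mult_right_mono) auto
    finally have "cmod (alpha lam f n * complex_of_real y) \<le> (u + H * d) * H"
      unfolding norm_mult norm_of_real using y ud H by (intro mult_mono) (auto simp: H_def)
    then have 2: "cmod (alpha lam f n * complex_of_real y) \<le> H * u + H\<^sup>2 * d"
      by (simp add: algebra_simps power2_eq_square)
    have "cmod (complex_of_real (g\<^sup>2) * curv f n * complex_of_real (qcubic t)) = g\<^sup>2 * d * \<bar>qcubic t\<bar>"
      by (simp add: norm_mult d_def norm_power)
    also have "\<dots> \<le> H\<^sup>2 * d * 1"
      using g ud qcubic_bounds(1)[OF t] by (intro mult_mono power_mono) (auto simp: H_def)
    finally have 3: "cmod (complex_of_real (g\<^sup>2) * curv f n * complex_of_real (qcubic t)) \<le> H\<^sup>2 * d" by simp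
    have "cmod (f (lam n) + alpha lam f n * complex_of_real y + complex_of_real (g\<^sup>2) * curv f n * complex_of_real (qcubic t))
        \<le> cmod (f (lam n)) + cmod (alpha lam f n * complex_of_real y) +
          cmod (complex_of_real (g\<^sup>2) * curv f n * complex_of_real (qcubic t))"
      by (meson add_mono norm_triangle_ineq norm_triangle_le order_refl)
    also have "\<dots> \<le> 2 * (cmod (f (lam (n - 1))) + H * u + H\<^sup>2 * d)"
      by (rule order_trans[OF add_mono[OF add_mono[OF 1 2] 3]]) (simp add: algebra_simps)
    also have "\<dots> = 2 * (\<Sum>j\<le>2. H ^ j * cmod (node_dd lam f (n - 1) j))"
    proof -
      have "node_dd lam f (n - 1) (Suc 0) = slope f (n - 1)"
        by (simp add: node_dd_1_divdiff slope_def del: divdiff.simps)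
      moreover have "node_dd lam f (n - 1) (Suc (Suc 0)) = curv f n"
        using node_dd_2_divdiff[of lam f n] by (simp add: curv_def numeral_2_eq_2 del: divdiff.simps)
      ultimately show ?thesis by (simp add: numeral_2_eq_2 node_dd_0 u_def d_def)
    qed
    finally show ?thesis by (simp add: H_def)
  qed
  obtain n where n: "lam n \<le> x" "x < lam (n + 1)" using x by (rule node_interval_piece)
  show ?thesis
  proof (cases "x \<le> mid lam n")
    case True
    have t: "0 \<le> (x - lam n) / gap lam n" "(x - lam n) / gap lam n \<le> 1 / 2"
      using n True gap_pos[of n] by (auto simp: pos_divide_le_eq mid_def gap_def simp del: lam_less_iff gap_pos)
    have b: "lam (n - 1) < lam n" "\<bar>x - lam n\<bar> \<le> lam (n + 1) - lam (n - 1)" "gap lam n \<le> lam (n + 1) - lam (n - 1)"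
      using n lam_less_iff[of "n - 1" n] by (auto simp: gap_def simp del: lam_less_iff)
    have e: "n - 1 + 2 = n + 1" by simp
    show ?thesis
    proof (intro exI[of _ "n - 1"] conjI)
      show "x \<in> window 2 (n - 1)" using n b(1) unfolding window_def by (auto simp: e simp del: lam_less_iff)
      show "cmod (Phi2 lam f x) \<le> 2 * (\<Sum>j\<le>2. (lam (n - 1 + 2) - lam (n - 1)) ^ j * cmod (node_dd lam f (n - 1) j))"
        using key[OF b(2) gap_pos b(3) t] Phi2_eq_right[OF strict_mono_lam n(1) True, of f]
        unfolding e Phi2_right_def curv_def by simp
    qed
  next
    case False
    \<comment> \<open>In the right half of the gap the formula of node \<open>n + 1\<close> applies,
      whose window starts at \<open>n\<close>.\<close>
    have t: "0 \<le> (lam (n + 1) - x) / gap lam n" "(lam (n + 1) - x) / gap lam n \<le> 1 / 2"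
      using n False gap_pos[of n] by (auto simp: pos_divide_le_eq mid_def gap_def simp del: lam_less_iff gap_pos)
    have b: "\<bar>x - lam (n + 1)\<bar> \<le> lam (n + 1 + 1) - lam (n + 1 - 1)" "gap lam n \<le> lam (n + 1 + 1) - lam (n + 1 - 1)"
      using n lam_less_iff[of "n + 1" "n + 1 + 1"] by (auto simp: gap_def simp del: lam_less_iff)
    have e: "n + 1 + 1 = n + 2" by simp
    show ?thesis
    proof (intro exI[of _ n] conjI)
      show "x \<in> window 2 n" using n lam_less_iff[of "n + 1" "n + 2"] by (auto simp: window_def simp del: lam_less_iff)
      show "cmod (Phi2 lam f x) \<le> 2 * (\<Sum>j\<le>2. (lam (n + 2) - lam n) ^ j * cmod (node_dd lam f n j))"
        using key[OF b(1) gap_pos b(2) t] Phi2_eq_left[OF strict_mono_lam, of "n + 1" x f] False n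
        unfolding e Phi2_left_def curv_def by simp
    qed
  qed
qed

section \<open>The piecewise linear interpolant\<close>

lemma Phi1_affine:
  assumes "lam n \<le> x" "x \<le> lam (n + 1)"
  shows "Phi1 lam f x = f (lam n) + complex_of_real (x - lam n) * node_dd lam f n (Suc 0)"
proof -
  define h where "h = complex_of_real (gap lam n)"
  have h: "h \<noteq> 0" using gap_pos[of n] unfolding h_def by (metis less_irrefl of_real_eq_0_iff)
  have e: "lam (n + 1) - x = gap lam n - (x - lam n)" by (simp add: gap_def)
  have "Phi1 lam f x = Phi1_piece lam f n x" using Phi1_eq[OF strict_mono_lam assms] .
  also have "\<dots> = f (lam n) * ((h - complex_of_real (x - lam n)) / h) + f (lam (n + 1)) * (complex_of_real (x - lam n) / h)"
    unfolding Phi1_piece_def e h_def by simp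
  also have "\<dots> = f (lam n) + complex_of_real (x - lam n) * ((f (lam (n + 1)) - f (lam n)) / h)"
    using h by (simp add: field_simps)
  also have "(f (lam (n + 1)) - f (lam n)) / h = node_dd lam f n (Suc 0)"
    by (simp add: node_dd_1 h_def gap_def)
  finally show ?thesis .
qed

lemma Phi1_has_vector_derivative:
  assumes "lam n < x" "x < lam (n + 1)"
  shows "(Phi1 lam f has_vector_derivative node_dd lam f n (Suc 0)) (at x)"
  by (rule has_vector_derivative_transform_within_open[OF affine_has_vector_derivative, of "{lam n<..<lam (n + 1)}"])
    (use assms Phi1_affine[of n _ f] in auto)

lemma node_interval_piece_interior:
  assumes "x \<in> node_interval lam" "x \<notin> range lam"
  obtains n where "lam n < x" "x < lam (n + 1)"
  using node_interval_piece[OF assms(1)] assms(2) by (metis order_le_less rangeI)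

lemma sobolev_regular_Phi1: "sobolev_regular 1 (node_interval lam) (Phi1 lam f)"
proof -
  let ?I = "node_interval lam"
  have "\<exists>L. L-lipschitz_on {lam n..lam (n + 1)} (Phi1 lam f)" for n
    by (rule C1_imp_lipschitz_on_Icc[OF affine_has_vector_derivative])
      (use Phi1_affine[of n _ f] in auto)
  then have "locally_absolutely_continuous_on ?I (Phi1 lam f)"
  proof (rule piecewise_lipschitz_imp_locally_absolutely_continuous[OF strict_mono_lam])
    fix x assume "x \<in> ?I"
    then show "\<exists>m n. lam m \<le> x \<and> x \<le> lam n"
      using mem_node_interval_iff less_imp_le by blast
  qed
  moreover have "AE x\<in>?I in lebesgue. Phi1 lam f differentiable (at x within ?I)"
    using AE_not_knot
  proof eventually_elim
    fix x assume nk: "x \<notin> range lam \<union> range (mid lam)"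
    show "x \<in> ?I \<longrightarrow> Phi1 lam f differentiable (at x within ?I)"
    proof
      assume "x \<in> ?I"
      then obtain n where "lam n < x" "x < lam (n + 1)"
        using nk node_interval_piece_interior by blast
      then show "Phi1 lam f differentiable (at x within ?I)"
        using Phi1_has_vector_derivative
        by (meson differentiableI_vector differentiable_at_withinI)
    qed
  qed
  ultimately show ?thesis unfolding sobolev_regular_def by simp
qed

text \<open>Off the nodes the derivative equals the first-order difference. The factor 8 is slack
  that gives the statement the shape of the one for \<open>Phi2\<close>; likewise the factor 2 in
  \<open>Phi1_le\<close>.\<close>

lemma AE_derivative_Phi1_le:
  "AE x in lebesgue. x \<in> node_interval lam \<longrightarrow>
    (\<exists>n. x \<in> window 1 n \<and> cmod (nth_deriv_on (node_interval lam) 1 (Phi1 lam f) x) \<le> 8 * cmod (node_dd lam f n 1))"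
  using AE_not_knot
proof eventually_elim
  fix x assume nk: "x \<notin> range lam \<union> range (mid lam)"
  let ?I = "node_interval lam"
  show "x \<in> ?I \<longrightarrow> (\<exists>n. x \<in> window 1 n \<and> cmod (nth_deriv_on ?I 1 (Phi1 lam f) x) \<le> 8 * cmod (node_dd lam f n 1))"
  proof
    assume x: "x \<in> ?I"
    then obtain n where n: "lam n < x" "x < lam (n + 1)"
      using nk node_interval_piece_interior by blast
    have "nth_deriv_on ?I 1 (Phi1 lam f) x = node_dd lam f n 1"
      using Phi1_has_vector_derivative[OF n, of f] at_within_open[OF x open_node_interval]
      by (simp add: nth_deriv_on_Suc vector_derivative_at)
    then show "\<exists>n. x \<in> window 1 n \<and> cmod (nth_deriv_on ?I 1 (Phi1 lam f) x) \<le> 8 * cmod (node_dd lam f n 1)"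
      using n by (intro exI[of _ n]) (auto simp: window_def)
  qed
qed

lemma Phi1_le:
  assumes x: "x \<in> node_interval lam"
  shows "\<exists>n. x \<in> window 1 n \<and> cmod (Phi1 lam f x) \<le>
    2 * (\<Sum>j\<le>1. (lam (n + 1) - lam n) ^ j * cmod (node_dd lam f n j))"
proof -
  obtain n where n: "lam n \<le> x" "x \<le> lam (n + 1)" using x by (auto simp: node_interval_def)
  define d where "d = cmod (node_dd lam f n (Suc 0))"
  have "cmod (Phi1 lam f x) \<le> cmod (f (lam n)) + \<bar>x - lam n\<bar> * d"
    unfolding Phi1_affine[OF n] d_def
    by (metis norm_mult norm_of_real norm_triangle_ineq)
  also have "\<bar>x - lam n\<bar> * d \<le> (lam (n + 1) - lam n) * d"
    using n by (intro mult_right_mono) (auto simp: d_def)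
  finally have *: "cmod (Phi1 lam f x) \<le> cmod (f (lam n)) + (lam (n + 1) - lam n) * d" by simp
  have "0 \<le> cmod (f (lam n)) + (lam (n + 1) - lam n) * d" by (simp add: d_def)
  with * have "cmod (Phi1 lam f x) \<le> 2 * (cmod (f (lam n)) + (lam (n + 1) - lam n) * d)"
    by (meson mult_le_cancel_right1 not_less one_le_numeral order_trans)
  then show ?thesis
    using n by (intro exI[of _ n]) (simp add: window_def node_dd_0 d_def)
qed

section \<open>Both interpolators under one interface\<close>

lemma sobolev_regular_Phi:
  "r \<in> {1, 2} \<Longrightarrow> sobolev_regular r (node_interval lam) (Phi r lam f)"
  using sobolev_regular_Phi1 sobolev_regular_Phi2 by (auto simp: Phi_def)

lemma AE_nth_deriv_Phi_le:
  "r \<in> {1, 2} \<Longrightarrow> AE x in lebesgue. x \<in> node_interval lam \<longrightarrow>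
    (\<exists>n. x \<in> window r n \<and> cmod (nth_deriv_on (node_interval lam) r (Phi r lam f) x) \<le> 8 * cmod (node_dd lam f n r))"
  using AE_derivative_Phi1_le AE_second_derivative_Phi2_le by (auto simp: Phi_def)

lemma Phi_le:
  "r \<in> {1, 2} \<Longrightarrow> x \<in> node_interval lam \<Longrightarrow> \<exists>n. x \<in> window r n \<and> cmod (Phi r lam f x) \<le>
    2 * (\<Sum>j\<le>r. (lam (n + int r) - lam n) ^ j * cmod (node_dd lam f n j))"
  using Phi1_le[of x f] Phi2_le[of x f] by (auto simp: Phi_def)

lemma Phi_node: "Phi r lam f (lam n) = f (lam n)"
proof -
  have "Phi2 lam f (lam n) = f (lam n)"
    using Phi2_eq_right[OF strict_mono_lam, of n "lam n" f] less_imp_le[OF mid_between(1)[of n]]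
    by (simp add: Phi2_right_def qcubic_def)
  moreover have "Phi1 lam f (lam n) = f (lam n)" using Phi1_affine[of n "lam n" f] by simp
  ultimately show ?thesis by (simp add: Phi_def)
qed

end

text \<open>The formulas read \<open>f\<close> at nodes only, and the choice of the piece does not
  involve \<open>f\<close>. The results are therefore equal as total functions, not only on the
  interval.\<close>

lemma Phi_cong:
  assumes "\<And>m. f (lam m) = g (lam m)"
  shows "Phi r lam f = Phi r lam g"
proof -
  have "Phi2_left lam f = Phi2_left lam g" "Phi2_right lam f = Phi2_right lam g"
    "Phi1_piece lam f = Phi1_piece lam g"
    by (simp_all add: fun_eq_iff Phi1_piece_def Phi2_left_def Phi2_right_def alpha_def assms)
  then show ?thesis by (simp add: fun_eq_iff Phi_def Phi1_def Phi2_def Let_def)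
qed

lemma divdiff_linear:
  "divdiff (\<lambda>y. a * f y + b * g y) [x, y] = a * divdiff f [x, y] + b * divdiff g [x, y]"
  "divdiff (\<lambda>y. a * f y + b * g y) [x, y, z] = a * divdiff f [x, y, z] + b * divdiff g [x, y, z]"
  by (simp_all add: add_divide_distrib diff_divide_distrib algebra_simps)

lemma Phi_linear:
  "Phi r lam (\<lambda>y. a * f y + b * g y) x = a * Phi r lam f x + b * Phi r lam g x"
proof -
  have 1: "alpha lam (\<lambda>y. a * f y + b * g y) n = a * alpha lam f n + b * alpha lam g n" for n
    unfolding alpha_def divdiff_linear by (simp add: add_divide_distrib algebra_simps del: divdiff.simps)
  have "Phi2_left lam (\<lambda>y. a * f y + b * g y) n x = a * Phi2_left lam f n x + b * Phi2_left lam g n x"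
    "Phi2_right lam (\<lambda>y. a * f y + b * g y) n x = a * Phi2_right lam f n x + b * Phi2_right lam g n x" for n
    unfolding Phi2_left_def Phi2_right_def 1 divdiff_linear by (simp_all add: algebra_simps del: divdiff.simps)
  then have "Phi2 lam (\<lambda>y. a * f y + b * g y) x = a * Phi2 lam f x + b * Phi2 lam g x"
    by (simp add: Phi2_def Let_def)
  moreover have "Phi1 lam (\<lambda>y. a * f y + b * g y) x = a * Phi1 lam f x + b * Phi1 lam g x"
    unfolding Phi1_def Phi1_piece_def by (simp only: distrib_left distrib_right mult.assoc add_ac)
  ultimately show ?thesis by (simp add: Phi_def)
qed

subsection \<open>Equivalence of norms\<close>

lemma ennreal_mult_double:
  assumes "c \<ge> 0" shows "ennreal c * x + ennreal c * x = ennreal (2 * c) * x"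
proof -
  have "ennreal (2 * c) = ennreal c + ennreal c" using assms by (simp flip: ennreal_plus)
  then show ?thesis by (simp only: distrib_right)
qed

text \<open>The discrete norm \<open>e\<close> mediates. Every extension \<open>F\<close> of
  \<open>f\<close> gives \<open>e f \<le> A * N F\<close>, and \<open>T f\<close> is itself an
  extension with \<open>N (T f) \<le> B * e f\<close>. The infimum over \<open>F\<close> yields the
  constant \<open>1 / A\<close>, the witness \<open>T f\<close> yields \<open>B\<close>, and
  composing the two bounds yields \<open>A * B\<close> for the operator.\<close>

lemma quasi_optimal_from_two_sided_bounds:
  assumes lower: "\<And>F. F \<in> X \<Longrightarrow> e F \<le> ennreal A * N F"
    and upper: "\<And>f. N (T f) \<le> ennreal B * e f"
    and mem: "\<And>f. N (T f) < \<infinity> \<Longrightarrow> T f \<in> X"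
    and fin: "\<And>F. F \<in> X \<Longrightarrow> N F < \<infinity>"
    and pos: "A > 0" "B > 0"
    and e_cong: "\<And>f g. (\<And>x. x \<in> \<Lambda> \<Longrightarrow> f x = g x) \<Longrightarrow> e f = e g"
    and T_cong: "\<And>f g. (\<And>x. x \<in> \<Lambda> \<Longrightarrow> f x = g x) \<Longrightarrow> T f = T g"
    and T_lin: "\<And>a b f g x. T (\<lambda>y. a * f y + b * g y) x = a * T f x + b * T g x"
    and T_interp: "\<And>f x. x \<in> \<Lambda> \<Longrightarrow> T f x = f x"
  shows "(\<forall>f\<in>trace_space X \<Lambda>. ennreal (1 / A) * e f \<le> trace_norm X N \<Lambda> f \<and>
            trace_norm X N \<Lambda> f \<le> ennreal B * e f) \<and>
         quasi_optimal_interpolator I X N \<Lambda> T \<and>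
         interpolator_norm X N \<Lambda> T \<le> ennreal (A * B)"
proof -
  have Af: "e f \<le> ennreal A * N F" if "F \<in> X" "\<forall>x\<in>\<Lambda>. F x = f x" for f F
    using lower[OF that(1)] e_cong[of F f] that(2) by simp
  \<comment> \<open>The bound \<open>upper\<close> admits infinite values. A trace has an extension
    of finite norm, so \<open>e f\<close> and then \<open>N (T f)\<close> are finite, which puts
    \<open>T f\<close> into \<open>X\<close>.\<close>
  have TX: "T f \<in> X" if f: "f \<in> trace_space X \<Lambda>" for f
  proof -
    obtain F where F: "F \<in> X" "\<forall>x\<in>\<Lambda>. F x = f x" using f by (auto simp: trace_space_def)
    have "e f < \<infinity>" using Af[OF F] fin[OF F(1)]
      by (metis ennreal_less_top ennreal_mult_less_top infinity_ennreal_def le_less_trans)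
    then have "N (T f) < \<infinity>" using upper[of f]
      by (metis ennreal_less_top ennreal_mult_less_top infinity_ennreal_def le_less_trans)
    then show ?thesis by (rule mem)
  qed
  have inv: "ennreal (1 / A) * (ennreal A * y) = y" for y
    using pos by (simp add: ennreal_mult[symmetric] mult.assoc[symmetric])
  have lo: "ennreal (1 / A) * e f \<le> trace_norm X N \<Lambda> f" for f
    unfolding trace_norm_def
  proof (rule Inf_greatest)
    fix y assume "y \<in> {N F |F. F \<in> X \<and> (\<forall>x\<in>\<Lambda>. F x = f x)}"
    then obtain F where F: "y = N F" "F \<in> X" "\<forall>x\<in>\<Lambda>. F x = f x" by blast
    then have "ennreal (1 / A) * e f \<le> ennreal (1 / A) * (ennreal A * N F)"
      by (intro mult_left_mono Af) auto
    then show "ennreal (1 / A) * e f \<le> y" using F inv by simp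
  qed
  have up: "trace_norm X N \<Lambda> f \<le> ennreal B * e f" if "f \<in> trace_space X \<Lambda>" for f
  proof -
    have "trace_norm X N \<Lambda> f \<le> N (T f)"
      unfolding trace_norm_def using TX[OF that] T_interp by (intro Inf_lower) blast
    then show ?thesis using upper order_trans by blast
  qed
  have bd: "N (T f) \<le> ennreal (A * B) * trace_norm X N \<Lambda> f" for f
  proof -
    have "e f = ennreal A * (ennreal (1 / A) * e f)"
      using inv[of "e f"] by (simp add: mult.left_commute)
    also have "\<dots> \<le> ennreal A * trace_norm X N \<Lambda> f" using lo by (intro mult_left_mono) auto
    finally have "ennreal B * e f \<le> ennreal B * (ennreal A * trace_norm X N \<Lambda> f)"
      by (intro mult_left_mono) auto
    also have "\<dots> = ennreal (A * B) * trace_norm X N \<Lambda> f"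
      using pos by (simp add: ennreal_mult mult_ac)
    finally show ?thesis using upper order_trans by blast
  qed
  have q: "quasi_optimal_interpolator I X N \<Lambda> T"
    unfolding quasi_optimal_interpolator_def
  proof (intro conjI ballI allI impI)
    show "\<exists>B<\<infinity>. \<forall>f\<in>trace_space X \<Lambda>. N (T f) \<le> B * trace_norm X N \<Lambda> f"
      using bd by (intro exI[of _ "ennreal (A * B)"]) auto
    fix f g :: "real \<Rightarrow> complex" and x assume "\<forall>x\<in>\<Lambda>. f x = g x"
    then show "T f x = T g x" using T_cong[of f g] by simp
  qed (use TX T_lin T_interp in auto)
  have "interpolator_norm X N \<Lambda> T \<le> ennreal (A * B)"
    unfolding interpolator_norm_def using bd by (intro Inf_lower) auto
  then show ?thesis using lo up q by blast
qed

text \<open>The discrete norm before the root, so that estimates can be made between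
  \<open>p\<close>-th powers.\<close>

definition eqW_sum :: "nat \<Rightarrow> real \<Rightarrow> (int \<Rightarrow> real) \<Rightarrow> (real \<Rightarrow> complex) \<Rightarrow> ennreal" where
  "eqW_sum r p lam f = eqL_sum r p lam f +
     (\<Sum>j<r. \<Sum>\<^sub>\<infinity>n. ennreal ((lam (n + int r) - lam n) powr (real j * p + 1) * cmod (node_dd lam f n j) powr p))"

lemma eqW_norm_eq: "eqW_norm r p lam f = ennroot p (eqW_sum r p lam f)"
  by (simp add: eqW_norm_def eqW_sum_def)

definition power_integral :: "real \<Rightarrow> real set \<Rightarrow> (real \<Rightarrow> complex) \<Rightarrow> ennreal" where
  "power_integral p S g = (\<integral>\<^sup>+x\<in>S. ennreal (cmod (g x) powr p) \<partial>lebesgue)"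

lemma L_norm_eq: "L_norm r p I F = ennroot p (power_integral p I (nth_deriv_on I r F))"
  by (simp add: L_norm_def power_integral_def)

lemma W_norm_eq: "W_norm r p I F = ennroot p (power_integral p I F + power_integral p I (nth_deriv_on I r F))"
  by (simp add: W_norm_def power_integral_def)

lemma power_integral_mono: "S \<subseteq> T \<Longrightarrow> power_integral p S g \<le> power_integral p T g"
  unfolding power_integral_def by (intro nn_integral_mono) (auto simp: indicator_def)

section \<open>Comparison of p-th powers on the whole interval\<close>

context node_sequence
begin

abbreviation "I \<equiv> node_interval lam"

text \<open>The factor 3 is the largest overlap \<open>r + 1\<close>.\<close>

lemma infsum_window_power_integral_le:
  assumes r: "r \<in> {1, 2}"
    and meas: "\<And>n. (\<lambda>x. ennreal (cmod (g x) powr p) * indicator (window r n) x) \<in> borel_measurable lebesgue"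
  shows "(\<Sum>\<^sub>\<infinity>n. power_integral p (window r n) g) \<le> 3 * power_integral p I g"
proof -
  have U: "(\<Union>n. window r n) = I" using r by (intro Union_window) auto
  have "(\<Sum>\<^sub>\<infinity>n. power_integral p (window r n) g) \<le> ennreal (real (r + 1)) * power_integral p (\<Union>n. window r n) g"
    unfolding power_integral_def
    by (rule infsum_nn_integral_overlap_le[OF meas]) (use card_window_overlap U in blast)
  also have "\<dots> \<le> 3 * power_integral p I g"
    unfolding U
  proof (rule mult_right_mono)
    have "ennreal (real (r + 1)) \<le> ennreal 3" using r by (intro ennreal_leI) auto
    then show "ennreal (real (r + 1)) \<le> 3" by simp
  qed simp
  finally show ?thesis .
qed

text \<open>The constant 6 is 2 from a single window times the overlap 3, which
  \<open>3 \<le> 3 powr p\<close> brings under the power.\<close>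

lemma eqL_sum_le:
  assumes r: "r \<in> {1, 2}" and "1 \<le> p" and reg: "sobolev_regular r I F"
    and fin: "power_integral p I (nth_deriv_on I r F) < \<infinity>"
  shows "eqL_sum r p lam F \<le> ennreal (6 powr p) * power_integral p I (nth_deriv_on I r F)"
proof -
  let ?D = "nth_deriv_on I r F"
  have fw: "power_integral p (window r n) ?D < \<infinity>" for n
    using power_integral_mono[OF window_subset] fin le_less_trans by blast
  have meas: "(\<lambda>x. ennreal (cmod (?D x) powr p) * indicator (window r n) x) \<in> borel_measurable lebesgue" for n
    unfolding window_def using r by (intro sobolev_regular_measurable[OF reg]) auto
  have "eqL_sum r p lam F \<le> (\<Sum>\<^sub>\<infinity>n. ennreal (2 powr p) * power_integral p (window r n) ?D)"
    unfolding eqL_sum_def power_integral_def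
    by (intro infsum_mono_ennreal node_dd_powr_le_window_integral[OF reg r \<open>1 \<le> p\<close>] fw[unfolded power_integral_def])
  also have "\<dots> = ennreal (2 powr p) * (\<Sum>\<^sub>\<infinity>n. power_integral p (window r n) ?D)"
    by (rule infsum_cmult_ennreal)
  also have "\<dots> \<le> ennreal (2 powr p) * (3 * power_integral p I ?D)"
    by (intro mult_left_mono infsum_window_power_integral_le[OF r meas]) auto
  also have "\<dots> = ennreal (2 powr p * 3) * power_integral p I ?D"
    by (simp add: ennreal_mult mult.assoc)
  also have "\<dots> \<le> ennreal (6 powr p) * power_integral p I ?D"
  proof (intro mult_right_mono ennreal_leI)
    have "2 powr p * 3 \<le> 2 powr p * 3 powr p"
      using \<open>1 \<le> p\<close> powr_mono[of 1 p 3] by (intro mult_left_mono) auto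
    then show "2 powr p * 3 \<le> 6 powr p" using powr_mult[of 2 3 p] by simp
  qed simp
  finally show ?thesis .
qed

text \<open>The constant 864 is 72 from a single window, times 6 for the overlap 3 and at most two
  orders \<open>j < r\<close>, times 2 for adding the sum of order \<open>r\<close>.\<close>

lemma eqW_sum_le:
  assumes r: "r \<in> {1, 2}" and "1 \<le> p" and reg: "sobolev_regular r I F"
    and gaps: "\<And>n. lam (n + 1) - lam n \<le> K"
    and fin: "power_integral p I F + power_integral p I (nth_deriv_on I r F) < \<infinity>"
  shows "eqW_sum r p lam F \<le> ennreal ((864 * (1 + 2 * K)\<^sup>2) powr p) *
    (power_integral p I F + power_integral p I (nth_deriv_on I r F))"
proof -
  let ?D = "nth_deriv_on I r F"
  let ?S = "power_integral p I F + power_integral p I ?D"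
  define M where "M = 72 * (1 + 2 * K)\<^sup>2"
  have "K \<ge> 0" using gaps[of 0] lam_less_iff[of 0 "0 + 1"] by linarith
  then have "1 \<le> (1 + 2 * K)\<^sup>2" by (intro one_le_power) simp
  then have M: "1 \<le> M" by (simp add: M_def)
  have fin1: "power_integral p I F < \<infinity>" "power_integral p I ?D < \<infinity>" using fin by auto
  have fw: "power_integral p (window r n) ?D < \<infinity>" "power_integral p (window r n) F < \<infinity>" for n
    using power_integral_mono[OF window_subset] fin1 le_less_trans by blast+
  have meas: "(\<lambda>x. ennreal (cmod (?D x) powr p) * indicator (window r n) x) \<in> borel_measurable lebesgue" for n
    unfolding window_def using r by (intro sobolev_regular_measurable[OF reg]) auto
  have measF: "(\<lambda>x. ennreal (cmod (F x) powr p) * indicator (window r n) x) \<in> borel_measurable lebesgue" for n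
  proof -
    have "continuous_on (window r n) F"
      using sobolev_regular_continuous_on[OF reg r open_node_interval] window_subset continuous_on_subset by blast
    then have [measurable]: "F \<in> borel_measurable (lebesgue_on (window r n))"
      by (rule continuous_imp_measurable_on_sets_lebesgue) (simp add: window_def)
    have "(\<lambda>x. ennreal (cmod (F x) powr p)) \<in> borel_measurable (lebesgue_on (window r n))"
      by measurable
    then show ?thesis
      by (subst (asm) borel_measurable_restrict_space_iff_ennreal) (auto simp: mult.commute window_def)
  qed
  have summand: "(\<Sum>\<^sub>\<infinity>n. ennreal ((lam (n + int r) - lam n) powr (real j * p + 1) * cmod (node_dd lam F n j) powr p))
      \<le> ennreal (M powr p) * (3 * ?S)" if "j < r" for j
  proof -
    have "(\<Sum>\<^sub>\<infinity>n. ennreal ((lam (n + int r) - lam n) powr (real j * p + 1) * cmod (node_dd lam F n j) powr p))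
      \<le> (\<Sum>\<^sub>\<infinity>n. ennreal (M powr p) * (power_integral p (window r n) F + power_integral p (window r n) ?D))"
      unfolding M_def
      by (intro infsum_mono_ennreal lower_order_powr_le_window_integral[OF reg r that \<open>1 \<le> p\<close> gaps])
        (use fw in \<open>auto simp: power_integral_def\<close>)
    also have "\<dots> = ennreal (M powr p) *
        ((\<Sum>\<^sub>\<infinity>n. power_integral p (window r n) F) + (\<Sum>\<^sub>\<infinity>n. power_integral p (window r n) ?D))"
      by (simp only: infsum_cmult_ennreal infsum_add_ennreal)
    also have "\<dots> \<le> ennreal (M powr p) * (3 * power_integral p I F + 3 * power_integral p I ?D)"
      by (intro mult_left_mono add_mono infsum_window_power_integral_le[OF r] meas measF) auto
    finally show ?thesis by (simp add: distrib_left)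
  qed
  have 6: "6 \<le> 6 powr p" using \<open>1 \<le> p\<close> powr_mono[of 1 p 6] by simp
  have Mp: "1 \<le> M powr p" using M \<open>1 \<le> p\<close> by (simp add: ge_one_powr_ge_zero)
  have "(\<Sum>j<r. \<Sum>\<^sub>\<infinity>n. ennreal ((lam (n + int r) - lam n) powr (real j * p + 1) * cmod (node_dd lam F n j) powr p))
      \<le> (\<Sum>j<r. ennreal (M powr p) * (3 * ?S))"
    using summand by (intro sum_mono) auto
  also have "\<dots> = ennreal (real r) * (ennreal (M powr p) * (3 * ?S))"
    by (simp add: ennreal_of_nat_eq_real_of_nat)
  also have "\<dots> = ennreal (real r * M powr p * 3) * ?S"
    by (simp add: ennreal_mult mult.assoc)
  also have "\<dots> \<le> ennreal ((6 * M) powr p) * ?S"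
  proof (intro mult_right_mono ennreal_leI)
    have "real r * M powr p * 3 \<le> 6 * M powr p" using r by auto
    also have "\<dots> \<le> 6 powr p * M powr p" using 6 by (intro mult_right_mono) auto
    finally show "real r * M powr p * 3 \<le> (6 * M) powr p" using M by (simp add: powr_mult)
  qed simp
  finally have 1: "(\<Sum>j<r. \<Sum>\<^sub>\<infinity>n. ennreal ((lam (n + int r) - lam n) powr (real j * p + 1) * cmod (node_dd lam F n j) powr p))
      \<le> ennreal ((6 * M) powr p) * ?S" .
  have "eqL_sum r p lam F \<le> ennreal (6 powr p) * power_integral p I ?D"
    by (rule eqL_sum_le[OF r \<open>1 \<le> p\<close> reg fin1(2)])
  also have "\<dots> \<le> ennreal ((6 * M) powr p) * ?S"
    using M \<open>1 \<le> p\<close> by (intro mult_mono ennreal_leI powr_mono2) auto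
  finally have "eqW_sum r p lam F \<le> ennreal ((6 * M) powr p) * ?S + ennreal ((6 * M) powr p) * ?S"
    unfolding eqW_sum_def using 1 by (intro add_mono)
  also have "\<dots> = ennreal (2 * (6 * M) powr p) * ?S"
    by (rule ennreal_mult_double) simp
  also have "\<dots> \<le> ennreal ((12 * M) powr p) * ?S"
  proof (intro mult_right_mono ennreal_leI)
    have "2 * (6 * M) powr p \<le> 2 powr p * (6 * M) powr p"
      using \<open>1 \<le> p\<close> powr_mono[of 1 p 2] by (intro mult_right_mono) auto
    also have "\<dots> = (12 * M) powr p" using M by (subst powr_mult[symmetric]) auto
    finally show "2 * (6 * M) powr p \<le> (12 * M) powr p" .
  qed simp
  finally show ?thesis by (simp add: M_def)
qed

lemma emeasure_window: "emeasure lebesgue (window r n) = ennreal (lam (n + int r) - lam n)"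
  by (simp add: window_def)

text \<open>The pointwise bound is constant on a window, and the window length supplies exactly the
  weight in \<open>eqL_sum\<close>.\<close>

lemma power_integral_nth_deriv_Phi_le:
  assumes r: "r \<in> {1, 2}" and "1 \<le> p"
  shows "power_integral p I (nth_deriv_on I r (Phi r lam f)) \<le> ennreal (8 powr p) * eqL_sum r p lam f"
proof -
  have "power_integral p I (nth_deriv_on I r (Phi r lam f)) \<le>
      (\<Sum>\<^sub>\<infinity>n. ennreal ((8 * cmod (node_dd lam f n r)) powr p) * emeasure lebesgue (window r n))"
    unfolding power_integral_def
  proof (rule nn_integral_cover_le)
    show "window r n \<in> sets lebesgue" for n by (simp add: window_def)
    show "AE x in lebesgue. x \<in> I \<longrightarrow> (\<exists>n. x \<in> window r n \<and>
        ennreal (cmod (nth_deriv_on I r (Phi r lam f) x) powr p) \<le> ennreal ((8 * cmod (node_dd lam f n r)) powr p))"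
      using AE_nth_deriv_Phi_le[OF r, of f]
    proof eventually_elim
      case (elim x)
      show ?case
      proof
        assume "x \<in> I"
        then obtain n where "x \<in> window r n"
          "cmod (nth_deriv_on I r (Phi r lam f) x) \<le> 8 * cmod (node_dd lam f n r)"
          using elim by blast
        then show "\<exists>n. x \<in> window r n \<and>
            ennreal (cmod (nth_deriv_on I r (Phi r lam f) x) powr p) \<le> ennreal ((8 * cmod (node_dd lam f n r)) powr p)"
          using \<open>1 \<le> p\<close> by (intro exI[of _ n]) (auto intro!: ennreal_leI powr_mono2)
      qed
    qed
  qed
  also have "\<dots> = (\<Sum>\<^sub>\<infinity>n. ennreal (8 powr p) * ennreal ((lam (n + int r) - lam n) * cmod (node_dd lam f n r) powr p))"
    using r by (intro infsum_cong) (auto simp: emeasure_window powr_mult ennreal_mult[symmetric] mult_ac)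
  also have "\<dots> = ennreal (8 powr p) * eqL_sum r p lam f"
    by (simp add: infsum_cmult_ennreal eqL_sum_def)
  finally show ?thesis .
qed

text \<open>The constant 6 is the factor 2 of \<open>Phi_le\<close> times at most three orders
  \<open>j \<le> r\<close>. The square absorbs the excess weight of the order \<open>r\<close> over
  the one in \<open>eqL_sum\<close>.\<close>

lemma power_integral_Phi_le:
  assumes r: "r \<in> {1, 2}" and "1 \<le> p"
    and gaps: "\<And>n. lam (n + 1) - lam n \<le> K"
  shows "power_integral p I (Phi r lam f) \<le> ennreal ((6 * (1 + 2 * K)\<^sup>2) powr p) * eqW_sum r p lam f"
proof -
  define L where "L = (1 + 2 * K)\<^sup>2"
  have K0: "K \<ge> 0" using gaps[of 0] lam_less_iff[of 0 "0 + 1"] by linarith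
  then have L1: "1 \<le> L" unfolding L_def by (intro one_le_power) simp
  define H where "H n = lam (n + int r) - lam n" for n
  have H: "H n > 0" for n using r by (auto simp: H_def)
  have HL: "H n ^ r \<le> L" for n
  proof -
    have "H n \<le> 2 * K" using r gaps[of n] gaps[of "n + 1"] K0 by (auto simp: H_def add.assoc)
    then have "H n ^ r \<le> (1 + 2 * K) ^ r" using H[of n] by (intro power_mono) auto
    also have "\<dots> \<le> (1 + 2 * K)\<^sup>2" using r K0 by (intro power_increasing) auto
    finally show ?thesis by (simp add: L_def)
  qed
  define a where "a n j = H n ^ j * cmod (node_dd lam f n j)" for n j
  have a0: "a n j \<ge> 0" for n j using H[of n] by (simp add: a_def)
  define b where "b n j = H n powr (real j * p + 1) * cmod (node_dd lam f n j) powr p" for n j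
  \<comment> \<open>Window length times the \<open>p\<close>-th power of a summand is the
    corresponding term of the discrete norm.\<close>
  have ab: "H n * a n j powr p = b n j" for n j
  proof -
    have "H n powr (real j * p + 1) = (H n ^ j) powr p * H n"
      using H[of n] by (simp add: powr_add powr_realpow[symmetric] powr_powr)
    then show ?thesis using H[of n] by (simp add: a_def b_def powr_mult)
  qed
  have Lp: "1 \<le> L powr p" using L1 \<open>1 \<le> p\<close> by (simp add: ge_one_powr_ge_zero)
  have main: "(2 * (\<Sum>j\<le>r. a n j)) powr p * H n \<le>
      (6 * L) powr p * (H n * cmod (node_dd lam f n r) powr p + (\<Sum>j<r. b n j))" for n
  proof -
    have "(\<Sum>j\<le>r. a n j) powr p \<le> real (card {..r}) powr p * (\<Sum>j\<le>r. a n j powr p)"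
      using a0 \<open>1 \<le> p\<close> by (intro sum_powr_le) auto
    also have "\<dots> \<le> 3 powr p * (\<Sum>j\<le>r. a n j powr p)"
      using r \<open>1 \<le> p\<close> by (intro mult_right_mono powr_mono2 sum_nonneg) auto
    finally have "(\<Sum>j\<le>r. a n j) powr p * H n \<le> 3 powr p * (\<Sum>j\<le>r. a n j powr p) * H n"
      using H[of n] by (intro mult_right_mono) auto
    also have "\<dots> = 3 powr p * (\<Sum>j\<le>r. b n j)"
      by (simp add: ab[symmetric] sum_distrib_left mult_ac)
    also have "(\<Sum>j\<le>r. b n j) = b n r + (\<Sum>j<r. b n j)"
      by (simp add: lessThan_Suc_atMost[symmetric] add.commute)
    also have "b n r \<le> L powr p * (H n * cmod (node_dd lam f n r) powr p)"
    proof -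
      have "b n r = (H n ^ r) powr p * (H n * cmod (node_dd lam f n r) powr p)"
        using H[of n] by (simp add: ab[symmetric] a_def powr_mult)
      also have "\<dots> \<le> L powr p * (H n * cmod (node_dd lam f n r) powr p)"
        using H[of n] HL[of n] \<open>1 \<le> p\<close> by (intro mult_right_mono powr_mono2) auto
      finally show ?thesis .
    qed
    \<comment> \<open>The lower orders already have the right weight; the factor, at least 1, is
      inserted only to share one constant with the order \<open>r\<close>.\<close>
    also have "(\<Sum>j<r. b n j) \<le> L powr p * (\<Sum>j<r. b n j)"
      using Lp mult_right_mono[of 1 "L powr p" "\<Sum>j<r. b n j"] H[of n]
      by (simp add: b_def sum_nonneg)
    finally have *: "(\<Sum>j\<le>r. a n j) powr p * H n \<le>
        3 powr p * (L powr p * (H n * cmod (node_dd lam f n r) powr p) + L powr p * (\<Sum>j<r. b n j))"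
      by simp
    have "(2 * (\<Sum>j\<le>r. a n j)) powr p * H n = 2 powr p * ((\<Sum>j\<le>r. a n j) powr p * H n)"
      using a0 by (simp add: powr_mult sum_nonneg)
    also have "\<dots> \<le> 2 powr p *
        (3 powr p * (L powr p * (H n * cmod (node_dd lam f n r) powr p) + L powr p * (\<Sum>j<r. b n j)))"
      using * by (intro mult_left_mono) auto
    also have "\<dots> = (2 powr p * 3 powr p * L powr p) * (H n * cmod (node_dd lam f n r) powr p + (\<Sum>j<r. b n j))"
      by (simp add: algebra_simps)
    also have "2 powr p * 3 powr p * L powr p = (6 * L) powr p"
      using L1 powr_mult[of 2 3 p] by (simp add: powr_mult)
    finally show ?thesis .
  qed
  have "power_integral p I (Phi r lam f) \<le>
      (\<Sum>\<^sub>\<infinity>n. ennreal ((2 * (\<Sum>j\<le>r. a n j)) powr p) * emeasure lebesgue (window r n))"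
    unfolding power_integral_def
  proof (rule nn_integral_cover_le)
    show "window r n \<in> sets lebesgue" for n by (simp add: window_def)
    show "AE x in lebesgue. x \<in> I \<longrightarrow> (\<exists>n. x \<in> window r n \<and>
        ennreal (cmod (Phi r lam f x) powr p) \<le> ennreal ((2 * (\<Sum>j\<le>r. a n j)) powr p))"
    proof (intro AE_I2 impI)
      fix x assume "x \<in> I"
      then obtain n where "x \<in> window r n" "cmod (Phi r lam f x) \<le> 2 * (\<Sum>j\<le>r. a n j)"
        using Phi_le[OF r, of x f] unfolding a_def H_def by blast
      then show "\<exists>n. x \<in> window r n \<and>
          ennreal (cmod (Phi r lam f x) powr p) \<le> ennreal ((2 * (\<Sum>j\<le>r. a n j)) powr p)"
        using \<open>1 \<le> p\<close> by (intro exI[of _ n]) (auto intro!: ennreal_leI powr_mono2)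
    qed
  qed
  also have "\<dots> \<le> (\<Sum>\<^sub>\<infinity>n. ennreal ((6 * L) powr p) *
      (ennreal (H n * cmod (node_dd lam f n r) powr p) + (\<Sum>j<r. ennreal (b n j))))"
  proof (rule infsum_mono_ennreal)
    fix n
    have b0: "b n j \<ge> 0" for j by (simp add: b_def)
    have "ennreal ((2 * (\<Sum>j\<le>r. a n j)) powr p) * emeasure lebesgue (window r n) =
        ennreal ((2 * (\<Sum>j\<le>r. a n j)) powr p * H n)"
      using H[of n] by (simp add: emeasure_window H_def ennreal_mult)
    also have "\<dots> \<le> ennreal ((6 * L) powr p * (H n * cmod (node_dd lam f n r) powr p + (\<Sum>j<r. b n j)))"
      by (rule ennreal_leI[OF main])
    also have "\<dots> = ennreal ((6 * L) powr p) *
        (ennreal (H n * cmod (node_dd lam f n r) powr p) + (\<Sum>j<r. ennreal (b n j)))"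
      using H[of n] b0 by (simp add: ennreal_mult sum_ennreal sum_nonneg)
    finally show "ennreal ((2 * (\<Sum>j\<le>r. a n j)) powr p) * emeasure lebesgue (window r n) \<le> ennreal ((6 * L) powr p) *
        (ennreal (H n * cmod (node_dd lam f n r) powr p) + (\<Sum>j<r. ennreal (b n j)))" .
  qed
  also have "\<dots> = ennreal ((6 * L) powr p) * eqW_sum r p lam f"
    unfolding infsum_cmult_ennreal infsum_add_ennreal infsum_sum_ennreal eqW_sum_def eqL_sum_def b_def H_def
    by simp
  finally show ?thesis by (simp add: L_def)
qed

text \<open>Both integrals are bounded with the larger constant 8 times the square, and adding the
  two bounds doubles it to 16.\<close>

lemma power_integral_sum_Phi_le:
  assumes r: "r \<in> {1, 2}" and "1 \<le> p"
    and gaps: "\<And>n. lam (n + 1) - lam n \<le> K"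
  shows "power_integral p I (Phi r lam f) + power_integral p I (nth_deriv_on I r (Phi r lam f)) \<le>
    ennreal ((16 * (1 + 2 * K)\<^sup>2) powr p) * eqW_sum r p lam f"
proof -
  define L where "L = (1 + 2 * K)\<^sup>2"
  have "K \<ge> 0" using gaps[of 0] lam_less_iff[of 0 "0 + 1"] by linarith
  then have L1: "1 \<le> L" unfolding L_def by (intro one_le_power) simp
  have "power_integral p I (Phi r lam f) \<le> ennreal ((6 * L) powr p) * eqW_sum r p lam f"
    unfolding L_def by (rule power_integral_Phi_le[OF r \<open>1 \<le> p\<close> gaps])
  also have "\<dots> \<le> ennreal ((8 * L) powr p) * eqW_sum r p lam f"
    using L1 \<open>1 \<le> p\<close> by (intro mult_right_mono ennreal_leI powr_mono2) auto
  finally have 1: "power_integral p I (Phi r lam f) \<le> ennreal ((8 * L) powr p) * eqW_sum r p lam f" .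
  have "power_integral p I (nth_deriv_on I r (Phi r lam f)) \<le> ennreal (8 powr p) * eqL_sum r p lam f"
    by (rule power_integral_nth_deriv_Phi_le[OF r \<open>1 \<le> p\<close>])
  also have "\<dots> \<le> ennreal ((8 * L) powr p) * eqW_sum r p lam f"
    using L1 \<open>1 \<le> p\<close> by (intro mult_mono ennreal_leI powr_mono2) (auto simp: eqW_sum_def)
  finally have "power_integral p I (Phi r lam f) + power_integral p I (nth_deriv_on I r (Phi r lam f)) \<le>
      ennreal ((8 * L) powr p) * eqW_sum r p lam f + ennreal ((8 * L) powr p) * eqW_sum r p lam f"
    using 1 by (intro add_mono)
  also have "\<dots> = ennreal (2 * (8 * L) powr p) * eqW_sum r p lam f"
    by (rule ennreal_mult_double) simp
  also have "\<dots> \<le> ennreal ((16 * L) powr p) * eqW_sum r p lam f"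
  proof (intro mult_right_mono ennreal_leI)
    have "2 * (8 * L) powr p \<le> 2 powr p * (8 * L) powr p"
      using \<open>1 \<le> p\<close> powr_mono[of 1 p 2] by (intro mult_right_mono) auto
    also have "\<dots> = (16 * L) powr p" using L1 by (subst powr_mult[symmetric]) auto
    finally show "2 * (8 * L) powr p \<le> (16 * L) powr p" .
  qed simp
  finally show ?thesis by (simp add: L_def)
qed

lemma eqW_sum_cong:
  assumes "\<And>x. x \<in> range lam \<Longrightarrow> f x = g x"
  shows "eqL_sum r p lam f = eqL_sum r p lam g" "eqW_sum r p lam f = eqW_sum r p lam g"
proof -
  have "node_dd lam f = node_dd lam g"
    using assms node_dd_cong[of f lam g] by (auto simp: fun_eq_iff)
  then show "eqL_sum r p lam f = eqL_sum r p lam g" "eqW_sum r p lam f = eqW_sum r p lam g"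
    by (simp_all add: eqW_sum_def eqL_sum_def)
qed

section \<open>The two norm equivalences with explicit constants\<close>

lemma L_space_interpolation:
  assumes r: "r \<in> {1, 2}" and "1 \<le> p"
  shows "(\<forall>f\<in>trace_space (L_space r p I) (range lam).
            ennreal (1 / 6) * eqL_norm r p lam f \<le> trace_norm (L_space r p I) (L_norm r p I) (range lam) f \<and>
            trace_norm (L_space r p I) (L_norm r p I) (range lam) f \<le> ennreal 8 * eqL_norm r p lam f) \<and>
         quasi_optimal_interpolator I (L_space r p I) (L_norm r p I) (range lam) (Phi r lam) \<and>
         interpolator_norm (L_space r p I) (L_norm r p I) (range lam) (Phi r lam) \<le> ennreal (6 * 8)"
proof (rule quasi_optimal_from_two_sided_bounds)
  show "eqL_norm r p lam F \<le> ennreal 6 * L_norm r p I F" if "F \<in> L_space r p I" for F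
    unfolding eqL_norm_def L_norm_eq using that \<open>1 \<le> p\<close>
    by (intro ennroot_le eqL_sum_le[OF r]) (auto simp: L_space_def L_norm_eq)
  show N: "L_norm r p I (Phi r lam f) \<le> ennreal 8 * eqL_norm r p lam f" for f
    unfolding eqL_norm_def L_norm_eq using \<open>1 \<le> p\<close>
    by (intro ennroot_le power_integral_nth_deriv_Phi_le[OF r]) auto
  show "Phi r lam f \<in> L_space r p I" if "L_norm r p I (Phi r lam f) < \<infinity>" for f
    using that sobolev_regular_Phi[OF r] by (simp add: L_space_def)
  show "L_norm r p I F < \<infinity>" if "F \<in> L_space r p I" for F
    using that by (simp add: L_space_def)
  show "eqL_norm r p lam f = eqL_norm r p lam g" if "\<And>x. x \<in> range lam \<Longrightarrow> f x = g x" for f g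
    using eqW_sum_cong[of f g] that by (simp add: eqL_norm_def)
  show "Phi r lam f = Phi r lam g" if "\<And>x. x \<in> range lam \<Longrightarrow> f x = g x" for f g
    using that by (intro Phi_cong) auto
qed (auto simp: Phi_linear Phi_node)

lemma W_space_interpolation:
  assumes r: "r \<in> {1, 2}" and "1 \<le> p"
    and gaps: "\<And>n. lam (n + 1) - lam n \<le> K"
  defines "A \<equiv> 864 * (1 + 2 * K)\<^sup>2" and "B \<equiv> 16 * (1 + 2 * K)\<^sup>2"
  shows "(\<forall>f\<in>trace_space (W_space r p I) (range lam).
            ennreal (1 / A) * eqW_norm r p lam f \<le> trace_norm (W_space r p I) (W_norm r p I) (range lam) f \<and>
            trace_norm (W_space r p I) (W_norm r p I) (range lam) f \<le> ennreal B * eqW_norm r p lam f) \<and>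
         quasi_optimal_interpolator I (W_space r p I) (W_norm r p I) (range lam) (Phi r lam) \<and>
         interpolator_norm (W_space r p I) (W_norm r p I) (range lam) (Phi r lam) \<le> ennreal (A * B)"
proof (rule quasi_optimal_from_two_sided_bounds)
  have "K \<ge> 0" using gaps[of 0] lam_less_iff[of 0 "0 + 1"] by linarith
  then have "0 < (1 + 2 * K)\<^sup>2" by simp
  then show pos: "A > 0" "B > 0" by (simp_all add: A_def B_def)
  show "eqW_norm r p lam F \<le> ennreal A * W_norm r p I F" if "F \<in> W_space r p I" for F
    unfolding eqW_norm_eq W_norm_eq A_def
    by (intro ennroot_le eqW_sum_le[OF r] gaps \<open>1 \<le> p\<close>)
      (use that pos in \<open>auto simp: W_space_def W_norm_eq A_def\<close>)
  show N: "W_norm r p I (Phi r lam f) \<le> ennreal B * eqW_norm r p lam f" for f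
    unfolding eqW_norm_eq W_norm_eq B_def
    by (intro ennroot_le power_integral_sum_Phi_le[OF r] gaps \<open>1 \<le> p\<close>)
      (use pos in \<open>auto simp: B_def\<close>)
  show "Phi r lam f \<in> W_space r p I" if "W_norm r p I (Phi r lam f) < \<infinity>" for f
    using that sobolev_regular_Phi[OF r] by (simp add: W_space_def)
  show "W_norm r p I F < \<infinity>" if "F \<in> W_space r p I" for F
    using that by (simp add: W_space_def)
  show "eqW_norm r p lam f = eqW_norm r p lam g" if "\<And>x. x \<in> range lam \<Longrightarrow> f x = g x" for f g
    using eqW_sum_cong[of f g] that by (simp add: eqW_norm_eq)
  show "Phi r lam f = Phi r lam g" if "\<And>x. x \<in> range lam \<Longrightarrow> f x = g x" for f g
    using that by (intro Phi_cong) auto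
qed (auto simp: Phi_linear Phi_node)

end

theorem theorem1:
  fixes r :: nat
  assumes "r \<in> {1, 2}"
  shows
    "(\<exists>C>0. \<exists>C'>0. \<exists>C''>0. \<forall>(p::real) (lam :: int \<Rightarrow> real).
        1 \<le> p \<and> strict_mono lam \<longrightarrow>
        (let I = node_interval lam; \<Lambda> = range lam;
             X = L_space r p I; N = L_norm r p I
         in (\<forall>f\<in>trace_space X \<Lambda>.
               ennreal C * eqL_norm r p lam f \<le> trace_norm X N \<Lambda> f \<and>
               trace_norm X N \<Lambda> f \<le> ennreal C' * eqL_norm r p lam f) \<and>
            quasi_optimal_interpolator I X N \<Lambda> (Phi r lam) \<and>
            interpolator_norm X N \<Lambda> (Phi r lam) \<le> ennreal C'')) \<and>
     (\<forall>K>0. \<exists>C>0. \<exists>C'>0. \<exists>C''>0. \<forall>(p::real) (lam :: int \<Rightarrow> real).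
        1 \<le> p \<and> strict_mono lam \<and> (\<forall>n. lam (n + 1) - lam n \<le> K) \<longrightarrow>
        (let I = node_interval lam; \<Lambda> = range lam;
             X = W_space r p I; N = W_norm r p I
         in (\<forall>f\<in>trace_space X \<Lambda>.
               ennreal C * eqW_norm r p lam f \<le> trace_norm X N \<Lambda> f \<and>
               trace_norm X N \<Lambda> f \<le> ennreal C' * eqW_norm r p lam f) \<and>
            quasi_optimal_interpolator I X N \<Lambda> (Phi r lam) \<and>
            interpolator_norm X N \<Lambda> (Phi r lam) \<le> ennreal C''))"
proof (intro conjI)
  show "\<exists>C>0. \<exists>C'>0. \<exists>C''>0. \<forall>(p::real) (lam :: int \<Rightarrow> real).
        1 \<le> p \<and> strict_mono lam \<longrightarrow>
        (let I = node_interval lam; \<Lambda> = range lam;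
             X = L_space r p I; N = L_norm r p I
         in (\<forall>f\<in>trace_space X \<Lambda>.
               ennreal C * eqL_norm r p lam f \<le> trace_norm X N \<Lambda> f \<and>
               trace_norm X N \<Lambda> f \<le> ennreal C' * eqL_norm r p lam f) \<and>
            quasi_optimal_interpolator I X N \<Lambda> (Phi r lam) \<and>
            interpolator_norm X N \<Lambda> (Phi r lam) \<le> ennreal C'')"
  \<comment> \<open>6 and 8 are the constants of the two one-sided bounds, and their product bounds
    the operator norm.\<close>
  proof (rule exI[of _ "1 / 6"], rule conjI, simp, rule exI[of _ 8], rule conjI, simp,
      rule exI[of _ "6 * 8"], rule conjI, simp, intro allI impI)
    fix p :: real and lam :: "int \<Rightarrow> real"
    assume *: "1 \<le> p \<and> strict_mono lam"
    then interpret node_sequence lam by (simp add: node_sequence_def)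
    show "let I = node_interval lam; \<Lambda> = range lam; X = L_space r p I; N = L_norm r p I
         in (\<forall>f\<in>trace_space X \<Lambda>.
               ennreal (1 / 6) * eqL_norm r p lam f \<le> trace_norm X N \<Lambda> f \<and>
               trace_norm X N \<Lambda> f \<le> ennreal 8 * eqL_norm r p lam f) \<and>
            quasi_optimal_interpolator I X N \<Lambda> (Phi r lam) \<and>
            interpolator_norm X N \<Lambda> (Phi r lam) \<le> ennreal (6 * 8)"
      unfolding Let_def using * by (intro L_space_interpolation assms) simp
  qed
next
  show "\<forall>K>0. \<exists>C>0. \<exists>C'>0. \<exists>C''>0. \<forall>(p::real) (lam :: int \<Rightarrow> real).
        1 \<le> p \<and> strict_mono lam \<and> (\<forall>n. lam (n + 1) - lam n \<le> K) \<longrightarrow>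
        (let I = node_interval lam; \<Lambda> = range lam;
             X = W_space r p I; N = W_norm r p I
         in (\<forall>f\<in>trace_space X \<Lambda>.
               ennreal C * eqW_norm r p lam f \<le> trace_norm X N \<Lambda> f \<and>
               trace_norm X N \<Lambda> f \<le> ennreal C' * eqW_norm r p lam f) \<and>
            quasi_optimal_interpolator I X N \<Lambda> (Phi r lam) \<and>
            interpolator_norm X N \<Lambda> (Phi r lam) \<le> ennreal C'')"
  proof (intro allI impI)
    fix K :: real assume K: "K > 0"
    \<comment> \<open>These depend on \<open>K\<close> alone, so the witnesses are fixed before
      \<open>p\<close> and \<open>lam\<close>.\<close>
    define A B where "A = 864 * (1 + 2 * K)\<^sup>2" and "B = 16 * (1 + 2 * K)\<^sup>2"
    have "(1 + 2 * K)\<^sup>2 > 0" using K by simp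
    then have pos: "A > 0" "B > 0" by (simp_all add: A_def B_def)
    show "\<exists>C>0. \<exists>C'>0. \<exists>C''>0. \<forall>(p::real) (lam :: int \<Rightarrow> real).
        1 \<le> p \<and> strict_mono lam \<and> (\<forall>n. lam (n + 1) - lam n \<le> K) \<longrightarrow>
        (let I = node_interval lam; \<Lambda> = range lam;
             X = W_space r p I; N = W_norm r p I
         in (\<forall>f\<in>trace_space X \<Lambda>.
               ennreal C * eqW_norm r p lam f \<le> trace_norm X N \<Lambda> f \<and>
               trace_norm X N \<Lambda> f \<le> ennreal C' * eqW_norm r p lam f) \<and>
            quasi_optimal_interpolator I X N \<Lambda> (Phi r lam) \<and>
            interpolator_norm X N \<Lambda> (Phi r lam) \<le> ennreal C'')"
    proof (rule exI[of _ "1 / A"], rule conjI, simp add: pos, rule exI[of _ B], rule conjI, simp add: pos,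
        rule exI[of _ "A * B"], rule conjI, simp add: pos, intro allI impI)
      fix p :: real and lam :: "int \<Rightarrow> real"
      assume *: "1 \<le> p \<and> strict_mono lam \<and> (\<forall>n. lam (n + 1) - lam n \<le> K)"
      then interpret node_sequence lam by (simp add: node_sequence_def)
      show "let I = node_interval lam; \<Lambda> = range lam; X = W_space r p I; N = W_norm r p I
         in (\<forall>f\<in>trace_space X \<Lambda>.
               ennreal (1 / A) * eqW_norm r p lam f \<le> trace_norm X N \<Lambda> f \<and>
               trace_norm X N \<Lambda> f \<le> ennreal B * eqW_norm r p lam f) \<and>
            quasi_optimal_interpolator I X N \<Lambda> (Phi r lam) \<and>
            interpolator_norm X N \<Lambda> (Phi r lam) \<le> ennreal (A * B)"
        unfolding Let_def A_def B_def using * by (intro W_space_interpolation assms) auto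
    qed
  qed
qed

end
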